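(* Let $d_0,d_1$ be positive integers, and identify a quadratic form $\sum_{1\le i\le j\le d_0}c_{ij}x_ix_j\in \mathrm{Sym}_2(\mathbb{R}^{d_0})$ with the symmetric $d_0\times d_0$ matrix $$\begin{pmatrix} c_{11} & \tfrac12 c_{12} & \cdots & \tfrac12 c_{1d_0}\\ \tfrac12 c_{12} & c_{22} & \cdots & \tfrac12 c_{2d_0}\\ \vdots&\vdots&\ddots&\vdots\\ \tfrac12 c_{1d_0} & \tfrac12 c_{2d_0} & \cdots & c_{d_0d_0}\end{pmatrix}.$$ The neuromanifold $\mathcal{M}_{(d_0,d_1,1),2}$ consists of the symmetric $d_0\times d_0$ matrices of this form of rank at most $d_1$. It is equal to its neurovariety $\mathcal{V}_{(d_0,d_1,1),2}$, and the ideal of the neurovariety is generated by all $(d_1+1)\times(d_1+1)$ minors of the symmetric matrix. The architecture $((d_0,d_1,1),2)$ is filling if and only if $d_1\ge d_0$.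
   Context: $\mathrm{Sym}_d(\mathbb{R}^n)$ denotes the real vector space of homogeneous polynomials of degree $d$ in $n$ variables. A polynomial neural network (PNN) with architecture $(\mathbf{d}=(d_0,\dots,d_L),r)$ is the map $p_{\mathbf{w}}=W_L\circ\rho_r\circ W_{L-1}\circ\cdots\circ\rho_r\circ W_1:\mathbb{R}^{d_0}\to\mathbb{R}^{d_L}$, where $W_i\in\mathbb{R}^{d_i\times d_{i-1}}$ are linear maps (weights) $\mathbf{w}=(W_1,\dots,W_L)$ and $\rho_r$ raises each coordinate to the $r$-th power. The components of $p_{\mathbf{w}}$ are homogeneous of degree $r^{L-1}$; the parameter map is $\Psi_{\mathbf{d},r}:\mathbf{w}\mapsto p_{\mathbf{w}}\in(\mathrm{Sym}_{r^{L-1}}(\mathbb{R}^{d_0}))^{d_L}$. The neuromanifold $\mathcal{M}_{\mathbf{d},r}$ is the image of $\Psi_{\mathbf{d},r}$; the neurovariety $\mathcal{V}_{\mathbf{d},r}$ is its Zariski closure in $(\mathrm{Sym}_{r^{L-1}}(\mathbb{R}^{d_0}))^{d_L}$. The ideal of the neurovariety is the ideal of all polynomials in the coefficient coordinates (here $c_{ij}$) vanishing on it. The architecture is filling if $\mathcal{V}_{\mathbf{d},r}=(\mathrm{Sym}_{r^{L-1}}(\mathbb{R}^{d_0}))^{d_L}$. *)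

theory Defs
  imports
    "HOL-Library.Poly_Mapping"
    "HOL-Algebra.Ideal"
    "Jordan_Normal_Form.DL_Rank_Submatrix"
    "Jordan_Normal_Form.Ring_Hom_Matrix"
begin

section \<open>Polynomials\<close>

text \<open>Polynomials over \<open>'a\<close> with indeterminates from the type \<open>'v\<close> are finitely
  supported maps from monomials to coefficients, a monomial being a finitely supported map
  from indeterminates to exponents.\<close>

type_synonym 'v monomial = "'v \<Rightarrow>\<^sub>0 nat"
type_synonym ('v, 'a) mpoly = "'v monomial \<Rightarrow>\<^sub>0 'a"

definition Const :: "'a::zero \<Rightarrow> ('v, 'a) mpoly" where
  "Const a = Poly_Mapping.single 0 a"

definition Var :: "'v \<Rightarrow> ('v, 'a::zero_neq_one) mpoly" where
  "Var v = Poly_Mapping.single (Poly_Mapping.single v 1) 1"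

definition mon_eval :: "('v \<Rightarrow> 'a::comm_semiring_1) \<Rightarrow> 'v monomial \<Rightarrow> 'a" where
  "mon_eval x m = (\<Prod>v\<in>Poly_Mapping.keys m. x v ^ Poly_Mapping.lookup m v)"

definition poly_eval :: "('v \<Rightarrow> 'a::comm_semiring_1) \<Rightarrow> ('v, 'a) mpoly \<Rightarrow> 'a" where
  "poly_eval x p = (\<Sum>m\<in>Poly_Mapping.keys p. Poly_Mapping.lookup p m * mon_eval x m)"

definition mon_degree :: "'v monomial \<Rightarrow> nat" where
  "mon_degree m = (\<Sum>v\<in>Poly_Mapping.keys m. Poly_Mapping.lookup m v)"

definition monomials :: "nat \<Rightarrow> nat \<Rightarrow> nat monomial set" where
  "monomials d n = {m. Poly_Mapping.keys m \<subseteq> {..<n} \<and> mon_degree m = d}"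

text \<open>The space \<open>Sym\<^sub>d(\<real>\<^sup>n)\<close> of forms of degree \<open>d\<close> in the indeterminates
  \<open>0, \<dots>, n - 1\<close>; in particular it contains the zero polynomial.\<close>

definition Sym :: "nat \<Rightarrow> nat \<Rightarrow> (nat, real) mpoly set" where
  "Sym d n = {p. Poly_Mapping.keys p \<subseteq> monomials d n}"

text \<open>The subring of polynomials in the indeterminates from \<open>V\<close>.\<close>

definition poly_ring :: "'v set \<Rightarrow> ('v, 'a::comm_ring_1) mpoly ring" where
  "poly_ring V = \<lparr>carrier = {p. \<forall>m\<in>Poly_Mapping.keys p. Poly_Mapping.keys m \<subseteq> V},
     monoid.mult = (*), one = 1, zero = 0, add = (+)\<rparr>"

lemma poly_eval_superset:
  assumes "finite A" "Poly_Mapping.keys p \<subseteq> A"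
  shows "poly_eval x p = (\<Sum>m\<in>A. Poly_Mapping.lookup p m * mon_eval x m)"
  unfolding poly_eval_def
  by (rule sum.mono_neutral_left) (use assms in \<open>auto simp: in_keys_iff\<close>)

lemma poly_eval_add: "poly_eval x (p + q) = poly_eval x p + poly_eval x q"
proof -
  let ?A = "Poly_Mapping.keys p \<union> Poly_Mapping.keys q"
  have "poly_eval x (p + q) = (\<Sum>m\<in>?A. Poly_Mapping.lookup (p + q) m * mon_eval x m)"
    by (rule poly_eval_superset) (use keys_add[of p q] in auto)
  moreover have "poly_eval x p = (\<Sum>m\<in>?A. Poly_Mapping.lookup p m * mon_eval x m)"
    by (rule poly_eval_superset) auto
  moreover have "poly_eval x q = (\<Sum>m\<in>?A. Poly_Mapping.lookup q m * mon_eval x m)"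
    by (rule poly_eval_superset) auto
  ultimately show ?thesis
    by (simp add: lookup_add sum.distrib distrib_right)
qed

lemma poly_eval_0 [simp]: "poly_eval x 0 = 0"
  by (simp add: poly_eval_def)

lemma poly_eval_sum: "poly_eval x (sum f A) = (\<Sum>a\<in>A. poly_eval x (f a))"
  by (induction A rule: infinite_finite_induct) (auto simp: poly_eval_add)

lemma poly_eval_single: "poly_eval x (Poly_Mapping.single m a) = a * mon_eval x m"
  by (cases "a = 0") (auto simp: poly_eval_def)

lemma mon_eval_superset:
  assumes "finite A" "Poly_Mapping.keys m \<subseteq> A"
  shows "mon_eval x m = (\<Prod>v\<in>A. x v ^ Poly_Mapping.lookup m v)"
  unfolding mon_eval_def
  by (rule prod.mono_neutral_left) (use assms in \<open>auto simp: in_keys_iff\<close>)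

lemma mon_eval_add: "mon_eval x (m + m') = mon_eval x m * mon_eval x m'"
proof -
  let ?A = "Poly_Mapping.keys m \<union> Poly_Mapping.keys m'"
  have "mon_eval x (m + m') = (\<Prod>v\<in>?A. x v ^ Poly_Mapping.lookup (m + m') v)"
    by (rule mon_eval_superset) (use keys_add[of m m'] in auto)
  moreover have "mon_eval x m = (\<Prod>v\<in>?A. x v ^ Poly_Mapping.lookup m v)"
    by (rule mon_eval_superset) auto
  moreover have "mon_eval x m' = (\<Prod>v\<in>?A. x v ^ Poly_Mapping.lookup m' v)"
    by (rule mon_eval_superset) auto
  ultimately show ?thesis
    by (simp add: lookup_add power_add prod.distrib)
qed

lemma mpoly_sum_monomials:
  "p = (\<Sum>m\<in>Poly_Mapping.keys p. Poly_Mapping.single m (Poly_Mapping.lookup p m))"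
  by (rule poly_mapping_eqI)
    (auto simp: lookup_sum lookup_single when_def in_keys_iff)

lemma poly_eval_mult: "poly_eval x (p * q) = poly_eval x p * poly_eval x q"
proof -
  have "poly_eval x (p * q) = poly_eval x
      ((\<Sum>m\<in>Poly_Mapping.keys p. Poly_Mapping.single m (Poly_Mapping.lookup p m)) *
       (\<Sum>m\<in>Poly_Mapping.keys q. Poly_Mapping.single m (Poly_Mapping.lookup q m)))"
    using mpoly_sum_monomials[of p] mpoly_sum_monomials[of q] by simp
  also have "\<dots> = poly_eval x p * poly_eval x q"
    unfolding sum_product poly_eval_sum mult_single poly_eval_single mon_eval_add
    by (simp add: poly_eval_def sum_product mult_ac)
  finally show ?thesis .
qed

lemma poly_eval_Const [simp]: "poly_eval x (Const a) = a"
  by (simp add: Const_def poly_eval_single mon_eval_def)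

lemma poly_eval_Var [simp]: "poly_eval x (Var v) = x v"
  by (simp add: Var_def poly_eval_single mon_eval_def)

lemma poly_eval_hom: "comm_semiring_hom (poly_eval x)"
  by unfold_locales (auto simp: poly_eval_add poly_eval_mult simp flip: single_one
      simp: poly_eval_single mon_eval_def)

lemma cring_poly_ring: "cring (poly_ring V)"
proof (rule cringI)
  show "abelian_group (poly_ring V)"
  proof (rule abelian_groupI, goal_cases)
    case (1 p q)
    then show ?case using keys_add[of p q] by (auto simp: poly_ring_def)
  next
    case (6 p)
    then have "- p \<in> carrier (poly_ring V)" by (simp add: poly_ring_def in_keys_iff)
    then show ?case by (rule rev_bexI) (simp add: poly_ring_def)
  qed (auto simp: poly_ring_def add_ac)
  show "Group.comm_monoid (poly_ring V)"
  proof (rule Group.comm_monoidI, goal_cases)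
    case (1 p q)
    show ?case unfolding poly_ring_def
    proof (simp, intro ballI)
      fix m assume "m \<in> Poly_Mapping.keys (p * q)"
      then obtain a b where "m = a + b" "a \<in> Poly_Mapping.keys p" "b \<in> Poly_Mapping.keys q"
        using keys_mult by blast
      then show "Poly_Mapping.keys m \<subseteq> V"
        using 1 keys_add[of a b] by (fastforce simp: poly_ring_def)
    qed
  qed (auto simp: poly_ring_def mult_ac)
qed (auto simp: poly_ring_def distrib_right)


section \<open>Polynomial neural networks\<close>

text \<open>An architecture is the list \<open>ds = [d\<^sub>0, \<dots>, d\<^sub>L]\<close> with \<open>L \<ge> 1\<close>, together with the
  exponent \<open>r\<close>; a list of weights is \<open>[W\<^sub>1, \<dots>, W\<^sub>L]\<close>.\<close>

definition weights :: "nat list \<Rightarrow> real mat list set" where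
  "weights ds = {Ws. length Ws + 1 = length ds \<and>
     (\<forall>i<length Ws. Ws ! i \<in> carrier_mat (ds ! (i + 1)) (ds ! i))}"

text \<open>The network map over an arbitrary commutative semiring. Over the reals this is
  \<open>p\<^sub>w\<close> as a map \<open>\<real>\<^bsup>d\<^sub>0\<^esup> \<rightarrow> \<real>\<^bsup>d\<^sub>L\<^esup>\<close>; run on the vector of
  indeterminates it gives \<open>p\<^sub>w\<close> as a tuple of polynomials.\<close>

fun pnn :: "nat \<Rightarrow> 'a::comm_semiring_1 mat list \<Rightarrow> 'a vec \<Rightarrow> 'a vec" where
  "pnn r [] x = x"
| "pnn r [W] x = W *\<^sub>v x"
| "pnn r (W # W' # Ws) x = pnn r (W' # Ws) (map_vec (\<lambda>t. t ^ r) (W *\<^sub>v x))"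

definition param_map :: "nat list \<Rightarrow> nat \<Rightarrow> real mat list \<Rightarrow> (nat, real) mpoly vec" where
  "param_map ds r Ws = pnn r (map (map_mat Const) Ws) (vec (hd ds) Var)"

text \<open>Evaluating the tuple of polynomials gives back the map \<open>p\<^sub>w\<close>.\<close>

lemma (in comm_semiring_hom) pnn_hom:
  assumes "length Ws + 1 = length ds"
    and "\<forall>i<length Ws. Ws ! i \<in> carrier_mat (ds ! (i + 1)) (ds ! i)"
    and "x \<in> carrier_vec (hd ds)"
  shows "map_vec hom (pnn r Ws x) = pnn r (map (map_mat hom) Ws) (map_vec hom x) \<and>
    pnn r Ws x \<in> carrier_vec (last ds)"
  using assms
proof (induction r Ws x arbitrary: ds rule: pnn.induct)
  case (1 r x)
  then show ?case by (cases ds) auto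
next
  case (2 r W x)
  then obtain a b where "ds = [a, b]"
    by (cases ds; cases "tl ds") auto
  with 2 show ?case by (auto simp: mult_mat_vec_hom[where n = a and nr = b])
next
  case (3 r W W' Ws x)
  then obtain a b es where ds: "ds = a # b # es"
    by (cases ds; cases "tl ds") auto
  have W: "W \<in> carrier_mat b a" and x: "x \<in> carrier_vec a"
    using 3(3,4) ds by force+
  let ?y = "map_vec (\<lambda>t. t ^ r) (W *\<^sub>v x)"
  have "\<forall>i<length (W' # Ws). (W' # Ws) ! i \<in> carrier_mat ((b # es) ! (i + 1)) ((b # es) ! i)"
    using 3(3) ds by force
  then have IH: "map_vec hom (pnn r (W' # Ws) ?y) =
      pnn r (map (map_mat hom) (W' # Ws)) (map_vec hom ?y) \<and>
      pnn r (W' # Ws) ?y \<in> carrier_vec (last (b # es))"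
    using 3(2) W x ds by (intro 3(1)) (auto intro: mult_mat_vec_carrier)
  have "map_vec hom ?y = map_vec (\<lambda>t. t ^ r) (map_mat hom W *\<^sub>v map_vec hom x)"
    unfolding mult_mat_vec_hom[OF W x, symmetric] by (rule eq_vecI) (auto simp: hom_power)
  with IH ds show ?case by simp
qed

lemma poly_eval_param_map:
  assumes "Ws \<in> weights ds" and "x \<in> carrier_vec (hd ds)"
  shows "map_vec (poly_eval (\<lambda>i. x $ i)) (param_map ds r Ws) = pnn r Ws x"
proof -
  let ?e = "poly_eval (\<lambda>i. x $ i)"
  interpret comm_semiring_hom ?e by (rule poly_eval_hom)
  let ?Us = "map (map_mat Const) Ws :: (nat, real) mpoly mat list"
  have "map (map_mat ?e) ?Us = Ws"
    by (rule nth_equalityI) (auto intro!: eq_matI)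
  moreover have "map_vec ?e (vec (hd ds) Var) = x"
    using assms(2) by (intro eq_vecI) auto
  moreover have "map_vec ?e (pnn r ?Us (vec (hd ds) Var)) =
      pnn r (map (map_mat ?e) ?Us) (map_vec ?e (vec (hd ds) Var))"
    using pnn_hom[of ?Us ds "vec (hd ds) Var" r] assms(1) by (auto simp: weights_def)
  ultimately show ?thesis by (simp add: param_map_def)
qed

abbreviation out_degree :: "nat list \<Rightarrow> nat \<Rightarrow> nat" where
  "out_degree ds r \<equiv> r ^ (length ds - 2)"  \<comment> \<open>\<open>length ds - 2 = L - 1\<close>\<close>

definition target_space :: "nat list \<Rightarrow> nat \<Rightarrow> (nat, real) mpoly vec set" where
  "target_space ds r =
     {F \<in> carrier_vec (last ds). \<forall>k<last ds. F $ k \<in> Sym (out_degree ds r) (hd ds)}"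

definition neuromanifold :: "nat list \<Rightarrow> nat \<Rightarrow> (nat, real) mpoly vec set" where
  "neuromanifold ds r = param_map ds r ` weights ds"

text \<open>The coordinate with index \<open>(k, m)\<close> on the target space is the coefficient of the
  monomial \<open>m\<close> in the \<open>k\<close>-th component.\<close>

definition coord_index :: "nat list \<Rightarrow> nat \<Rightarrow> (nat \<times> nat monomial) set" where
  "coord_index ds r = {..<last ds} \<times> monomials (out_degree ds r) (hd ds)"

definition coords :: "(nat, real) mpoly vec \<Rightarrow> nat \<times> nat monomial \<Rightarrow> real" where
  "coords F = (\<lambda>(k, m). Poly_Mapping.lookup (F $ k) m)"

definition coord_ring :: "nat list \<Rightarrow> nat \<Rightarrow> (nat \<times> nat monomial, real) mpoly ring" where
  "coord_ring ds r = poly_ring (coord_index ds r)"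

definition vanishing_ideal ::
    "nat list \<Rightarrow> nat \<Rightarrow> (nat, real) mpoly vec set \<Rightarrow> (nat \<times> nat monomial, real) mpoly set" where
  "vanishing_ideal ds r S = {q \<in> carrier (coord_ring ds r). \<forall>F\<in>S. poly_eval (coords F) q = 0}"

definition zariski_closure ::
    "nat list \<Rightarrow> nat \<Rightarrow> (nat, real) mpoly vec set \<Rightarrow> (nat, real) mpoly vec set" where
  "zariski_closure ds r S =
     {F \<in> target_space ds r. \<forall>q\<in>vanishing_ideal ds r S. poly_eval (coords F) q = 0}"

definition neurovariety :: "nat list \<Rightarrow> nat \<Rightarrow> (nat, real) mpoly vec set" where
  "neurovariety ds r = zariski_closure ds r (neuromanifold ds r)"

definition filling :: "nat list \<Rightarrow> nat \<Rightarrow> bool" where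
  "filling ds r \<longleftrightarrow> neurovariety ds r = target_space ds r"


section \<open>Quadratic forms and symmetric matrices\<close>

text \<open>Here \<open>c\<^sub>i\<^sub>j\<close> is the coefficient of \<open>x\<^sub>i x\<^sub>j = x\<^sub>j x\<^sub>i\<close>, with indices from \<open>0\<close>.\<close>

definition quad_mon :: "nat \<Rightarrow> nat \<Rightarrow> nat monomial" where
  "quad_mon i j = Poly_Mapping.single i 1 + Poly_Mapping.single j 1"

definition quad_mat :: "nat \<Rightarrow> (nat, real) mpoly \<Rightarrow> real mat" where
  "quad_mat n f =
     mat n n (\<lambda>(i, j). (if i = j then 1 else 1/2) * Poly_Mapping.lookup f (quad_mon i j))"

text \<open>The identification of \<open>Sym\<^sub>2(\<real>\<^sup>n)\<close> with the symmetric matrices.\<close>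

lemma quad_mon_eq_iff:
  "quad_mon i j = quad_mon k l \<longleftrightarrow> (i = k \<and> j = l) \<or> (i = l \<and> j = k)"
proof
  assume "quad_mon i j = quad_mon k l"
  then have "Poly_Mapping.lookup (quad_mon i j) v = Poly_Mapping.lookup (quad_mon k l) v" for v
    by simp
  from this[of i] this[of j] this[of k] this[of l]
  show "(i = k \<and> j = l) \<or> (i = l \<and> j = k)"
    by (auto simp: quad_mon_def lookup_add lookup_single when_def split: if_splits)
qed (auto simp: quad_mon_def add.commute)

lemma monomials_2: "monomials 2 n = {quad_mon i j | i j. i < n \<and> j < n}"
proof (intro equalityI subsetI)
  fix m assume "m \<in> monomials 2 n"
  then have k: "Poly_Mapping.keys m \<subseteq> {..<n}"
    and d: "(\<Sum>v\<in>Poly_Mapping.keys m. Poly_Mapping.lookup m v) = 2"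
    by (auto simp: monomials_def mon_degree_def)
  then obtain i where i: "i \<in> Poly_Mapping.keys m"
    by (metis equals0I sum.empty zero_neq_numeral)
  let ?m = "m - Poly_Mapping.single i 1"
  have m: "m = Poly_Mapping.single i 1 + ?m"
    by (rule poly_mapping_eqI)
      (use i in \<open>auto simp: lookup_add lookup_minus lookup_single when_def in_keys_iff\<close>)
  have d1: "(\<Sum>v\<in>Poly_Mapping.keys m. Poly_Mapping.lookup ?m v) = 1"
  proof -
    have "(\<Sum>v\<in>Poly_Mapping.keys m. Poly_Mapping.lookup m v) =
      (\<Sum>v\<in>Poly_Mapping.keys m. Poly_Mapping.lookup (Poly_Mapping.single i (1::nat)) v +
         Poly_Mapping.lookup ?m v)"
      by (rule sum.cong) (simp, subst m, simp only: lookup_add)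
    also have "\<dots> = 1 + (\<Sum>v\<in>Poly_Mapping.keys m. Poly_Mapping.lookup ?m v)"
      using i by (simp add: sum.distrib lookup_single when_def)
    finally show ?thesis using d by simp
  qed
  then obtain j where j: "j \<in> Poly_Mapping.keys m" "Poly_Mapping.lookup ?m j = 1"
    and o: "\<forall>v\<in>Poly_Mapping.keys m. v \<noteq> j \<longrightarrow> Poly_Mapping.lookup ?m v = 0"
    using sum_eq_1_iff[of "Poly_Mapping.keys m" "Poly_Mapping.lookup ?m"] by auto
  have "?m = Poly_Mapping.single j 1"
  proof (rule poly_mapping_eqI)
    fix v
    show "Poly_Mapping.lookup ?m v = Poly_Mapping.lookup (Poly_Mapping.single j 1) v"
    proof (cases "v \<in> Poly_Mapping.keys m")
      case True
      then show ?thesis using j o by (auto simp: lookup_single when_def)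
    next
      case False
      then have "Poly_Mapping.lookup ?m v = 0" by (simp add: lookup_minus in_keys_iff)
      moreover have "v \<noteq> j" using False j by auto
      ultimately show ?thesis by (simp add: lookup_single when_def)
    qed
  qed
  then have "m = quad_mon i j" using m by (simp add: quad_mon_def)
  then show "m \<in> {quad_mon i j | i j. i < n \<and> j < n}" using i j k by auto
next
  fix m assume "m \<in> {quad_mon i j | i j. i < n \<and> j < n}"
  then obtain i j where m: "m = quad_mon i j" and ij: "i < n" "j < n" by auto
  have k: "Poly_Mapping.keys m = {i, j}"
    by (auto simp: m quad_mon_def in_keys_iff lookup_add lookup_single when_def split: if_splits)
  have "mon_degree m = 2"
    unfolding mon_degree_def k
    by (cases "i = j") (auto simp: m quad_mon_def lookup_add lookup_single when_def)
  then show "m \<in> monomials 2 n" using k ij by (auto simp: monomials_def)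
qed

lemma quad_mat_bij:
  "bij_betw (quad_mat n) (Sym 2 n) {A \<in> carrier_mat n n. transpose_mat A = A}"
proof (rule bij_betw_imageI)
  show "inj_on (quad_mat n) (Sym 2 n)"
  proof (rule inj_onI, rule poly_mapping_eqI)
    fix f g m assume fg: "f \<in> Sym 2 n" "g \<in> Sym 2 n" and eq: "quad_mat n f = quad_mat n g"
    show "Poly_Mapping.lookup f m = Poly_Mapping.lookup g m"
    proof (cases "m \<in> monomials 2 n")
      case True
      then obtain i j where ij: "m = quad_mon i j" "i < n" "j < n" by (auto simp: monomials_2)
      have "quad_mat n f $$ (i, j) = quad_mat n g $$ (i, j)" using eq by simp
      with ij show ?thesis by (auto simp: quad_mat_def split: if_splits)
    next
      case False
      then have "m \<notin> Poly_Mapping.keys f" "m \<notin> Poly_Mapping.keys g"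
        using fg by (auto simp: Sym_def)
      then show ?thesis by (simp add: in_keys_iff)
    qed
  qed
  show "quad_mat n ` Sym 2 n = {A \<in> carrier_mat n n. transpose_mat A = A}"
  proof (intro equalityI subsetI)
    fix A assume "A \<in> quad_mat n ` Sym 2 n"
    then show "A \<in> {A \<in> carrier_mat n n. transpose_mat A = A}"
      by (auto simp: quad_mat_def quad_mon_def add.commute intro!: eq_matI)
  next
    fix A :: "real mat" assume "A \<in> {A \<in> carrier_mat n n. transpose_mat A = A}"
    then have A: "A \<in> carrier_mat n n" and t: "transpose_mat A = A" by auto
    have sym: "A $$ (i, j) = A $$ (j, i)" if "i < n" "j < n" for i j
      using A that arg_cong[OF t, of "\<lambda>B. B $$ (j, i)"] by simp
    define f where "f = (\<Sum>i<n. \<Sum>j<n. Poly_Mapping.single (quad_mon i j) (A $$ (i, j)))"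
    have "Poly_Mapping.keys f \<subseteq> monomials 2 n"
    proof
      fix m assume "m \<in> Poly_Mapping.keys f"
      then have "(\<Sum>i<n. \<Sum>j<n. A $$ (i, j) when quad_mon i j = m) \<noteq> 0"
        by (simp add: f_def in_keys_iff lookup_sum lookup_single)
      then obtain i where i: "i < n" "(\<Sum>j<n. A $$ (i, j) when quad_mon i j = m) \<noteq> 0"
        by (meson lessThan_iff sum.not_neutral_contains_not_neutral)
      then obtain j where "j < n" "(A $$ (i, j) when quad_mon i j = m) \<noteq> 0"
        by (meson lessThan_iff sum.not_neutral_contains_not_neutral)
      with i show "m \<in> monomials 2 n" by (auto simp: monomials_2 when_def split: if_splits)
    qed
    moreover have "quad_mat n f = A"
    proof (rule eq_matI)
      fix k l assume "k < dim_row A" "l < dim_col A"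
      then have kl: "k < n" "l < n" using A by auto
      have "Poly_Mapping.lookup f (quad_mon k l) =
          (\<Sum>(i, j)\<in>{..<n} \<times> {..<n}. A $$ (i, j) when quad_mon i j = quad_mon k l)"
        by (simp add: f_def lookup_sum lookup_single flip: sum.cartesian_product)
      also have "\<dots> = (\<Sum>(i, j)\<in>{(k, l), (l, k)}. A $$ (i, j) when quad_mon i j = quad_mon k l)"
        using kl by (intro sum.mono_neutral_right) (auto simp: quad_mon_eq_iff when_def split: if_splits)
      also have "\<dots> = (if k = l then 1 else 2) * A $$ (k, l)"
        using sym[OF kl] by (auto simp: quad_mon_eq_iff when_def)
      finally show "quad_mat n f $$ (k, l) = A $$ (k, l)"
        using kl by (auto simp: quad_mat_def)
    qed (use A in \<open>auto simp: quad_mat_def\<close>)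
    ultimately show "A \<in> quad_mat n ` Sym 2 n" by (auto simp: Sym_def)
  qed
qed

text \<open>The same matrix with the coefficients \<open>c\<^sub>i\<^sub>j\<close> as indeterminates, i.e. with entries in
  the coordinate ring of an architecture with one-dimensional output.\<close>

definition generic_quad_mat :: "nat \<Rightarrow> (nat \<times> nat monomial, real) mpoly mat" where
  "generic_quad_mat n =
     mat n n (\<lambda>(i, j). Const (if i = j then 1 else 1/2) * Var (0, quad_mon i j))"

lemma eval_generic_quad_mat:
  "map_mat (poly_eval (coords F)) (generic_quad_mat n) = quad_mat n (F $ 0)"
  by (rule eq_matI)
    (auto simp: generic_quad_mat_def quad_mat_def poly_eval_mult coords_def)

definition minors :: "nat \<Rightarrow> 'a::comm_ring_1 mat \<Rightarrow> 'a set" where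
  "minors k A = {det (submatrix A I J) | I J.
     I \<subseteq> {..<dim_row A} \<and> J \<subseteq> {..<dim_col A} \<and> card I = k \<and> card J = k}"

end

theory Submission
  imports Defs "HOL-Library.Product_Lexorder"
begin

text \<open>A network with architecture \<open>((n, r, 1), 2)\<close> computes \<open>\<Sum>k<r. w\<^sub>k (l\<^sub>k \<bullet> x)\<^sup>2\<close>, whose
symmetric matrix is \<open>\<Sum>k<r. w\<^sub>k l\<^sub>k l\<^sub>k\<^sup>T\<close> (\<open>neuromanifold_shallow\<close>). That these are exactly the
symmetric matrices of rank at most \<open>r\<close>, and that they form a Zariski closed set, both come from
diagonalizing a symmetric form: either Gram--Schmidt stops after at most \<open>r\<close> steps and
writes \<open>A\<close> as such a sum, or it produces \<open>x\<^sub>0, \<dots>, x\<^sub>r\<close> with \<open>det (x\<^sub>i\<^sup>T A x\<^sub>j) \<noteq> 0\<close>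
(\<open>low_rank_or_nondegenerate\<close>). The second case is impossible if \<open>A\<close> has rank at most \<open>r\<close>, and also
if \<open>A\<close> satisfies all the polynomial equations of the neuromanifold, one of which is
\<open>det (x\<^sub>i\<^sup>T S x\<^sub>j) = 0\<close>.

The deep part is the second fundamental theorem for the orthogonal group: a polynomial \<open>f\<close> vanishing on
these matrices lies in the ideal \<open>I\<close> of the \<open>(r + 1)\<close>-minors (\<open>vanishing_iff_det_ideal\<close>). The
proof uses highest weights for the action \<open>S \<mapsto> g S g\<^sup>T\<close> of \<open>GL\<^sub>n\<close>, in infinitesimal form. The Lie
algebra acts by the polarization operators \<open>E\<^sub>a\<^sub>b = \<Sum>l. s\<^sub>a\<^sub>l \<partial>\<^sub>b\<^sub>l\<close>, and for a suitable Fischer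
inner product on polynomials \<open>E\<^sub>a\<^sub>b\<close> is adjoint to \<open>E\<^sub>b\<^sub>a\<close> (\<open>polar_adjoint\<close>). Both the space \<open>V\<close> of
polynomials vanishing on the matrices of bounded rank and the orthogonal complement of \<open>I\<close> are
stable under all \<open>E\<^sub>a\<^sub>b\<close> with \<open>a \<noteq> b\<close> (\<open>vanishing_polar\<close>, \<open>perp_minors_polar\<close>) and are
graded by weight. Decomposing \<open>f = p + h\<close> orthogonally with \<open>p \<in> I\<close>, it remains to see that
\<open>V \<inter> I\<^sup>\<bottom> = 0\<close> (\<open>vanishing_perp_minors_zero\<close>).

By induction on the weight, a weight vector \<open>h\<close> of \<open>V \<inter> I\<^sup>\<bottom>\<close> is killed by
all \<open>E\<^sub>a\<^sub>b\<close> with \<open>a < b\<close>. Hence \<open>h\<close> is invariant under unipotent lower triangular congruences, and by the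
LDL decomposition it is determined by its values on diagonal matrices. There it is a monomial,
so \<open>h = c \<Prod>\<^sub>i \<delta>\<^sub>i\<^bsup>e\<^sub>i\<^esup>\<close> in terms of the leading principal minors \<open>\<delta>\<^sub>i\<close>. Were \<open>h\<close> nonzero, its vanishing on
a diagonal matrix of rank at most \<open>r\<close> would force a factor \<open>\<delta>\<^sub>i\<close> with \<open>i > r\<close>, so that
\<open>h \<in> I\<close> (\<open>unip_inv_homog_in_det_ideal\<close>); being orthogonal to \<open>I\<close>, \<open>h\<close> would be orthogonal to itself.\<close>

section \<open>Polynomials\<close>

abbreviation "keys \<equiv> Poly_Mapping.keys"
abbreviation "lookup \<equiv> Poly_Mapping.lookup"
abbreviation "single \<equiv> Poly_Mapping.single"

lemma mpoly_single_induct [case_names single add]: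
  assumes "\<And>m a. P (single m a)" and "\<And>f g. P f \<Longrightarrow> P g \<Longrightarrow> P (f + g)"
  shows "P (f :: ('v, 'a::comm_monoid_add) mpoly)"
proof -
  have "P (\<Sum>m\<in>A. single m (lookup f m))" if "finite A" for A
    using that
  proof induction
    case empty
    show ?case using assms(1)[of 0 0] by simp
  qed (auto intro: assms)
  from this[OF finite_keys[of f]] show ?thesis
    by (subst mpoly_sum_monomials)
qed

lemma Const_simps [simp]:
  "Const (0::'a::zero) = 0" "Const (1::'b::comm_semiring_1) = 1"
  by (auto simp: Const_def)

lemma Const_add: "Const (a + b) = Const a + Const (b::'a::comm_semiring_1)"
  and Const_mult: "Const (a * b) = Const a * Const (b::'a::comm_semiring_1)"
  by (auto simp: Const_def single_add mult_single)

lemma Const_diff: "Const (a - b) = Const a - Const (b::'a::comm_ring_1)"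
  by (simp add: Const_def single_diff)

lemma Const_times_single: "Const a * single m b = single m (a * (b::'a::comm_semiring_1))"
  by (simp add: Const_def mult_single)

lemma Var_times_single:
  "Var v * single m b = single (m + single v 1) (b::'a::comm_semiring_1)"
  by (simp add: Var_def mult_single add.commute)

lemma lookup_Const_times: "lookup (Const a * f) m = a * lookup f (m::'v monomial)"
  for f :: "('v, 'a::comm_semiring_1) mpoly"
  by (induction f rule: mpoly_single_induct)
    (auto simp: Const_times_single lookup_single when_def distrib_left lookup_add)

lemma poly_eval_1 [simp]: "poly_eval x 1 = 1"
  by (simp flip: single_one add: poly_eval_single mon_eval_def)

lemma poly_eval_diff: "poly_eval x (p - q) = poly_eval x p - poly_eval x (q::('v,'a::comm_ring_1) mpoly)"
  using poly_eval_add[of x "p - q" q] by simp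

lemma poly_eval_ring_hom: "comm_ring_hom (poly_eval x :: ('v,'a::comm_ring_1) mpoly \<Rightarrow> 'a)"
proof -
  interpret comm_semiring_hom "poly_eval x :: ('v,'a) mpoly \<Rightarrow> 'a" by (rule poly_eval_hom)
  show ?thesis by unfold_locales
qed

section \<open>The subring of polynomials in given indeterminates\<close>

abbreviation "polys V \<equiv> carrier (poly_ring V)"

lemma polys_iff: "p \<in> polys V \<longleftrightarrow> (\<forall>m\<in>keys p. keys m \<subseteq> V)"
  by (simp add: poly_ring_def)

lemma polys_single: "a = 0 \<or> keys m \<subseteq> V \<Longrightarrow> single m a \<in> polys V"
  by (auto simp: polys_iff)

lemma polys_0 [simp]: "0 \<in> polys V" and polys_1 [simp]: "1 \<in> polys V"
  and polys_Const [simp]: "Const a \<in> polys V"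
  and polys_Var: "v \<in> V \<Longrightarrow> Var v \<in> polys V"
  by (auto simp: polys_iff Const_def Var_def)

lemma polys_add: "p \<in> polys V \<Longrightarrow> q \<in> polys V \<Longrightarrow> p + q \<in> polys V"
  and polys_mult: "p \<in> polys V \<Longrightarrow> q \<in> polys V \<Longrightarrow> p * q \<in> polys V"
  using cring.cring_simprules(1)[OF cring_poly_ring[of V], of p q]
    cring.cring_simprules(5)[OF cring_poly_ring[of V], of p q]
  by (simp_all add: poly_ring_def)

lemma polys_uminus: "p \<in> polys V \<Longrightarrow> - p \<in> polys V"
  by (auto simp: polys_iff in_keys_iff)

lemma polys_diff: "p \<in> polys V \<Longrightarrow> q \<in> polys V \<Longrightarrow> p - q \<in> polys V"
  using polys_add[of p V "- q"] polys_uminus[of q V] by simp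

lemma polys_sum: "(\<And>a. a \<in> A \<Longrightarrow> f a \<in> polys V) \<Longrightarrow> sum f A \<in> polys V"
  by (induction A rule: infinite_finite_induct) (auto intro: polys_add)

lemma polys_prod: "(\<And>a. a \<in> A \<Longrightarrow> f a \<in> polys V) \<Longrightarrow> prod f A \<in> polys V"
  by (induction A rule: infinite_finite_induct) (auto intro: polys_mult)

lemma polys_power: "p \<in> polys V \<Longrightarrow> p ^ k \<in> polys V"
  by (induction k) (auto intro: polys_mult)

lemma polys_det:
  assumes "\<And>i j. i < k \<Longrightarrow> j < k \<Longrightarrow> M i j \<in> polys V"
  shows "det (mat k k (\<lambda>(i, j). M i j)) \<in> polys V"
proof -
  have *: "signof p \<in> polys V" for p
    by (auto simp: sign_def intro: polys_uminus)
  show ?thesis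
    unfolding det_def
    by (auto intro!: polys_sum polys_mult * polys_prod assms dest: permutes_in_image)
qed

text \<open>Every term is a product of a constant and indeterminates; this reduces the induction principle below to sums of terms.\<close>

lemma single_split: "single m a = Const a * (\<Prod>v\<in>keys m. Var v ^ lookup m v)"
  for a :: "'a::comm_semiring_1"
proof -
  have P: "Var v ^ k = single (single v k) (1::'a)" for v :: 'v and k
    by (induction k) (auto simp: Var_def mult_single single_add[symmetric] simp flip: single_one)
  have "(\<Prod>v\<in>A. Var v ^ lookup m v) = single (\<Sum>v\<in>A. single v (lookup m v)) (1::'a)" if "finite A" for A
    using that by induction (auto simp: P mult_single)
  moreover have "(\<Sum>v\<in>keys m. single v (lookup m v)) = m"
    by (rule poly_mapping_eqI) (auto simp: lookup_sum lookup_single when_def in_keys_iff)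
  ultimately show ?thesis by (simp add: Const_times_single)
qed

lemma polys_induct [consumes 1, case_names Const Var add mult]:
  fixes P :: "('v, 'a::comm_ring_1) mpoly \<Rightarrow> bool"
  assumes "f \<in> polys V" and C: "\<And>a. P (Const a)" and V: "\<And>v. v \<in> V \<Longrightarrow> P (Var v)"
    and A: "\<And>f g. f \<in> polys V \<Longrightarrow> g \<in> polys V \<Longrightarrow> P f \<Longrightarrow> P g \<Longrightarrow> P (f + g)"
    and M: "\<And>f g. f \<in> polys V \<Longrightarrow> g \<in> polys V \<Longrightarrow> P f \<Longrightarrow> P g \<Longrightarrow> P (f * g)"
  shows "P f"
proof -
  have sm: "P (single m a) \<and> single m a \<in> polys V" if "keys m \<subseteq> V" for m a
  proof -
    have pw: "P (Var v ^ k)" if "v \<in> V" for v k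
      using that C[of 1] by (induction k) (auto intro: M V polys_power polys_Var)
    have "P (\<Prod>v\<in>A. Var v ^ lookup m v)" if "finite A" "A \<subseteq> V" for A
      using that
      by (induction A rule: finite_induct) (use C[of 1] in \<open>auto intro!: M pw polys_power polys_Var polys_prod\<close>)
    then show ?thesis
      using that unfolding single_split[of m a]
      by (auto intro!: M C polys_mult polys_prod polys_power polys_Var)
  qed
  have "P (\<Sum>m\<in>A. single m (lookup f m))" if "finite A" "A \<subseteq> keys f" for A
    using that
  proof (induction A)
    case empty
    then show ?case using C[of 0] by simp
  next
    case (insert m A)
    with sm assms(1) show ?case by (auto simp: polys_iff[of f] intro!: A polys_sum)
  qed
  then show ?thesis
    by (subst mpoly_sum_monomials) simp
qed

lemma poly_eval_cong:
  assumes "f \<in> polys V" "\<And>v. v \<in> V \<Longrightarrow> x v = y v"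
  shows "poly_eval x f = poly_eval y f"
  unfolding poly_eval_def mon_eval_def
  by (intro sum.cong refl arg_cong2[where f = "(*)"] prod.cong arg_cong2[where f = "(^)"])
    (use assms in \<open>auto simp: polys_iff\<close>)

section \<open>Polynomials are determined by their values\<close>

text \<open>Splitting off one indeterminate is the induction step of the identity theorem below.\<close>

lemma mon_eval_update:
  assumes "v \<notin> keys m'" "m = m' + single v k"
  shows "mon_eval x m = mon_eval x m' * x v ^ k"
  unfolding assms(2) mon_eval_add by (auto simp: mon_eval_def)

text \<open>Induction on the indeterminates: for fixed values of the others, the sum is a univariate polynomial in
the new indeterminate \<open>v\<close>. It has infinitely many roots, so each of its coefficients is zero, and the
coefficient of \<open>v\<^sup>k\<close> is again a sum of the same kind.\<close>

lemma poly_eval_zero_imp_coeff_zero: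
  fixes c :: "'v monomial \<Rightarrow> real"
  assumes "finite V" "finite K" "\<And>m. m \<in> K \<Longrightarrow> keys m \<subseteq> V"
    and "\<And>x. (\<Sum>m\<in>K. c m * mon_eval x m) = 0" and "m \<in> K"
  shows "c m = 0"
  using assms
proof (induction V arbitrary: K c m rule: finite_induct)
  case empty
  then have "K = {0}" by (auto simp: keys_eq_empty)
  with empty.prems(3)[of "\<lambda>_. 0"] empty.prems(4) show ?case by (auto simp: mon_eval_def)
next
  case (insert v V)
  define res where "res m = m - single v (lookup m v)" for m :: "'v monomial"
  have lres: "lookup (res m) u = (if u = v then 0 else lookup m u)" for m u
    by (auto simp: res_def lookup_minus lookup_single when_def)
  have kres: "keys (res m) = keys m - {v}" for m
    by (auto simp: in_keys_iff lres split: if_splits)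
  have res: "m = res m + single v (lookup m v)" for m
    by (rule poly_mapping_eqI) (auto simp: lookup_add lres lookup_single when_def)
  have me: "mon_eval x m = mon_eval x (res m) * x v ^ lookup m v" for x :: "'v \<Rightarrow> real" and m
    by (rule mon_eval_update[OF _ res]) (simp add: kres)
  define k where "k = lookup m v"
  define K' where "K' = {m \<in> K. lookup m v = k}"
  have inj: "inj_on res K'"
    by (rule inj_onI) (metis (mono_tags, lifting) K'_def mem_Collect_eq res)
  have zero: "(\<Sum>m\<in>res ` K'. c (m + single v k) * mon_eval x m) = 0" for x
  proof -
    define p :: "real poly" where
      "p = (\<Sum>m\<in>K. monom (c m * mon_eval x (res m)) (lookup m v))"
    have "poly p t = 0" for t
    proof -
      have "mon_eval (x(v := t)) (res m) = mon_eval x (res m)" for m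
        unfolding mon_eval_def by (rule prod.cong) (auto simp: kres)
      then have "mon_eval (x(v := t)) m = mon_eval x (res m) * t ^ lookup m v" for m
        by (subst me) simp
      then have "(\<Sum>m\<in>K. c m * mon_eval (x(v := t)) m) = poly p t"
        by (simp add: p_def poly_sum poly_monom mult.assoc)
      with insert.prems(3) show ?thesis by metis
    qed
    then have "p = 0" using poly_all_0_iff_0 by auto
    then have "0 = coeff p k" by simp
    also have "\<dots> = (\<Sum>m\<in>K'. c m * mon_eval x (res m))"
      unfolding p_def K'_def coeff_sum coeff_monom
      by (intro sum.mono_neutral_cong_right) (use insert.prems(1) in auto)
    also have "\<dots> = (\<Sum>m\<in>K'. c (res m + single v k) * mon_eval x (res m))"
      by (rule sum.cong) (auto simp: K'_def res[symmetric])
    also have "\<dots> = (\<Sum>m\<in>res ` K'. c (m + single v k) * mon_eval x m)"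
      by (simp add: sum.reindex[OF inj])
    finally show ?thesis by simp
  qed
  have "keys m' \<subseteq> V" if "m' \<in> res ` K'" for m'
    using that insert.prems(2) by (fastforce simp: K'_def kres)
  moreover have "finite (res ` K')" "res m \<in> res ` K'"
    using insert.prems(1,4) by (auto simp: K'_def k_def)
  ultimately have "c (res m + single v k) = 0"
    using insert.IH[OF _ _ zero] by blast
  then show ?case by (simp add: k_def res[symmetric])
qed

lemma poly_eval_zero_imp_zero:
  fixes f :: "('v, real) mpoly"
  assumes "\<And>x. poly_eval x f = 0"
  shows "f = 0"
proof -
  have "lookup f m = 0" if "m \<in> keys f" for m
    by (rule poly_eval_zero_imp_coeff_zero[of "\<Union> (keys ` keys f)" "keys f" "lookup f"])
      (use assms that in \<open>auto simp: poly_eval_def\<close>)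
  then show ?thesis by (intro poly_mapping_eqI) (auto simp: in_keys_iff)
qed

section \<open>Partial derivatives\<close>

definition partial :: "'v \<Rightarrow> ('v, 'a::comm_semiring_1) mpoly \<Rightarrow> ('v, 'a) mpoly" where
  "partial v f = (\<Sum>m\<in>keys f. single (m - single v 1) (of_nat (lookup m v) * lookup f m))"

lemma lookup_partial:
  fixes m :: "'v monomial" and f :: "('v, 'a::comm_semiring_1) mpoly"
  shows "lookup (partial v f) m = of_nat (lookup m v + 1) * lookup f (m + single v 1)"
proof -
  have eq: "m' - single v 1 = m \<longleftrightarrow> m' = m + single v 1" if "lookup m' v \<noteq> 0" for m' :: "'v monomial"
  proof
    assume "m' - single v 1 = m"
    then show "m' = m + single v 1"
      using that by (intro poly_mapping_eqI) (auto simp: lookup_add lookup_minus lookup_single when_def)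
  qed simp
  have "lookup (partial v f) m = (\<Sum>m'\<in>keys f. of_nat (lookup m' v) * lookup f m' when m' - single v 1 = m)"
    by (simp add: partial_def lookup_sum lookup_single)
  also have "\<dots> = (\<Sum>m'\<in>keys f. if m' = m + single v 1 then of_nat (lookup m v + 1) * lookup f (m + single v 1) else 0)"
  proof (rule sum.cong)
    fix m'
    show "(of_nat (lookup m' v) * lookup f m' when m' - single v 1 = m) =
      (if m' = m + single v 1 then of_nat (lookup m v + 1) * lookup f (m + single v 1) else 0)"
      using eq[of m'] by (cases "lookup m' v = 0") (auto simp: when_def lookup_add)
  qed simp
  also have "\<dots> = of_nat (lookup m v + 1) * lookup f (m + single v 1)"
    by (auto simp: in_keys_iff)
  finally show ?thesis .
qed

lemma partial_add: "partial v (f + g) = partial v f + partial v g"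
  by (rule poly_mapping_eqI) (simp add: lookup_partial lookup_add distrib_left)

lemma partial_0 [simp]: "partial v 0 = 0"
  by (simp add: partial_def)

lemma partial_single: "partial v (single m a) = single (m - single v 1) (of_nat (lookup m v) * a)"
  by (cases "a = 0") (auto simp: partial_def)

lemma partial_Const [simp]: "partial v (Const a) = 0"
  by (simp add: Const_def partial_single)

lemma partial_Var: "partial v (Var u) = (if u = v then 1 else 0)"
  by (auto simp: Var_def partial_single lookup_single when_def)

lemma partial_mult:
  fixes f g :: "('v, 'a::comm_semiring_1) mpoly"
  shows "partial v (f * g) = partial v f * g + f * partial v g"
proof (induction f rule: mpoly_single_induct)
  case (single m a)
  show ?case
  proof (induction g rule: mpoly_single_induct)
    case (single m' b)
    have 1: "m + m' - single v 1 = (m - single v 1) + m'" if "lookup m v \<noteq> 0" for m m' :: "'v monomial"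
      using that by (intro poly_mapping_eqI) (auto simp: lookup_add lookup_minus lookup_single when_def)
    have 2: "single (m + m' - single v 1) (of_nat (lookup m v) * c) =
        single ((m - single v 1) + m') (of_nat (lookup m v) * c)" for c :: 'a and m m' :: "'v monomial"
      using 1[of m m'] by (cases "lookup m v = 0") auto
    show ?case
      using 2[of m m' "a * b"] 2[of m' m "a * b"]
      by (simp add: partial_single mult_single lookup_add single_add algebra_simps)
  qed (simp add: partial_add distrib_left add_ac)
qed (simp add: partial_add distrib_right add_ac)

lemma polys_partial: "f \<in> polys V \<Longrightarrow> partial v f \<in> polys V"
proof (induction rule: polys_induct)
  case (Var u)
  then show ?case by (simp add: partial_Var)
qed (auto simp: partial_mult partial_add intro: polys_add polys_mult)

section \<open>The Fischer inner product\<close>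

definition fischer_weight :: "('v \<Rightarrow> real) \<Rightarrow> 'v monomial \<Rightarrow> real" where
  "fischer_weight \<omega> m = (\<Prod>v\<in>keys m. fact (lookup m v) * \<omega> v ^ lookup m v)"

text \<open>The Fischer, or apolar, inner product with weights \<open>\<omega>\<close>: distinct monomials are orthogonal, and the
factor \<open>\<Prod>\<^sub>v m\<^sub>v! \<omega>\<^sub>v\<^bsup>m\<^sub>v\<^esup>\<close> is chosen so that multiplication by an indeterminate becomes
adjoint to a multiple of the partial derivative.\<close>

definition fischer :: "('v \<Rightarrow> real) \<Rightarrow> ('v, real) mpoly \<Rightarrow> ('v, real) mpoly \<Rightarrow> real" where
  "fischer \<omega> f g = (\<Sum>m\<in>keys f. lookup f m * lookup g m * fischer_weight \<omega> m)"

lemma fischer_weight_superset: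
  assumes "finite A" "keys m \<subseteq> A"
  shows "fischer_weight \<omega> m = (\<Prod>v\<in>A. fact (lookup m v) * \<omega> v ^ lookup m v)"
  unfolding fischer_weight_def
  by (rule prod.mono_neutral_left) (use assms in \<open>auto simp: in_keys_iff\<close>)

lemma fischer_weight_Suc: "fischer_weight \<omega> (m + single v 1) = (real (lookup m v) + 1) * \<omega> v * fischer_weight \<omega> m"
proof -
  let ?A = "insert v (keys m)"
  have k: "keys (m + single v 1) \<subseteq> ?A" using keys_add[of m "single v 1"] by auto
  have c: "(\<Prod>u\<in>?A - {v}. fact (lookup (m + single v 1) u) * \<omega> u ^ lookup (m + single v 1) u) =
      (\<Prod>u\<in>?A - {v}. fact (lookup m u) * \<omega> u ^ lookup m u)"
    by (rule prod.cong) (auto simp: lookup_add lookup_single when_def)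
  have "fischer_weight \<omega> (m + single v 1) = (fact (lookup m v + 1) * \<omega> v ^ (lookup m v + 1)) *
     (\<Prod>u\<in>?A - {v}. fact (lookup m u) * \<omega> u ^ lookup m u)"
    unfolding c[symmetric]
    by (subst fischer_weight_superset[OF _ k], simp, subst prod.remove[of "insert v (keys m)" v])
      (simp_all add: lookup_add)
  moreover have "fischer_weight \<omega> m = (fact (lookup m v) * \<omega> v ^ lookup m v) *
     (\<Prod>u\<in>?A - {v}. fact (lookup m u) * \<omega> u ^ lookup m u)"
    by (subst fischer_weight_superset[of ?A], simp, blast, subst prod.remove[of "insert v (keys m)" v]) auto
  ultimately show ?thesis by (simp add: algebra_simps)
qed

lemma fischer_weight_pos: "(\<And>v. \<omega> v > 0) \<Longrightarrow> fischer_weight \<omega> m > 0"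
  unfolding fischer_weight_def by (intro prod_pos) auto

lemma fischer_superset:
  assumes "finite A" "keys f \<inter> keys g \<subseteq> A"
  shows "fischer \<omega> f g = (\<Sum>m\<in>A. lookup f m * lookup g m * fischer_weight \<omega> m)"
proof -
  have "fischer \<omega> f g = (\<Sum>m\<in>keys f \<inter> keys g. lookup f m * lookup g m * fischer_weight \<omega> m)"
    unfolding fischer_def
    by (rule sum.mono_neutral_right) (auto simp: in_keys_iff)
  also have "\<dots> = (\<Sum>m\<in>A. lookup f m * lookup g m * fischer_weight \<omega> m)"
    by (rule sum.mono_neutral_left) (use assms in \<open>auto simp: in_keys_iff\<close>)
  finally show ?thesis .
qed

lemma fischer_commute: "fischer \<omega> f g = fischer \<omega> g f"
proof -
  have "fischer \<omega> f g = (\<Sum>m\<in>keys f \<inter> keys g. lookup f m * lookup g m * fischer_weight \<omega> m)"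
    by (rule fischer_superset) auto
  also have "\<dots> = fischer \<omega> g f"
    by (subst fischer_superset[of "keys f \<inter> keys g" g f]) (auto simp: mult_ac)
  finally show ?thesis .
qed

lemma fischer_add_left: "fischer \<omega> (f + f') g = fischer \<omega> f g + fischer \<omega> f' g"
  by (subst (1 2 3) fischer_superset[of "keys g"]) (auto simp: lookup_add algebra_simps sum.distrib)

lemma fischer_add_right: "fischer \<omega> g (f + f') = fischer \<omega> g f + fischer \<omega> g f'"
  using fischer_add_left by (metis fischer_commute)

lemma fischer_0_left [simp]: "fischer \<omega> 0 g = 0" and fischer_0_right [simp]: "fischer \<omega> g 0 = 0"
  by (auto simp: fischer_def)

lemma fischer_sum_left: "fischer \<omega> (sum f A) g = (\<Sum>a\<in>A. fischer \<omega> (f a) g)"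
  by (induction A rule: infinite_finite_induct) (auto simp: fischer_add_left)

lemma fischer_sum_right: "fischer \<omega> g (sum f A) = (\<Sum>a\<in>A. fischer \<omega> g (f a))"
  by (induction A rule: infinite_finite_induct) (auto simp: fischer_add_right)

lemma fischer_scale_left: "fischer \<omega> (Const a * f) g = a * fischer \<omega> f g"
proof -
  have "keys (Const a * f) \<subseteq> keys f" by (auto simp: in_keys_iff lookup_Const_times)
  then show ?thesis
    by (subst (1 2) fischer_superset[of "keys f"]) (auto simp: lookup_Const_times sum_distrib_left mult.assoc)
qed

lemma fischer_scale_right: "fischer \<omega> g (Const a * f) = a * fischer \<omega> g f"
  using fischer_scale_left by (metis fischer_commute)

lemma fischer_single: "fischer \<omega> (single m a) g = a * lookup g m * fischer_weight \<omega> m"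
  by (cases "a = 0") (auto simp: fischer_def)

lemma fischer_Var: "fischer \<omega> (Var v * f) g = \<omega> v * fischer \<omega> f (partial v g)"
proof (induction f rule: mpoly_single_induct)
  case (single m a)
  then show ?case by (simp add: Var_times_single fischer_single fischer_weight_Suc[unfolded One_nat_def] lookup_partial mult_ac)
qed (simp add: distrib_left fischer_add_left)

lemma fischer_pos:
  assumes "\<And>v. \<omega> v > 0" "f \<noteq> 0"
  shows "fischer \<omega> f f > 0"
proof -
  have "keys f \<noteq> {}" using assms(2) by (simp add: keys_eq_empty)
  then show ?thesis
    unfolding fischer_def
  proof (intro sum_pos)
    fix m assume "m \<in> keys f"
    then have "lookup f m * lookup f m > 0" by (auto simp: in_keys_iff zero_less_mult_iff)
    then show "lookup f m * lookup f m * fischer_weight \<omega> m > 0"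
      using fischer_weight_pos[of \<omega> m] assms(1) by simp
  qed auto
qed

text \<open>Orthogonal projection onto the span of a finite set, by Gram--Schmidt: the part \<open>k\<close> of the new
generator orthogonal to the previous ones is used to correct the remainder.\<close>

lemma fischer_decomp:
  assumes "finite G" and \<omega>: "\<And>v. \<omega> v > 0"
  shows "\<exists>c h. f = (\<Sum>g\<in>G. Const (c g) * g) + h \<and> (\<forall>g\<in>G. fischer \<omega> g h = 0)"
  using assms(1)
proof (induction G arbitrary: f rule: finite_induct)
  case (insert g G)
  obtain c h where f: "f = (\<Sum>g\<in>G. Const (c g) * g) + h" and h: "\<forall>g\<in>G. fischer \<omega> g h = 0"
    using insert.IH[of f] by blast
  obtain c' k where g: "g = (\<Sum>g\<in>G. Const (c' g) * g) + k" and k: "\<forall>g\<in>G. fischer \<omega> g k = 0"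
    using insert.IH[of g] by blast
  \<comment> \<open>If the new generator already lies in the span of the others, no correction is needed.\<close>
  define t where "t = (if k = 0 then 0 else fischer \<omega> k h / fischer \<omega> k k)"
  have t: "fischer \<omega> k h = t * fischer \<omega> k k"
    using fischer_pos[of \<omega> k] \<omega> by (fastforce simp: t_def)
  define h' where "h' = h - Const t * k"
  have hh: "h = h' + Const t * k" by (simp add: h'_def)
  have orth: "fischer \<omega> g h' = 0" if "g \<in> G" for g
  proof -
    have "fischer \<omega> g h = fischer \<omega> g h' + t * fischer \<omega> g k"
      by (subst hh) (simp add: fischer_add_right fischer_scale_right)
    with h k that show ?thesis by simp
  qed
  have "fischer \<omega> k h = fischer \<omega> k h' + t * fischer \<omega> k k"
    by (subst hh) (simp add: fischer_add_right fischer_scale_right)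
  with t have "fischer \<omega> k h' = 0" by simp
  moreover have "fischer \<omega> g h' = (\<Sum>g\<in>G. c' g * fischer \<omega> g h') + fischer \<omega> k h'"
    by (subst g) (simp add: fischer_add_left fischer_sum_left fischer_scale_left)
  ultimately have "fischer \<omega> g h' = 0" using orth by simp
  define d where "d x = (if x = g then t else c x - t * c' x)" for x
  have "(\<Sum>x\<in>insert g G. Const (d x) * x) = Const t * g + (\<Sum>x\<in>G. Const (c x - t * c' x) * x)"
  proof -
    have "(\<Sum>x\<in>G. Const (d x) * x) = (\<Sum>x\<in>G. Const (c x - t * c' x) * x)"
      using insert.hyps by (intro sum.cong) (auto simp: d_def)
    then show ?thesis using insert.hyps by (simp add: d_def)
  qed
  also have "(\<Sum>x\<in>G. Const (c x - t * c' x) * x) =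
     (\<Sum>x\<in>G. Const (c x) * x) - Const t * (\<Sum>x\<in>G. Const (c' x) * x)"
  proof -
    have "(\<Sum>x\<in>G. Const (c x - t * c' x) * x) =
        (\<Sum>x\<in>G. Const (c x) * x - Const t * (Const (c' x) * x))"
      by (intro sum.cong refl) (simp only: Const_diff Const_mult left_diff_distrib mult.assoc)
    then show ?thesis by (simp only: sum_subtractf sum_distrib_left)
  qed
  finally have "(\<Sum>x\<in>insert g G. Const (d x) * x) =
    Const t * g + ((\<Sum>x\<in>G. Const (c x) * x) - Const t * (\<Sum>x\<in>G. Const (c' x) * x))" .
  moreover have "Const t * g = Const t * (\<Sum>x\<in>G. Const (c' x) * x) + Const t * k"
    using arg_cong[OF g, of "\<lambda>x. Const t * x"] by (simp only: distrib_left)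
  ultimately have "f = (\<Sum>x\<in>insert g G. Const (d x) * x) + h'"
    using f hh by simp
  then show ?case using orth \<open>fischer \<omega> g h' = 0\<close> by blast
qed auto

section \<open>The generic symmetric matrix and its specializations\<close>

abbreviation "cvar i j \<equiv> (0::nat, quad_mon i j)"
definition cvars :: "nat \<Rightarrow> (nat \<times> nat monomial) set" where
  "cvars n = {..<1} \<times> monomials 2 n"

text \<open>The entries of the generic symmetric matrix; they are symmetric in the two indices because \<open>c\<^sub>i\<^sub>j\<close> and
\<open>c\<^sub>j\<^sub>i\<close> are the same coordinate.\<close>

definition entry :: "nat \<Rightarrow> nat \<Rightarrow> (nat \<times> nat monomial, real) mpoly" where
  "entry i j = Const (if i = j then 1 else 1/2) * Var (cvar i j)"

lemma quad_mon_commute: "quad_mon i j = quad_mon j i"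
  by (simp add: quad_mon_def add.commute)

lemma entry_commute: "entry i j = entry j i"
  by (simp add: entry_def quad_mon_commute[of i j])

lemma cvar_in: "i < n \<Longrightarrow> j < n \<Longrightarrow> cvar i j \<in> cvars n"
  by (auto simp: cvars_def monomials_2)

lemma cvars_cases:
  assumes "v \<in> cvars n" obtains i j where "v = cvar i j" "i < n" "j < n"
  using assms by (auto simp: cvars_def monomials_2)

lemma polys_entry: "i < n \<Longrightarrow> j < n \<Longrightarrow> entry i j \<in> polys (cvars n)"
  unfolding entry_def by (intro polys_mult polys_Const polys_Var cvar_in)

text \<open>Matrices are functions on all pairs of indices, of which only an initial square matters; this avoids carrying dimensions along.\<close>

definition symm :: "(nat \<Rightarrow> nat \<Rightarrow> real) \<Rightarrow> bool" where
  "symm A \<longleftrightarrow> (\<forall>i j. A i j = A j i)"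

text \<open>The coordinates of the quadratic form with a given symmetric matrix. A coordinate index determines the
pair of matrix indices only up to order, hence the choice.\<close>

definition point :: "(nat \<Rightarrow> nat \<Rightarrow> real) \<Rightarrow> nat \<times> nat monomial \<Rightarrow> real" where
  "point A v = (let p = SOME p. snd v = quad_mon (fst p) (snd p)
     in (if fst p = snd p then 1 else 2) * A (fst p) (snd p))"

abbreviation "ev A \<equiv> poly_eval (point A)"

lemma point_cvar:
  assumes "symm A" shows "point A (cvar i j) = (if i = j then 1 else 2) * A i j"
proof -
  define p where "p = (SOME p. quad_mon i j = quad_mon (fst p) (snd p))"
  have "quad_mon i j = quad_mon (fst p) (snd p)"
    unfolding p_def by (rule someI[of _ "(i, j)"]) simp
  then have "(i = fst p \<and> j = snd p) \<or> (i = snd p \<and> j = fst p)"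
    by (simp only: quad_mon_eq_iff)
  then have "(if fst p = snd p then 1 else 2) * A (fst p) (snd p) = (if i = j then 1 else 2) * A i j"
  proof
    assume "i = snd p \<and> j = fst p"
    moreover have "A (fst p) (snd p) = A (snd p) (fst p)" using assms by (simp add: symm_def)
    ultimately show ?thesis by (simp add: eq_commute)
  qed simp
  moreover have "point A (cvar i j) = (if fst p = snd p then 1 else 2) * A (fst p) (snd p)"
    unfolding point_def p_def Let_def snd_conv ..
  ultimately show ?thesis by simp
qed

lemma ev_entry: "symm A \<Longrightarrow> ev A (entry i j) = A i j"
  by (simp add: entry_def poly_eval_mult point_cvar)

lemma ev_zero_imp_zero:
  assumes "f \<in> polys (cvars n)" and "\<And>A. symm A \<Longrightarrow> ev A f = 0"
  shows "f = 0"
proof (rule poly_eval_zero_imp_zero)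
  fix x :: "nat \<times> nat monomial \<Rightarrow> real"
  define A where "A i j = (if i = j then 1 else 1/2) * x (cvar i j)" for i j
  have s: "symm A" unfolding symm_def A_def by (simp add: quad_mon_commute)
  have "poly_eval x f = ev A f"
  proof (rule poly_eval_cong[OF assms(1)])
    fix v assume "v \<in> cvars n"
    then obtain i j where "v = cvar i j" by (rule cvars_cases)
    then show "x v = point A v" by (simp add: point_cvar[OF s]) (simp add: A_def)
  qed
  then show "poly_eval x f = 0" using assms(2)[OF s] by simp
qed

text \<open>The chain rule along a path of symmetric matrices. Summing over all ordered pairs counts each off-diagonal
coordinate twice, which accounts exactly for \<open>c\<^sub>i\<^sub>j = 2 s\<^sub>i\<^sub>j\<close>.\<close>

lemma ev_has_derivative:
  assumes "f \<in> polys (cvars n)" and s: "\<And>t. symm (A t)" and s': "symm A'"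
    and d: "\<And>k l. ((\<lambda>t. A t k l) has_real_derivative A' k l) (at t)"
  shows "((\<lambda>t. ev (A t) f) has_real_derivative
    (\<Sum>k<n. \<Sum>l<n. A' k l * ev (A t) (partial (cvar k l) f))) (at t)"
  using assms(1)
proof (induction rule: polys_induct)
  case (Const a)
  then show ?case by simp
next
  case (Var v)
  then obtain p q where v: "v = cvar p q" "p < n" "q < n" by (rule cvars_cases)
  have "A' k l * ev (A t) (partial (cvar k l) (Var v)) =
      (if k = p then if l = q then A' p q else 0 else 0) +
      (if p = q then 0 else if k = q then if l = p then A' p q else 0 else 0)" for k l
    using s' by (auto simp: v partial_Var quad_mon_eq_iff symm_def)
  moreover have "(\<Sum>l<n. (if k = p then if l = q then A' p q else 0 else 0) +
      (if p = q then 0 else if k = q then if l = p then A' p q else 0 else 0)) =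
      (if k = p then A' p q else 0) + (if k = q then if p = q then 0 else A' p q else 0)" for k
    using v by (auto simp: sum.distrib)
  ultimately have "(\<Sum>k<n. \<Sum>l<n. A' k l * ev (A t) (partial (cvar k l) (Var v))) =
     (if p = q then 1 else 2) * A' p q"
    using v(2,3) by (simp add: sum.distrib)
  then show ?case
    by (simp add: v(1) point_cvar[OF s]) (auto intro!: derivative_eq_intros d)
next
  case (add f g)
  show ?case
    by (rule DERIV_cong[OF DERIV_add[OF add.IH, folded poly_eval_add]])
      (simp add: partial_add poly_eval_add distrib_left sum.distrib)
next
  case (mult f g)
  show ?case
    by (rule DERIV_cong[OF DERIV_mult[OF mult.IH, folded poly_eval_mult]])
      (simp add: partial_mult poly_eval_add poly_eval_mult distrib_left sum.distrib sum_distrib_left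
        sum_distrib_right mult_ac)
qed

section \<open>Polarization operators\<close>

text \<open>The operator \<open>E\<^sub>a\<^sub>b = \<Sum>l. s\<^sub>a\<^sub>l \<partial>\<^sub>b\<^sub>l\<close>, where \<open>\<partial>\<^sub>b\<^sub>l\<close> differentiates by \<open>c\<^sub>b\<^sub>l\<close>. Up to the factor
\<open>1/2\<close> it replaces the index \<open>b\<close> by \<open>a\<close>, one occurrence at a time: it is the derivation given by the
action of an elementary matrix of the Lie algebra of \<open>GL\<^sub>n\<close>.\<close>

definition polar :: "nat \<Rightarrow> nat \<Rightarrow> nat \<Rightarrow> (nat \<times> nat monomial, real) mpoly \<Rightarrow> (nat \<times> nat monomial, real) mpoly" where
  "polar n a b f = (\<Sum>l<n. entry a l * partial (cvar b l) f)"

lemma polys_polar: "f \<in> polys (cvars n) \<Longrightarrow> a < n \<Longrightarrow> polar n a b f \<in> polys (cvars n)"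
  unfolding polar_def by (intro polys_sum polys_mult polys_entry polys_partial) auto

lemma polar_0 [simp]: "polar n a b 0 = 0"
  by (simp add: polar_def)

lemma polar_Const [simp]: "polar n a b (Const c) = 0"
  by (simp add: polar_def)

lemma polar_add: "polar n a b (f + g) = polar n a b f + polar n a b g"
  by (simp add: polar_def partial_add distrib_left sum.distrib)

lemma polar_sum: "polar n a b (sum f A) = (\<Sum>x\<in>A. polar n a b (f x))"
  by (induction A rule: infinite_finite_induct) (auto simp: polar_add)

lemma polar_mult: "polar n a b (f * g) = polar n a b f * g + f * polar n a b g"
  by (simp add: polar_def partial_mult distrib_left sum.distrib sum_distrib_left sum_distrib_right mult_ac)

lemma polar_prod:
  "finite I \<Longrightarrow> polar n a b (prod f I) = (\<Sum>i\<in>I. polar n a b (f i) * prod f (I - {i}))"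
proof (induction I rule: finite_induct)
  case empty
  then show ?case using polar_Const[of n a b 1] by simp
next
  case (insert x I)
  have "prod f (insert x I - {i}) = f x * prod f (I - {i})" if "i \<in> I" for i
  proof -
    have "insert x I - {i} = insert x (I - {i})" using that insert.hyps by auto
    then show ?thesis using insert.hyps by simp
  qed
  then have "(\<Sum>i\<in>I. polar n a b (f i) * prod f (insert x I - {i})) = f x * polar n a b (prod f I)"
    by (simp add: insert.IH sum_distrib_left mult_ac)
  then show ?case using insert.hyps by (simp add: polar_mult)
qed

lemma partial_entry:
  "partial (cvar b m) (entry k l) =
    Const (1/2) * ((if b = k \<and> m = l then 1 else 0) + (if b = l \<and> m = k then 1 else 0))"
proof -
  have "Const (1/2) * (1 + 1) = Const (1/2) + (Const (1/2) :: (nat \<times> nat monomial, real) mpoly)"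
    by (simp only: distrib_left mult_1_right)
  then have "Const (1/2) * 2 = (1 :: (nat \<times> nat monomial, real) mpoly)"
    by (simp flip: Const_add)
  then show ?thesis
    by (auto simp: entry_def partial_mult partial_Var quad_mon_eq_iff)
qed

lemma polar_entry:
  assumes "k < n" "l < n"
  shows "polar n a b (entry k l) =
    Const (1/2) * ((if k = b then entry a l else 0) + (if l = b then entry k a else 0))"
proof -
  have "entry a m * partial (cvar b m) (entry k l) =
     Const (1/2) * ((if m = l then if k = b then entry a l else 0 else 0) +
       (if m = k then if l = b then entry k a else 0 else 0))" for m
    by (auto simp: partial_entry entry_commute mult_ac distrib_left)
  then show ?thesis
    using assms unfolding polar_def by (simp add: sum_distrib_left[symmetric] sum.distrib)
qed

lemma ev_polar: "symm A \<Longrightarrow> ev A (polar n a b f) = (\<Sum>l<n. A a l * ev A (partial (cvar b l) f))"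
  by (simp add: polar_def poly_eval_sum poly_eval_mult ev_entry)

text \<open>With these weights multiplication by the matrix entry \<open>s\<^sub>i\<^sub>j\<close> is adjoint to differentiation by the
coordinate \<open>c\<^sub>i\<^sub>j\<close>, without a scalar factor.\<close>

definition omega :: "nat \<times> nat monomial \<Rightarrow> real" where
  "omega v = (if \<exists>i. snd v = quad_mon i i then 1 else 2)"

lemma omega_pos: "omega v > 0"
  by (simp add: omega_def)

lemma fischer_entry: "fischer omega (entry i j * f) g = fischer omega f (partial (cvar i j) g)"
  by (auto simp: entry_def mult.assoc fischer_scale_left fischer_Var omega_def quad_mon_eq_iff)

text \<open>Both sides equal \<open>\<Sum>l. \<langle>\<partial>\<^sub>b\<^sub>l f, \<partial>\<^sub>a\<^sub>l g\<rangle>\<close>.\<close>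

lemma polar_adjoint: "fischer omega (polar n a b f) g = fischer omega f (polar n b a g)"
proof -
  have "fischer omega (polar n a b f) g = (\<Sum>l<n. fischer omega (partial (cvar b l) f) (partial (cvar a l) g))"
    by (simp add: polar_def fischer_sum_left fischer_entry)
  also have "\<dots> = (\<Sum>l<n. fischer omega (partial (cvar a l) g) (partial (cvar b l) f))"
    by (simp add: fischer_commute)
  also have "\<dots> = fischer omega (polar n b a g) f"
    by (simp add: polar_def fischer_sum_left fischer_entry)
  finally show ?thesis by (simp add: fischer_commute)
qed

section \<open>Minors of the generic symmetric matrix\<close>

text \<open>Rows and columns are chosen by arbitrary functions rather than by subsets, so that replacing an index
needs neither a sign nor a case distinction: a repeated index just gives zero.\<close>

definition gen_minor :: "nat \<Rightarrow> (nat \<Rightarrow> nat) \<Rightarrow> (nat \<Rightarrow> nat) \<Rightarrow> (nat \<times> nat monomial, real) mpoly" where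
  "gen_minor k \<alpha> \<beta> = det (mat k k (\<lambda>(i, j). entry (\<alpha> i) (\<beta> j)))"

lemma polys_gen_minor:
  "(\<And>i. i < k \<Longrightarrow> \<alpha> i < n) \<Longrightarrow> (\<And>i. i < k \<Longrightarrow> \<beta> i < n) \<Longrightarrow> gen_minor k \<alpha> \<beta> \<in> polys (cvars n)"
  unfolding gen_minor_def by (intro polys_det polys_entry) auto

lemma ev_gen_minor:
  assumes "symm A"
  shows "ev A (gen_minor k \<alpha> \<beta>) = det (mat k k (\<lambda>(i, j). A (\<alpha> i) (\<beta> j)))"
proof -
  interpret comm_ring_hom "ev A" by (rule poly_eval_ring_hom)
  show ?thesis
    unfolding gen_minor_def hom_det[symmetric]
    by (rule arg_cong[of _ _ det]) (auto intro!: eq_matI simp: ev_entry assms)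
qed

lemma gen_minor_expand: "gen_minor k \<alpha> \<beta> =
  (\<Sum>p | p permutes {0..<k}. signof p * (\<Prod>i\<in>{0..<k}. entry (\<alpha> i) (\<beta> (p i))))"
  unfolding gen_minor_def
  by (subst det_def'[of _ k], simp, intro sum.cong refl arg_cong2[where f = "(*)"] prod.cong)
    (auto simp: permutes_in_image dest: permutes_in_image)

lemma polar_signof: "polar n a b (signof p * f) = signof p * polar n a b f"
proof -
  have "polar n a b (- f) = - polar n a b f" for f
    using polar_add[of n a b f "- f"] by (simp add: eq_neg_iff_add_eq_0 add.commute)
  then show ?thesis by (auto simp: sign_def)
qed

text \<open>A derivation acts on a minor by replacing, one after the other, each row index and each column index \<open>b\<close>
by \<open>a\<close>; in particular it maps minors to combinations of minors of the same size. In the Leibniz expansion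
the column contributions are indexed by the rows and have to be reindexed by the permutation.\<close>

lemma polar_gen_minor:
  assumes "\<And>i. i < k \<Longrightarrow> \<alpha> i < n" "\<And>i. i < k \<Longrightarrow> \<beta> i < n"
  shows "polar n a b (gen_minor k \<alpha> \<beta>) = Const (1/2) *
    ((\<Sum>i\<in>{0..<k}. if \<alpha> i = b then gen_minor k (\<alpha>(i := a)) \<beta> else 0) +
     (\<Sum>j\<in>{0..<k}. if \<beta> j = b then gen_minor k \<alpha> (\<beta>(j := a)) else 0))"
proof -
  let ?I = "{0..<k}"
  define P where "P \<alpha> \<beta> p = (\<Prod>i\<in>?I. entry (\<alpha> i) (\<beta> (p i)))" for \<alpha> \<beta> and p :: "nat \<Rightarrow> nat"
  have gd: "gen_minor k \<alpha> \<beta> = (\<Sum>p | p permutes ?I. signof p * P \<alpha> \<beta> p)" for \<alpha> \<beta>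
    by (simp add: gen_minor_expand P_def)
  have "polar n a b (P \<alpha> \<beta> p) = Const (1/2) *
    ((\<Sum>i\<in>?I. if \<alpha> i = b then P (\<alpha>(i := a)) \<beta> p else 0) +
     (\<Sum>j\<in>?I. if \<beta> j = b then P \<alpha> (\<beta>(j := a)) p else 0))" if p: "p permutes ?I" for p
  proof -
    have 1: "entry a (\<beta> (p i)) * (\<Prod>j\<in>?I - {i}. entry (\<alpha> j) (\<beta> (p j))) = P (\<alpha>(i := a)) \<beta> p"
      if "i \<in> ?I" for i
    proof -
      have "P (\<alpha>(i := a)) \<beta> p = entry ((\<alpha>(i := a)) i) (\<beta> (p i)) *
          (\<Prod>j\<in>?I - {i}. entry ((\<alpha>(i := a)) j) (\<beta> (p j)))"
        unfolding P_def using that by (intro prod.remove) auto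
      also have "(\<Prod>j\<in>?I - {i}. entry ((\<alpha>(i := a)) j) (\<beta> (p j))) = (\<Prod>j\<in>?I - {i}. entry (\<alpha> j) (\<beta> (p j)))"
        by (intro prod.cong) auto
      finally show ?thesis by (simp only: fun_upd_same)
    qed
    have 2: "entry (\<alpha> i) a * (\<Prod>j\<in>?I - {i}. entry (\<alpha> j) (\<beta> (p j))) = P \<alpha> (\<beta>(p i := a)) p"
      if "i \<in> ?I" for i
    proof -
      have "P \<alpha> (\<beta>(p i := a)) p = entry (\<alpha> i) ((\<beta>(p i := a)) (p i)) *
          (\<Prod>j\<in>?I - {i}. entry (\<alpha> j) ((\<beta>(p i := a)) (p j)))"
        unfolding P_def using that by (intro prod.remove) auto
      also have "(\<Prod>j\<in>?I - {i}. entry (\<alpha> j) ((\<beta>(p i := a)) (p j))) = (\<Prod>j\<in>?I - {i}. entry (\<alpha> j) (\<beta> (p j)))"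
        using permutes_inj[OF p] by (intro prod.cong) (auto simp: inj_def)
      finally show ?thesis by (simp only: fun_upd_same)
    qed
    have "polar n a b (P \<alpha> \<beta> p) = (\<Sum>i\<in>?I. polar n a b (entry (\<alpha> i) (\<beta> (p i))) * (\<Prod>j\<in>?I - {i}. entry (\<alpha> j) (\<beta> (p j))))"
      unfolding P_def by (rule polar_prod) simp
    also have "\<dots> = (\<Sum>i\<in>?I. Const (1/2) * ((if \<alpha> i = b then P (\<alpha>(i := a)) \<beta> p else 0) +
        (if \<beta> (p i) = b then P \<alpha> (\<beta>(p i := a)) p else 0)))"
    proof (rule sum.cong[OF refl])
      fix i assume i: "i \<in> ?I"
      then have "p i \<in> ?I" using permutes_in_image[OF p] by blast
      with i assms have "\<alpha> i < n" "\<beta> (p i) < n" by auto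
      then show "polar n a b (entry (\<alpha> i) (\<beta> (p i))) * (\<Prod>j\<in>?I - {i}. entry (\<alpha> j) (\<beta> (p j))) =
        Const (1/2) * ((if \<alpha> i = b then P (\<alpha>(i := a)) \<beta> p else 0) +
        (if \<beta> (p i) = b then P \<alpha> (\<beta>(p i := a)) p else 0))"
        unfolding 1[OF i, symmetric] 2[OF i, symmetric]
        by (simp add: polar_entry mult.assoc distrib_right)
    qed
    also have "\<dots> = Const (1/2) * ((\<Sum>i\<in>?I. if \<alpha> i = b then P (\<alpha>(i := a)) \<beta> p else 0) +
        (\<Sum>i\<in>?I. if \<beta> (p i) = b then P \<alpha> (\<beta>(p i := a)) p else 0))"
      by (simp only: sum_distrib_left[symmetric] sum.distrib)
    also have "(\<Sum>i\<in>?I. if \<beta> (p i) = b then P \<alpha> (\<beta>(p i := a)) p else 0) =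
       (\<Sum>j\<in>?I. if \<beta> j = b then P \<alpha> (\<beta>(j := a)) p else 0)"
      using sum.permute[OF p, of "\<lambda>j. if \<beta> j = b then P \<alpha> (\<beta>(j := a)) p else 0"] by (simp add: o_def)
    finally show ?thesis .
  qed
  then have "polar n a b (gen_minor k \<alpha> \<beta>) = (\<Sum>p | p permutes ?I. signof p * (Const (1/2) *
    ((\<Sum>i\<in>?I. if \<alpha> i = b then P (\<alpha>(i := a)) \<beta> p else 0) +
     (\<Sum>j\<in>?I. if \<beta> j = b then P \<alpha> (\<beta>(j := a)) p else 0))))"
    unfolding gd polar_sum polar_signof by (intro sum.cong) auto
  also have "\<dots> = (\<Sum>p | p permutes ?I. Const (1/2) *
    ((\<Sum>i\<in>?I. signof p * (if \<alpha> i = b then P (\<alpha>(i := a)) \<beta> p else 0)) +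
     (\<Sum>j\<in>?I. signof p * (if \<beta> j = b then P \<alpha> (\<beta>(j := a)) p else 0))))"
    by (intro sum.cong refl, unfold sum_distrib_left[symmetric] distrib_left[symmetric])
      (simp only: mult.left_commute)
  also have "\<dots> = Const (1/2) *
     ((\<Sum>p | p permutes ?I. \<Sum>i\<in>?I. signof p * (if \<alpha> i = b then P (\<alpha>(i := a)) \<beta> p else 0)) +
      (\<Sum>p | p permutes ?I. \<Sum>j\<in>?I. signof p * (if \<beta> j = b then P \<alpha> (\<beta>(j := a)) p else 0)))"
    by (simp only: sum_distrib_left[symmetric] sum.distrib)
  also have "(\<Sum>p | p permutes ?I. \<Sum>i\<in>?I. signof p * (if \<alpha> i = b then P (\<alpha>(i := a)) \<beta> p else 0)) =
     (\<Sum>i\<in>?I. if \<alpha> i = b then gen_minor k (\<alpha>(i := a)) \<beta> else 0)"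
    unfolding gd by (subst sum.swap) (auto intro!: sum.cong)
  also have "(\<Sum>p | p permutes ?I. \<Sum>j\<in>?I. signof p * (if \<beta> j = b then P \<alpha> (\<beta>(j := a)) p else 0)) =
     (\<Sum>j\<in>?I. if \<beta> j = b then gen_minor k \<alpha> (\<beta>(j := a)) else 0)"
    unfolding gd by (subst sum.swap) (auto intro!: sum.cong)
  finally show ?thesis .
qed

lemma gen_minor_commute: "gen_minor k \<beta> \<alpha> = gen_minor k \<alpha> \<beta>"
  unfolding gen_minor_def
  by (subst det_transpose[symmetric, of _ k], simp) (auto intro!: arg_cong[of _ _ det] eq_matI simp: entry_commute)

lemma gen_minor_repeat:
  assumes "i < k" "j < k" "i \<noteq> j" "\<alpha> i = \<alpha> j"
  shows "gen_minor k \<alpha> \<beta> = 0" and "gen_minor k \<beta> \<alpha> = 0"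
proof -
  have z: "gen_minor k \<alpha> \<gamma> = 0" for \<gamma>
    unfolding gen_minor_def
    by (rule det_identical_rows[of _ k i j]) (use assms in \<open>auto intro!: eq_vecI\<close>)
  show "gen_minor k \<alpha> \<beta> = 0" by (rule z)
  show "gen_minor k \<beta> \<alpha> = 0" using z[of \<beta>] gen_minor_commute[of k \<beta> \<alpha>] by simp
qed

section \<open>Symmetric matrices of bounded rank\<close>

text \<open>The matrices realized by a hidden layer of width \<open>r\<close>. In this form, stability under congruence is evident.\<close>

definition low_rank :: "nat \<Rightarrow> (nat \<Rightarrow> nat \<Rightarrow> real) \<Rightarrow> bool" where
  "low_rank r A \<longleftrightarrow> (\<exists>w l. A = (\<lambda>i j. \<Sum>k<r. w k * l k i * l k j))"

lemma low_rank_symm: "low_rank r A \<Longrightarrow> symm A"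
  by (auto simp: low_rank_def symm_def intro!: sum.cong)

text \<open>The congruence \<open>A \<mapsto> g A g\<^sup>T\<close> by \<open>g = 1 + t u e\<^sub>a\<^sup>T\<close>, which adds multiples of row and column \<open>a\<close>
to the others.\<close>

definition shear :: "nat \<Rightarrow> (nat \<Rightarrow> real) \<Rightarrow> real \<Rightarrow> (nat \<Rightarrow> nat \<Rightarrow> real) \<Rightarrow> nat \<Rightarrow> nat \<Rightarrow> real" where
  "shear a u t A = (\<lambda>i j. A i j + t * (u i * A a j + u j * A i a) + t\<^sup>2 * u i * u j * A a a)"

lemma shear_0 [simp]: "shear a u 0 A = A"
  by (simp add: shear_def)

lemma symm_shear: "symm A \<Longrightarrow> symm (shear a u t A)"
  unfolding symm_def shear_def
proof (intro allI)
  fix i j assume "\<forall>i j. A i j = A j i"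
  then have "A i j = A j i" "A i a = A a i" "A j a = A a j" by blast+
  then show "A i j + t * (u i * A a j + u j * A i a) + t\<^sup>2 * u i * u j * A a a =
    A j i + t * (u j * A a i + u i * A j a) + t\<^sup>2 * u j * u i * A a a"
    by (simp add: algebra_simps)
qed

lemma low_rank_shear:
  assumes "low_rank r A" shows "low_rank r (shear a u t A)"
proof -
  obtain w l where A: "A = (\<lambda>i j. \<Sum>k<r. w k * l k i * l k j)" using assms by (auto simp: low_rank_def)
  have "shear a u t A = (\<lambda>i j. \<Sum>k<r. w k * (l k i + t * u i * l k a) * (l k j + t * u j * l k a))"
    by (intro ext) (simp add: shear_def A algebra_simps sum.distrib sum_distrib_left power2_eq_square)
  then show ?thesis
    unfolding low_rank_def by (intro exI[of _ w] exI[of _ "\<lambda>k i. l k i + t * u i * l k a"])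
qed

lemma low_rank_scale:
  assumes "low_rank r A" shows "low_rank r (\<lambda>i j. t i * t j * A i j)"
proof -
  obtain w l where A: "A = (\<lambda>i j. \<Sum>k<r. w k * l k i * l k j)" using assms by (auto simp: low_rank_def)
  have "(\<lambda>i j. t i * t j * A i j) = (\<lambda>i j. \<Sum>k<r. w k * (t i * l k i) * (t j * l k j))"
    by (intro ext) (simp add: A sum_distrib_left mult_ac)
  then show ?thesis
    unfolding low_rank_def by (intro exI[of _ w] exI[of _ "\<lambda>k i. t i * l k i"])
qed

text \<open>If \<open>u\<^sub>a = 0\<close>, the shears with direction \<open>u\<close> form a one-parameter group, so that the derivative at time \<open>t\<close>
is an infinitesimal shear of the matrix reached at time \<open>t\<close>.\<close>

lemma shear_has_derivative:
  assumes f: "f \<in> polys (cvars n)" and A: "symm A" and u: "u a = 0"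
  shows "((\<lambda>t. ev (shear a u t A) f) has_real_derivative
    2 * (\<Sum>k<n. u k * ev (shear a u t A) (polar n a k f))) (at t)"
proof -
  let ?B = "shear a u t A"
  have sB: "symm ?B" by (rule symm_shear[OF A])
  let ?A' = "\<lambda>k l. u k * ?B a l + u l * ?B k a"
  have s': "symm ?A'"
    using sB by (auto simp: symm_def)
  have d: "((\<lambda>t. shear a u t A k l) has_real_derivative ?A' k l) (at t)" for k l
    unfolding shear_def using u by (auto intro!: derivative_eq_intros simp: algebra_simps)
  have "(\<Sum>k<n. \<Sum>l<n. ?A' k l * ev ?B (partial (cvar k l) f)) =
     (\<Sum>k<n. \<Sum>l<n. u k * (?B a l * ev ?B (partial (cvar k l) f))) +
     (\<Sum>k<n. \<Sum>l<n. u l * (?B k a * ev ?B (partial (cvar k l) f)))"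
    by (simp add: sum.distrib distrib_right mult.assoc)
  also have "(\<Sum>k<n. \<Sum>l<n. u l * (?B k a * ev ?B (partial (cvar k l) f))) =
     (\<Sum>l<n. \<Sum>k<n. u l * (?B a k * ev ?B (partial (cvar l k) f)))"
  proof (subst sum.swap, intro sum.cong refl)
    fix k l show "u l * (?B k a * ev ?B (partial (cvar k l) f)) = u l * (?B a k * ev ?B (partial (cvar l k) f))"
      using sB unfolding symm_def by (metis quad_mon_commute)
  qed
  also have "(\<Sum>k<n. \<Sum>l<n. u k * (?B a l * ev ?B (partial (cvar k l) f))) + \<dots> =
     2 * (\<Sum>k<n. u k * ev ?B (polar n a k f))"
    by (simp add: ev_polar[OF sB] sum_distrib_left)
  finally show ?thesis
    using ev_has_derivative[OF f, of "\<lambda>t. shear a u t A", OF symm_shear[OF A] s' d] by simp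
qed

definition vanishing :: "nat \<Rightarrow> nat \<Rightarrow> (nat \<times> nat monomial, real) mpoly \<Rightarrow> bool" where
  "vanishing n r f \<longleftrightarrow> f \<in> polys (cvars n) \<and> (\<forall>A. low_rank r A \<longrightarrow> ev A f = 0)"

text \<open>\<open>E\<^sub>a\<^sub>b f\<close> is half the derivative of \<open>f\<close> along shears, and these preserve the matrices of bounded rank.\<close>

lemma vanishing_polar:
  assumes "vanishing n r f" "a < n" "b < n" "a \<noteq> b"
  shows "vanishing n r (polar n a b f)"
  unfolding vanishing_def
proof (intro conjI allI impI)
  show "polar n a b f \<in> polys (cvars n)" using assms by (auto simp: vanishing_def intro: polys_polar)
  fix A assume A: "low_rank r A"
  define u :: "nat \<Rightarrow> real" where "u k = (if k = b then 1 else 0)" for k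
  have "((\<lambda>t. ev (shear a u t A) f) has_real_derivative
    2 * (\<Sum>k<n. u k * ev (shear a u 0 A) (polar n a k f))) (at 0)"
    using assms low_rank_symm[OF A] by (intro shear_has_derivative) (auto simp: vanishing_def u_def)
  moreover have "(\<lambda>t. ev (shear a u t A) f) = (\<lambda>t. 0)"
    using assms low_rank_shear[OF A] by (auto simp: vanishing_def)
  ultimately have "2 * (\<Sum>k<n. u k * ev A (polar n a k f)) = 0"
    using DERIV_unique[OF _ DERIV_const[of 0]] by fastforce
  moreover have "(\<Sum>k<n. u k * ev A (polar n a k f)) = (\<Sum>k<n. if k = b then ev A (polar n a b f) else 0)"
    by (rule sum.cong) (auto simp: u_def)
  ultimately show "ev A (polar n a b f) = 0"
    using assms(3) by simp
qed

section \<open>Weights\<close>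

text \<open>The weight of a monomial for the action of the diagonal torus: the total number of occurrences of each
matrix index, where \<open>c\<^sub>i\<^sub>j\<close> contributes \<open>i\<close> and \<open>j\<close>.\<close>

definition weight :: "(nat \<times> nat monomial) monomial \<Rightarrow> nat \<Rightarrow> nat" where
  "weight \<mu> i = (\<Sum>v\<in>keys \<mu>. lookup \<mu> v * lookup (snd v) i)"

lemma weight_superset:
  assumes "finite A" "keys \<mu> \<subseteq> A"
  shows "weight \<mu> i = (\<Sum>v\<in>A. lookup \<mu> v * lookup (snd v) i)"
  unfolding weight_def by (rule sum.mono_neutral_left) (use assms in \<open>auto simp: in_keys_iff\<close>)

lemma weight_add: "weight (\<mu> + \<nu>) i = weight \<mu> i + weight \<nu> i"
  using keys_add[of \<mu> \<nu>]
  by (subst (1 2 3) weight_superset[of "keys \<mu> \<union> keys \<nu>"]) (auto simp: lookup_add distrib_right sum.distrib)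

lemma weight_single: "weight (single v k) i = k * lookup (snd v) i"
  by (simp add: weight_def)

lemma lookup_quad_mon: "lookup (quad_mon a b) i = (if i = a then 1 else 0) + (if i = b then 1 else 0)"
  by (auto simp: quad_mon_def lookup_add lookup_single when_def)

lemma weight_outside:
  assumes "keys \<mu> \<subseteq> cvars n" "i \<ge> n" shows "weight \<mu> i = 0"
  unfolding weight_def
proof (intro sum.neutral ballI)
  fix v assume "v \<in> keys \<mu>"
  with assms(1) have "v \<in> cvars n" by blast
  then obtain a b where "v = cvar a b" "a < n" "b < n" by (rule cvars_cases)
  with assms(2) show "lookup \<mu> v * lookup (snd v) i = 0" by (simp add: lookup_quad_mon)
qed

definition homog :: "(nat \<Rightarrow> nat) \<Rightarrow> (nat \<times> nat monomial, real) mpoly \<Rightarrow> bool" where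
  "homog w f \<longleftrightarrow> (\<forall>\<mu>\<in>keys f. weight \<mu> = w)"

lemma homog_0 [simp]: "homog w 0" by (simp add: homog_def)

lemma homog_add: "homog w f \<Longrightarrow> homog w g \<Longrightarrow> homog w (f + g)"
  unfolding homog_def using keys_add[of f g] by blast

lemma homog_sum: "(\<And>x. x \<in> A \<Longrightarrow> homog w (f x)) \<Longrightarrow> homog w (sum f A)"
  by (induction A rule: infinite_finite_induct) (auto intro: homog_add)

lemma homog_diff: "homog w f \<Longrightarrow> homog w g \<Longrightarrow> homog w (f - g)"
  unfolding homog_def by (metis (no_types) in_keys_iff lookup_minus diff_0_right diff_self)

lemma homog_mult: "homog w f \<Longrightarrow> homog w' g \<Longrightarrow> homog (\<lambda>i. w i + w' i) (f * g)"
  unfolding homog_def using keys_mult[of f g] by (fastforce simp: weight_add)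

lemma homog_Const: "homog (\<lambda>_. 0) (Const c)"
  by (auto simp: homog_def Const_def weight_def)

lemma homog_scale: "homog w f \<Longrightarrow> homog w (Const c * f)"
  using homog_mult[OF homog_Const, of w f c] by simp

lemma homog_signof: "homog w f \<Longrightarrow> homog w (signof p * f)"
  by (auto simp: sign_def homog_def in_keys_iff)

lemma homog_single: "homog (weight \<mu>) (single \<mu> c)"
  by (simp add: homog_def)

lemma homog_entry: "homog (\<lambda>x. (if x = i then 1 else 0) + (if x = j then 1 else 0)) (entry i j)"
  unfolding entry_def
  by (intro homog_scale) (auto simp: homog_def Var_def weight_single lookup_quad_mon)

lemma homog_prod:
  "(\<And>i. i \<in> I \<Longrightarrow> homog (w i) (f i)) \<Longrightarrow> homog (\<lambda>x. \<Sum>i\<in>I. w i x) (prod f I)"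
proof (induction I rule: infinite_finite_induct)
  case (insert i I)
  then show ?case by (simp add: homog_mult)
qed (use homog_Const[of 1] in auto)

lemma homog_gen_minor:
  "homog (\<lambda>x. \<Sum>i\<in>{0..<k}. (if x = \<alpha> i then 1 else 0) + (if x = \<beta> i then 1 else 0)) (gen_minor k \<alpha> \<beta>)"
  unfolding gen_minor_expand
proof (intro homog_sum homog_signof)
  fix p assume "p \<in> {p. p permutes {0..<k}}"
  then have p: "p permutes {0..<k}" by simp
  have "homog (\<lambda>x. \<Sum>i\<in>{0..<k}. (if x = \<alpha> i then 1 else 0) + (if x = \<beta> (p i) then 1 else 0))
    (\<Prod>i\<in>{0..<k}. entry (\<alpha> i) (\<beta> (p i)))"
    by (intro homog_prod homog_entry)
  moreover have "(\<Sum>i\<in>{0..<k}. if x = \<beta> (p i) then 1 else 0) = (\<Sum>i\<in>{0..<k}. if x = \<beta> i then 1 else (0::nat))" for x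
    using sum.permute[OF p, of "\<lambda>i. if x = \<beta> i then 1 else (0::nat)"] by (simp add: o_def)
  ultimately show "homog (\<lambda>x. \<Sum>i\<in>{0..<k}. (if x = \<alpha> i then 1 else 0) + (if x = \<beta> i then 1 else 0))
    (\<Prod>i\<in>{0..<k}. entry (\<alpha> i) (\<beta> (p i)))"
    by (simp only: sum.distrib)
qed

lemma homog_orthogonal:
  assumes "homog w f" "homog w' g" "w \<noteq> w'" shows "fischer \<omega> f g = 0"
proof -
  have "keys f \<inter> keys g \<subseteq> {}"
  proof
    fix \<mu> assume "\<mu> \<in> keys f \<inter> keys g"
    then have "weight \<mu> = w" "weight \<mu> = w'" using assms(1,2) unfolding homog_def by auto
    then show "\<mu> \<in> {}" using assms(3) by simp
  qed
  from fischer_superset[OF _ this] show ?thesis by simp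
qed

definition weight_part :: "(nat \<Rightarrow> nat) \<Rightarrow> (nat \<times> nat monomial, real) mpoly \<Rightarrow> (nat \<times> nat monomial, real) mpoly" where
  "weight_part w f = (\<Sum>\<mu>\<in>{\<mu>\<in>keys f. weight \<mu> = w}. single \<mu> (lookup f \<mu>))"

lemma homog_weight_part: "homog w (weight_part w f)"
  unfolding weight_part_def by (intro homog_sum) (auto simp: homog_def)

lemma polys_weight_part: "f \<in> polys V \<Longrightarrow> weight_part w f \<in> polys V"
  unfolding weight_part_def by (intro polys_sum polys_single) (auto simp: polys_iff)

lemma sum_weight_part: "f = (\<Sum>w\<in>weight ` keys f. weight_part w f)"
proof -
  have "(\<Sum>w\<in>weight ` keys f. weight_part w f) = (\<Sum>\<mu>\<in>keys f. single \<mu> (lookup f \<mu>))"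
    unfolding weight_part_def by (rule sum.image_gen[symmetric]) simp
  then show ?thesis using mpoly_sum_monomials[of f] by simp
qed

lemma mon_eval_scale:
  assumes \<mu>: "keys \<mu> \<subseteq> cvars n" and A: "symm A"
  shows "mon_eval (point (\<lambda>i j. t i * t j * A i j)) \<mu> = (\<Prod>i<n. t i ^ weight \<mu> i) * mon_eval (point A) \<mu>"
proof -
  have s: "symm (\<lambda>i j. t i * t j * A i j)" using A by (simp add: symm_def mult.commute)
  have p: "(\<Prod>m<n. t m ^ lookup (quad_mon i j) m) = t i * t j" if "i < n" "j < n" for i j
  proof -
    have "(\<Prod>m<n. t m ^ lookup (quad_mon i j) m) =
        (\<Prod>m<n. (if m = i then t m else 1) * (if m = j then t m else 1))"
      by (rule prod.cong) (auto simp: lookup_quad_mon)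
    then show ?thesis using that by (simp add: prod.distrib)
  qed
  have "mon_eval (point (\<lambda>i j. t i * t j * A i j)) \<mu> =
     (\<Prod>v\<in>keys \<mu>. (\<Prod>m<n. t m ^ lookup (snd v) m) ^ lookup \<mu> v * point A v ^ lookup \<mu> v)"
    unfolding mon_eval_def
  proof (rule prod.cong[OF refl])
    fix v assume "v \<in> keys \<mu>"
    with \<mu> have "v \<in> cvars n" by blast
    then obtain i j where v: "v = cvar i j" "i < n" "j < n" by (rule cvars_cases)
    show "point (\<lambda>i j. t i * t j * A i j) v ^ lookup \<mu> v =
       (\<Prod>m<n. t m ^ lookup (snd v) m) ^ lookup \<mu> v * point A v ^ lookup \<mu> v"
      unfolding power_mult_distrib[symmetric] v(1) point_cvar[OF s] point_cvar[OF A] snd_conv p[OF v(2,3)]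
      by (simp only: mult.left_commute mult.assoc)
  qed
  also have "\<dots> = (\<Prod>v\<in>keys \<mu>. \<Prod>m<n. t m ^ (lookup \<mu> v * lookup (snd v) m)) * mon_eval (point A) \<mu>"
    unfolding prod.distrib mon_eval_def prod_power_distrib power_mult[symmetric]
    by (simp only: mult.commute[of "lookup (snd _) _"])
  also have "(\<Prod>v\<in>keys \<mu>. \<Prod>m<n. t m ^ (lookup \<mu> v * lookup (snd v) m)) = (\<Prod>m<n. t m ^ weight \<mu> m)"
    by (subst prod.swap) (simp add: weight_def power_sum)
  finally show ?thesis .
qed

lemma ev_scale_homog:
  assumes f: "f \<in> polys (cvars n)" and w: "homog w f" and A: "symm A"
  shows "ev (\<lambda>i j. t i * t j * A i j) f = (\<Prod>i<n. t i ^ w i) * ev A f"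
  unfolding poly_eval_def sum_distrib_left
proof (rule sum.cong[OF refl])
  fix \<mu> assume m: "\<mu> \<in> keys f"
  then have "keys \<mu> \<subseteq> cvars n" using f unfolding polys_iff by blast
  from mon_eval_scale[OF this A] m w
  show "lookup f \<mu> * mon_eval (point (\<lambda>i j. t i * t j * A i j)) \<mu> =
    (\<Prod>i<n. t i ^ w i) * (lookup f \<mu> * mon_eval (point A) \<mu>)"
    by (simp add: homog_def)
qed

text \<open>Weights as monomials in the coordinates \<open>t\<close> of the torus, which makes the linear independence of the
characters of the torus an instance of the identity theorem.\<close>

definition weight_mon :: "nat \<Rightarrow> (nat \<Rightarrow> nat) \<Rightarrow> nat monomial" where
  "weight_mon n w = (\<Sum>i<n. single i (w i))"

lemma lookup_weight_mon: "lookup (weight_mon n w) i = (if i < n then w i else 0)"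
  by (auto simp: weight_mon_def lookup_sum lookup_single when_def)

lemma mon_eval_weight_mon: "mon_eval t (weight_mon n w) = (\<Prod>i<n. t i ^ w i)"
proof -
  have "keys (weight_mon n w) \<subseteq> {..<n}" by (auto simp: in_keys_iff lookup_weight_mon split: if_splits)
  from mon_eval_superset[OF _ this] show ?thesis by (simp add: lookup_weight_mon)
qed

text \<open>For \<open>A\<close> of bounded rank, so is \<open>diag(t) A diag(t)\<close>, and there \<open>f\<close> takes the value
\<open>\<Sum>\<^sub>w t\<^sup>w f\<^sub>w(A)\<close>. This vanishes for all \<open>t\<close>, hence so does each \<open>f\<^sub>w(A)\<close>.\<close>

lemma vanishing_weight_part:
  assumes "vanishing n r f" shows "vanishing n r (weight_part w f)"
  unfolding vanishing_def
proof (intro conjI allI impI)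
  have f: "f \<in> polys (cvars n)" using assms by (simp add: vanishing_def)
  then show "weight_part w f \<in> polys (cvars n)" by (rule polys_weight_part)
  fix A assume A: "low_rank r A"
  let ?W = "weight ` keys f"
  have W: "lookup (weight_mon n w) = w" if wW: "w \<in> ?W" for w
  proof
    obtain \<mu> where "\<mu> \<in> keys f" "w = weight \<mu>" using wW by blast
    moreover from this have "keys \<mu> \<subseteq> cvars n" using f unfolding polys_iff by blast
    ultimately show "lookup (weight_mon n w) i = w i" for i
      using weight_outside[of \<mu> n i] by (simp add: lookup_weight_mon)
  qed
  then have inj: "inj_on (weight_mon n) ?W" by (metis inj_onI)
  show "ev A (weight_part w f) = 0"
  proof (cases "w \<in> ?W")
    case True
    have "(\<Sum>m\<in>weight_mon n ` ?W. ev A (weight_part (lookup m) f) * mon_eval t m) = 0" for t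
    proof -
      have "(\<Sum>m\<in>weight_mon n ` ?W. ev A (weight_part (lookup m) f) * mon_eval t m) =
         (\<Sum>w\<in>?W. ev A (weight_part w f) * mon_eval t (weight_mon n w))"
        by (simp add: sum.reindex[OF inj] W)
      also have "\<dots> = (\<Sum>w\<in>?W. ev (\<lambda>i j. t i * t j * A i j) (weight_part w f))"
        by (intro sum.cong refl)
          (simp add: ev_scale_homog[OF polys_weight_part[OF f] homog_weight_part low_rank_symm[OF A]] mon_eval_weight_mon)
      also have "\<dots> = ev (\<lambda>i j. t i * t j * A i j) f"
        using sum_weight_part[of f] by (simp flip: poly_eval_sum)
      also have "\<dots> = 0"
        using assms low_rank_scale[OF A] by (simp add: vanishing_def)
      finally show ?thesis .
    qed
    from poly_eval_zero_imp_coeff_zero[of "{..<n}" "weight_mon n ` ?W" "\<lambda>m. ev A (weight_part (lookup m) f)", OF _ _ _ this, of "weight_mon n w"]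
    show ?thesis using True W[OF True] by (force simp: in_keys_iff lookup_weight_mon split: if_splits)
  next
    case False
    then have "{\<mu>\<in>keys f. weight \<mu> = w} = {}" by blast
    then have "weight_part w f = 0" unfolding weight_part_def by (simp only: sum.empty)
    then show ?thesis by simp
  qed
qed

text \<open>\<open>E\<^sub>a\<^sub>b\<close> changes every weight by \<open>e\<^sub>a - e\<^sub>b\<close>.\<close>

lemma keys_polar:
  assumes "\<mu> \<in> keys (polar n a b f)"
  obtains \<nu> where "\<nu> \<in> keys f"
    "\<And>i. weight \<mu> i + (if i = b then 1 else 0) = weight \<nu> i + (if i = a then 1 else 0)"
proof -
  have "(\<Sum>l<n. lookup (entry a l * partial (cvar b l) f) \<mu>) \<noteq> 0"
    using assms by (simp add: polar_def in_keys_iff lookup_sum)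
  then obtain l where "lookup (entry a l * partial (cvar b l) f) \<mu> \<noteq> 0"
    by (meson sum.not_neutral_contains_not_neutral)
  then have "\<mu> \<in> keys (entry a l * partial (cvar b l) f)" by (simp add: in_keys_iff)
  then obtain x y where xy: "\<mu> = x + y" "x \<in> keys (entry a l)" "y \<in> keys (partial (cvar b l) f)"
    using keys_mult[of "entry a l"] by blast
  have x: "weight x i = (if i = a then 1 else 0) + (if i = l then 1 else 0)" for i
    using xy(2) homog_entry[of a l] unfolding homog_def by simp
  have "y + single (cvar b l) 1 \<in> keys f"
    using xy(3) by (auto simp: in_keys_iff lookup_partial)
  moreover have "weight \<mu> i + (if i = b then 1 else 0) = weight (y + single (cvar b l) 1) i + (if i = a then 1 else 0)" for i
    unfolding xy(1) weight_add x weight_single by (simp add: lookup_quad_mon)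
  ultimately show thesis by (rule that)
qed

section \<open>The determinantal ideal and its orthogonal complement\<close>

definition perp_minors :: "nat \<Rightarrow> nat \<Rightarrow> (nat \<times> nat monomial, real) mpoly \<Rightarrow> bool" where
  "perp_minors n k h \<longleftrightarrow> (\<forall>q \<alpha> \<beta>. (\<forall>i<k. \<alpha> i < n) \<longrightarrow> (\<forall>i<k. \<beta> i < n) \<longrightarrow>
     fischer omega h (q * gen_minor k \<alpha> \<beta>) = 0)"

text \<open>By adjointness this is stability of the ideal generated by the minors: \<open>E\<^sub>b\<^sub>a\<close> is a derivation that maps
minors to combinations of minors.\<close>

lemma perp_minors_polar:
  assumes h: "perp_minors n k h" and a: "a < n" and b: "b < n"
  shows "perp_minors n k (polar n a b h)"
  unfolding perp_minors_def
proof (intro allI impI)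
  fix q \<alpha> \<beta> assume \<alpha>: "\<forall>i<k. \<alpha> i < n" and \<beta>: "\<forall>i<k. \<beta> i < n"
  have z: "fischer omega h (q * gen_minor k \<alpha> \<beta>) = 0"
    if "\<forall>i<k. \<alpha> i < n" "\<forall>i<k. \<beta> i < n" for q \<alpha> \<beta>
    using h that by (simp add: perp_minors_def)
  have 1: "fischer omega h (q * (if c then gen_minor k (\<alpha>(i := b)) \<beta> else 0)) = 0" for c i
    using z[of "\<alpha>(i := b)" \<beta> q] \<alpha> \<beta> b by simp
  have 2: "fischer omega h (q * (if c then gen_minor k \<alpha> (\<beta>(i := b)) else 0)) = 0" for c i
    using z[of \<alpha> "\<beta>(i := b)" q] \<alpha> \<beta> b by simp
  have "q * polar n b a (gen_minor k \<alpha> \<beta>) = Const (1/2) *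
    ((\<Sum>i\<in>{0..<k}. q * (if \<alpha> i = a then gen_minor k (\<alpha>(i := b)) \<beta> else 0)) +
     (\<Sum>j\<in>{0..<k}. q * (if \<beta> j = a then gen_minor k \<alpha> (\<beta>(j := b)) else 0)))"
    using \<alpha> \<beta> by (subst polar_gen_minor) (auto simp: sum_distrib_left distrib_left mult.left_commute)
  then have "fischer omega h (q * polar n b a (gen_minor k \<alpha> \<beta>)) = 0"
    by (simp only: fischer_scale_right fischer_add_right fischer_sum_right 1 2) simp
  then show "fischer omega (polar n a b h) (q * gen_minor k \<alpha> \<beta>) = 0"
    using z[OF \<alpha> \<beta>, of "polar n b a q"] by (simp add: polar_adjoint polar_mult fischer_add_right)
qed

inductive_set det_ideal :: "nat \<Rightarrow> nat \<Rightarrow> (nat \<times> nat monomial, real) mpoly set" for n k where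
  zero: "0 \<in> det_ideal n k"
| step: "x \<in> det_ideal n k \<Longrightarrow> q \<in> polys (cvars n) \<Longrightarrow> (\<And>i. i < k \<Longrightarrow> \<alpha> i < n) \<Longrightarrow>
    (\<And>i. i < k \<Longrightarrow> \<beta> i < n) \<Longrightarrow> x + q * gen_minor k \<alpha> \<beta> \<in> det_ideal n k"

lemma det_ideal_polys: "x \<in> det_ideal n k \<Longrightarrow> x \<in> polys (cvars n)"
  by (induction rule: det_ideal.induct) (auto intro!: polys_add polys_mult polys_gen_minor)

lemma det_ideal_perp_minors: "x \<in> det_ideal n k \<Longrightarrow> perp_minors n k h \<Longrightarrow> fischer omega h x = 0"
  by (induction rule: det_ideal.induct) (auto simp: perp_minors_def fischer_add_right)

lemma det_ideal_add: "x \<in> det_ideal n k \<Longrightarrow> y \<in> det_ideal n k \<Longrightarrow> x + y \<in> det_ideal n k"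
proof (induction rule: det_ideal.induct)
  case (step x q \<alpha> \<beta>)
  then have "(x + y) + q * gen_minor k \<alpha> \<beta> \<in> det_ideal n k" by (intro det_ideal.step) auto
  then show ?case by (simp add: ac_simps)
qed simp

lemma det_ideal_mult: "x \<in> det_ideal n k \<Longrightarrow> q \<in> polys (cvars n) \<Longrightarrow> q * x \<in> det_ideal n k"
proof (induction rule: det_ideal.induct)
  case (step y p \<alpha> \<beta>)
  then have "q * y + (q * p) * gen_minor k \<alpha> \<beta> \<in> det_ideal n k" by (intro det_ideal.step polys_mult) auto
  then show ?case by (simp add: distrib_left mult.assoc)
qed (simp add: det_ideal.zero)

lemma det_ideal_sum: "(\<And>a. a \<in> A \<Longrightarrow> f a \<in> det_ideal n k) \<Longrightarrow> sum f A \<in> det_ideal n k"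
  by (induction A rule: infinite_finite_induct) (auto intro: det_ideal_add det_ideal.zero)

lemma det_ideal_gen_minor:
  assumes "\<And>i. i < k \<Longrightarrow> \<alpha> i < n" "\<And>i. i < k \<Longrightarrow> \<beta> i < n"
  shows "gen_minor k \<alpha> \<beta> \<in> det_ideal n k"
  using det_ideal.step[OF det_ideal.zero polys_1 assms] by simp

text \<open>Laplace expansion along the first row reduces larger minors to smaller ones.\<close>

lemma det_ideal_larger:
  assumes "k \<le> m" "\<And>i. i < m \<Longrightarrow> \<alpha> i < n" "\<And>i. i < m \<Longrightarrow> \<beta> i < n"
  shows "gen_minor m \<alpha> \<beta> \<in> det_ideal n k"
  using assms
proof (induction m arbitrary: \<alpha> \<beta> rule: dec_induct)
  case base
  then show ?case by (intro det_ideal_gen_minor)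
next
  case (step m)
  let ?M = "mat (Suc m) (Suc m) (\<lambda>(i, j). entry (\<alpha> i) (\<beta> j))"
  have "gen_minor (Suc m) \<alpha> \<beta> = (\<Sum>j<Suc m. ?M $$ (0, j) * cofactor ?M 0 j)"
    unfolding gen_minor_def by (rule laplace_expansion_row) auto
  also have "\<dots> \<in> det_ideal n k"
  proof (rule det_ideal_sum)
    fix j assume j: "j \<in> {..<Suc m}"
    let ?a = "\<lambda>i. \<alpha> (if i < 0 then i else Suc i)" and ?b = "\<lambda>i. \<beta> (if i < j then i else Suc i)"
    have "mat_delete ?M 0 j = mat m m (\<lambda>(i, j'). entry (?a i) (?b j'))"
      by (rule eq_matI) (auto simp: mat_delete_def)
    then have cof: "cofactor ?M 0 j = (- 1) ^ j * gen_minor m ?a ?b"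
      by (simp add: cofactor_def gen_minor_def)
    have "gen_minor m ?a ?b \<in> det_ideal n k"
      by (rule step.IH) (use step.prems j in auto)
    moreover have "(- 1) ^ j \<in> polys (cvars n)"
      using polys_uminus[OF polys_1] by (intro polys_power)
    ultimately have "cofactor ?M 0 j \<in> det_ideal n k"
      unfolding cof by (rule det_ideal_mult)
    moreover have "?M $$ (0, j) \<in> polys (cvars n)"
      using j step.prems by (auto intro!: polys_entry)
    ultimately show "?M $$ (0, j) * cofactor ?M 0 j \<in> det_ideal n k"
      by (rule det_ideal_mult)
  qed
  finally show ?case .
qed

lemma gen_minor_cong:
  "(\<And>i. i < k \<Longrightarrow> \<alpha> i = \<alpha>' i) \<Longrightarrow> (\<And>i. i < k \<Longrightarrow> \<beta> i = \<beta>' i) \<Longrightarrow> gen_minor k \<alpha> \<beta> = gen_minor k \<alpha>' \<beta>'"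
  unfolding gen_minor_def by (rule arg_cong[of _ _ det]) (auto intro!: eq_matI)

text \<open>Every coordinate has a nonzero weight, so only finitely many monomials have a given weight.\<close>

lemma weight_sum_bound:
  assumes "keys \<mu> \<subseteq> cvars n"
  shows "lookup \<mu> v \<le> (\<Sum>i<n. weight \<mu> i)"
proof (cases "v \<in> keys \<mu>")
  case True
  with assms have "v \<in> cvars n" by blast
  then obtain a b where v: "v = cvar a b" "a < n" "b < n" by (rule cvars_cases)
  have "lookup \<mu> v \<le> lookup \<mu> v * lookup (snd v) a" by (simp add: v lookup_quad_mon)
  also have "\<dots> \<le> weight \<mu> a" unfolding weight_def using True by (intro member_le_sum) auto
  also have "\<dots> \<le> (\<Sum>i<n. weight \<mu> i)" using v by (intro member_le_sum) auto
  finally show ?thesis .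
qed (simp add: in_keys_iff)

lemma finite_cvars: "finite (cvars n)"
proof -
  have "cvars n \<subseteq> (\<lambda>(i, j). cvar i j) ` ({..<n} \<times> {..<n})"
    by (auto elim!: cvars_cases)
  then show ?thesis by (rule finite_subset) auto
qed

lemma finite_bounded_monomials:
  assumes "finite V" shows "finite {\<mu> :: 'v monomial. keys \<mu> \<subseteq> V \<and> (\<forall>v. lookup \<mu> v \<le> N)}"
proof (rule finite_imageD[of lookup])
  have "finite {f. \<forall>x. (x \<in> V \<longrightarrow> f x \<in> {..N}) \<and> (x \<notin> V \<longrightarrow> f x = 0)}"
    using assms by (intro finite_set_of_finite_funs) auto
  then show "finite (lookup ` {\<mu> :: 'v monomial. keys \<mu> \<subseteq> V \<and> (\<forall>v. lookup \<mu> v \<le> N)})"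
    by (rule rev_finite_subset) (auto simp: in_keys_iff)
qed (auto intro: inj_onI poly_mapping_eqI)

text \<open>Orthogonal decomposition with respect to the determinantal ideal, carried out in a fixed weight, where the
ideal is spanned by finitely many products of a monomial and a minor. Products of other weights
are orthogonal to the remainder for trivial reasons.\<close>

lemma det_ideal_decomp:
  assumes f: "f \<in> polys (cvars n)" and w: "homog w f"
  obtains p h where "f = p + h" "p \<in> det_ideal n k" "h \<in> polys (cvars n)" "homog w h" "perp_minors n k h"
proof -
  let ?M = "{\<mu>. keys \<mu> \<subseteq> cvars n \<and> (\<forall>v. lookup \<mu> v \<le> (\<Sum>i<n. w i))}"
  let ?F = "{..<k} \<rightarrow>\<^sub>E {..<n}"
  define G where "G = {g \<in> (\<lambda>(\<mu>, \<alpha>, \<beta>). single \<mu> 1 * gen_minor k \<alpha> \<beta>) ` (?M \<times> ?F \<times> ?F). homog w g}"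
  have "finite ?M" by (intro finite_bounded_monomials finite_cvars)
  moreover have "finite ?F" by (intro finite_PiE) auto
  ultimately have "finite (?M \<times> ?F \<times> ?F)" by blast
  then have "finite G" unfolding G_def by simp
  then obtain c h where fh: "f = (\<Sum>g\<in>G. Const (c g) * g) + h" and orth: "\<forall>g\<in>G. fischer omega g h = 0"
    using fischer_decomp[of G omega f] omega_pos by blast
  let ?p = "\<Sum>g\<in>G. Const (c g) * g"
  have p: "?p \<in> det_ideal n k"
  proof (intro det_ideal_sum det_ideal_mult polys_Const)
    fix g assume "g \<in> G"
    then obtain \<mu> \<alpha> \<beta> where g: "g = single \<mu> 1 * gen_minor k \<alpha> \<beta>" "keys \<mu> \<subseteq> cvars n" "\<alpha> \<in> ?F" "\<beta> \<in> ?F"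
      unfolding G_def by auto
    show "g \<in> det_ideal n k"
      unfolding g(1) by (intro det_ideal_mult det_ideal_gen_minor polys_single) (use g in auto)
  qed
  have h: "h = f - ?p" using fh by (simp add: algebra_simps)
  have hp: "h \<in> polys (cvars n)" unfolding h by (intro polys_diff f det_ideal_polys[OF p])
  have hw: "homog w h" unfolding h
    by (intro homog_diff w homog_sum homog_scale) (auto simp: G_def)
  have "perp_minors n k h"
    unfolding perp_minors_def
  proof (intro allI impI)
    fix q \<alpha> \<beta> assume \<alpha>: "\<forall>i<k. \<alpha> i < n" and \<beta>: "\<forall>i<k. \<beta> i < n"
    show "fischer omega h (q * gen_minor k \<alpha> \<beta>) = 0"
    proof (induction q rule: mpoly_single_induct)
      case (single \<mu> a)
      let ?g = "single \<mu> 1 * gen_minor k \<alpha> \<beta>"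
      have "fischer omega h ?g = 0"
      proof (cases "fischer omega h ?g = 0")
        case False
        define w' where "w' = (\<lambda>x. \<Sum>i\<in>{0..<k}. (if x = \<alpha> i then 1 else 0) + (if x = \<beta> i then 1 else (0::nat)))"
        have gw: "homog (\<lambda>x. weight \<mu> x + w' x) ?g"
          unfolding w'_def by (intro homog_mult homog_single homog_gen_minor)
        then have ww: "w = (\<lambda>x. weight \<mu> x + w' x)"
          using homog_orthogonal[OF hw gw] False by blast
        \<comment> \<open>A common monomial of \<open>h\<close> and the product shows that \<open>\<mu>\<close> involves only coordinates.\<close>
        have "keys h \<inter> keys ?g \<noteq> {}"
          using False fischer_superset[of "{}" h ?g omega] by auto
        then obtain \<nu> where \<nu>: "\<nu> \<in> keys h" "\<nu> \<in> keys ?g" by blast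
        then obtain \<kappa> where "\<nu> = \<mu> + \<kappa>" using keys_mult[of "single \<mu> 1"] by fastforce
        moreover have "keys \<nu> \<subseteq> cvars n" using \<nu>(1) hp unfolding polys_iff by blast
        ultimately have \<mu>: "keys \<mu> \<subseteq> cvars n"
          by (force simp: in_keys_iff lookup_add)
        have "lookup \<mu> v \<le> (\<Sum>i<n. w i)" for v
          using weight_sum_bound[OF \<mu>, of v] unfolding ww by (simp add: sum.distrib)
        then have "\<mu> \<in> ?M" using \<mu> by blast
        moreover have "restrict \<alpha> {..<k} \<in> ?F" "restrict \<beta> {..<k} \<in> ?F" using \<alpha> \<beta> by auto
        ultimately have "(\<mu>, restrict \<alpha> {..<k}, restrict \<beta> {..<k}) \<in> ?M \<times> ?F \<times> ?F" by blast
        moreover have "?g = single \<mu> 1 * gen_minor k (restrict \<alpha> {..<k}) (restrict \<beta> {..<k})"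
          by (intro arg_cong2[where f = "(*)"] gen_minor_cong) auto
        ultimately have "?g \<in> (\<lambda>(\<mu>, \<alpha>, \<beta>). single \<mu> 1 * gen_minor k \<alpha> \<beta>) ` (?M \<times> ?F \<times> ?F)"
          by (intro image_eqI) (simp_all only: prod.case)
        moreover have "homog w ?g" using gw unfolding ww[symmetric] .
        ultimately have "?g \<in> G" unfolding G_def by (intro CollectI conjI)
        then have "fischer omega ?g h = 0" using orth by (rule bspec[rotated])
        then show ?thesis by (simp only: fischer_commute[of omega h])
      qed
      moreover have "single \<mu> a * gen_minor k \<alpha> \<beta> = Const a * ?g"
        unfolding mult.assoc[symmetric] Const_times_single by simp
      ultimately show ?case by (simp only: fischer_scale_right mult_zero_right)
    qed (simp add: distrib_right fischer_add_right)
  qed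
  with that fh p hp hw show thesis by blast
qed

section \<open>Highest weight vectors\<close>

text \<open>Highest weight vectors, without a condition on the weight: the polynomials killed by all operators that replace an index by a smaller one.\<close>

definition unip_inv :: "nat \<Rightarrow> (nat \<times> nat monomial, real) mpoly \<Rightarrow> bool" where
  "unip_inv n f \<longleftrightarrow> f \<in> polys (cvars n) \<and> (\<forall>a b. a < b \<longrightarrow> b < n \<longrightarrow> polar n a b f = 0)"

abbreviation "lead_minor j \<equiv> gen_minor j (\<lambda>i. i) (\<lambda>i. i)"

definition diag_form :: "(nat \<Rightarrow> real) \<Rightarrow> nat \<Rightarrow> nat \<Rightarrow> real" where
  "diag_form d i j = (if i = j then d i else 0)"

lemma symm_diag_form: "symm (diag_form d)"
  by (auto simp: symm_def diag_form_def)

text \<open>Infinitesimal invariance integrates: the derivative along the shear vanishes at all times.\<close>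

lemma ev_shear_unip_inv:
  assumes f: "unip_inv n f" and A: "symm A" and u: "\<And>k. k \<le> a \<Longrightarrow> u k = 0"
  shows "ev (shear a u t A) f = ev A f"
proof -
  have z: "u k * ev (shear a u t A) (polar n a k f) = 0" if "k < n" for k t
    using f u[of k] that by (cases "k \<le> a") (auto simp: unip_inv_def)
  have "((\<lambda>t. ev (shear a u t A) f) has_real_derivative 0) (at t)" for t
  proof -
    have "2 * (\<Sum>k<n. u k * ev (shear a u t A) (polar n a k f)) = 0"
      using z by (subst sum.neutral) auto
    then show ?thesis
      using shear_has_derivative[of f n A u a t] f A u[of a] by (simp add: unip_inv_def)
  qed
  then have "ev (shear a u t A) f = ev (shear a u 0 A) f"
    using DERIV_isconst_all[of "\<lambda>t. ev (shear a u t A) f" t 0] by blast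
  then show ?thesis by simp
qed

text \<open>Replacing an index \<open>b < j\<close> by a smaller one produces two equal rows or columns.\<close>

lemma unip_inv_lead_minor:
  assumes "j \<le> n" shows "unip_inv n (lead_minor j)"
  unfolding unip_inv_def
proof (intro conjI allI impI)
  show "lead_minor j \<in> polys (cvars n)" using assms by (intro polys_gen_minor) auto
  fix a b assume ab: "a < b" "b < n"
  have 1: "(if i = b then gen_minor j ((\<lambda>i. i)(i := a)) (\<lambda>i. i) else 0) = 0" if "i \<in> {0..<j}" for i
    using that ab gen_minor_repeat(1)[of a j b "(\<lambda>i. i)(b := a)" "\<lambda>i. i"] by auto
  have 2: "(if i = b then gen_minor j (\<lambda>i. i) ((\<lambda>i. i)(i := a)) else 0) = 0" if "i \<in> {0..<j}" for i
    using that ab gen_minor_repeat(2)[of a j b "(\<lambda>i. i)(b := a)" "\<lambda>i. i"] by auto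
  show "polar n a b (lead_minor j) = 0"
    using assms by (subst polar_gen_minor) (simp_all add: 1 2 del: fun_upd_apply)
qed

lemma ev_lead_minor_diag:
  assumes s: "symm A" and z: "\<And>p q. p < j \<Longrightarrow> q < j \<Longrightarrow> p \<noteq> q \<Longrightarrow> A p q = 0"
  shows "ev A (lead_minor j) = (\<Prod>i<j. A i i)"
proof -
  let ?M = "mat j j (\<lambda>(p, q). A p q)"
  have "ev A (lead_minor j) = det ?M" by (rule ev_gen_minor[OF s])
  also have "\<dots> = prod_list (diag_mat ?M)"
    by (rule det_upper_triangular[of _ j]) (auto simp: z upper_triangular_def)
  also have "diag_mat ?M = map (\<lambda>i. A i i) [0..<j]"
    by (auto simp: diag_mat_def)
  also have "prod_list \<dots> = (\<Prod>i<j. A i i)"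
    by (simp add: prod.distinct_set_conv_list[symmetric] atLeast0LessThan)
  finally show ?thesis .
qed

lemma ev_lead_minor_diag_form: "ev (diag_form d) (lead_minor j) = (\<Prod>i<j. d i)"
  by (subst ev_lead_minor_diag[OF symm_diag_form]) (auto simp: diag_form_def)

text \<open>Symmetric Gaussian elimination. The pivot is nonzero because the product of the first \<open>k + 1\<close> pivots is a
leading principal minor, which the preceding shears leave unchanged.\<close>

lemma ldl_reduction:
  assumes A: "symm A" and nz: "\<And>j. j \<le> n \<Longrightarrow> ev A (lead_minor j) \<noteq> 0" and "k \<le> n"
  shows "\<exists>B. symm B \<and> (\<forall>i j. i \<noteq> j \<longrightarrow> min i j < k \<longrightarrow> B i j = 0) \<and>
    (\<forall>f. unip_inv n f \<longrightarrow> ev B f = ev A f)"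
  using assms(3)
proof (induction k)
  case 0
  then show ?case using A by blast
next
  case (Suc k)
  then obtain B where s: "symm B" and B: "\<And>i j. i \<noteq> j \<Longrightarrow> min i j < k \<Longrightarrow> B i j = 0"
    and f: "\<And>f. unip_inv n f \<Longrightarrow> ev B f = ev A f" by force
  have "ev B (lead_minor (Suc k)) = (\<Prod>i<Suc k. B i i)"
    by (intro ev_lead_minor_diag s B) auto
  moreover have "ev B (lead_minor (Suc k)) \<noteq> 0"
    using Suc.prems nz f[OF unip_inv_lead_minor] by simp
  ultimately have p: "B k k \<noteq> 0" by simp
  \<comment> \<open>The shear that clears row and column \<open>k\<close> with the pivot.\<close>
  define u where "u i = (if i \<le> k then 0 else - B i k / B k k)" for i
  let ?C = "shear k u 1 B"
  have sB: "B i j = B j i" for i j using s by (simp add: symm_def)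
  have "?C i j = 0" if "i \<noteq> j" "min i j < Suc k" for i j
  proof -
    consider "min i j < k" | "i = k" "j > k" | "j = k" "i > k"
      using \<open>i \<noteq> j\<close> \<open>min i j < Suc k\<close> by linarith
    then show ?thesis
    proof cases
      case 1
      then have "i < k \<or> j < k" by auto
      then show ?thesis
      proof
        assume i: "i < k"
        then have "B i j = 0" "B i k = 0" using B \<open>i \<noteq> j\<close> by auto
        with i show ?thesis by (simp add: shear_def u_def)
      next
        assume j: "j < k"
        then have "B i j = 0" "B k j = 0" using B \<open>i \<noteq> j\<close> by auto
        with j show ?thesis by (simp add: shear_def u_def)
      qed
    next
      case 2
      then show ?thesis using p by (simp add: shear_def u_def sB[of j k])
    next
      case 3
      then show ?thesis using p by (simp add: shear_def u_def)
    qed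
  qed
  moreover have "ev ?C g = ev A g" if "unip_inv n g" for g
    using ev_shear_unip_inv[OF that s, of k u 1] f[OF that] by (simp add: u_def)
  ultimately show ?case using symm_shear[OF s] by blast
qed

lemma ev_cong:
  assumes "f \<in> polys (cvars n)" "symm A" "symm B" "\<And>i j. i < n \<Longrightarrow> j < n \<Longrightarrow> A i j = B i j"
  shows "ev A f = ev B f"
proof (rule poly_eval_cong[OF assms(1)])
  fix v assume "v \<in> cvars n"
  then obtain i j where "v = cvar i j" "i < n" "j < n" by (rule cvars_cases)
  then show "point A v = point B v" using assms(2-4) by (simp add: point_cvar)
qed

lemma ldl:
  assumes A: "symm A" and nz: "\<And>j. j \<le> n \<Longrightarrow> ev A (lead_minor j) \<noteq> 0"
  obtains d where "\<And>f. unip_inv n f \<Longrightarrow> ev A f = ev (diag_form d) f"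
proof -
  obtain B where s: "symm B" and B: "\<And>i j. i \<noteq> j \<Longrightarrow> min i j < n \<Longrightarrow> B i j = 0"
    and f: "\<And>f. unip_inv n f \<Longrightarrow> ev B f = ev A f"
    using ldl_reduction[OF A nz order_refl] by blast
  have "ev A g = ev (diag_form (\<lambda>i. B i i)) g" if "unip_inv n g" for g
  proof -
    have "ev B g = ev (diag_form (\<lambda>i. B i i)) g"
      using that B by (intro ev_cong[of g n] s symm_diag_form) (auto simp: unip_inv_def diag_form_def)
    with f[OF that] show ?thesis by simp
  qed
  then show thesis by (rule that)
qed

text \<open>Only monomials in the diagonal coordinates \<open>c\<^sub>i\<^sub>i\<close> survive on diagonal matrices, and among them the one of weight
\<open>w\<close> is unique: \<open>c\<^sub>i\<^sub>i\<close> contributes \<open>2 e\<^sub>i\<close> to the weight.\<close>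

lemma ev_diag_form_homog:
  assumes f: "f \<in> polys (cvars n)" and w: "homog w f"
  shows "ev (diag_form d) f = ev (diag_form (\<lambda>_. 1)) f * (\<Prod>i<n. d i ^ (w i div 2))"
proof -
  have *: "mon_eval (point (diag_form d)) \<mu> = mon_eval (point (diag_form (\<lambda>_. 1))) \<mu> * (\<Prod>i<n. d i ^ (weight \<mu> i div 2))"
    if \<mu>: "keys \<mu> \<subseteq> cvars n" for \<mu>
  proof (cases "\<exists>i j. i \<noteq> j \<and> cvar i j \<in> keys \<mu>")
    case True
    then obtain i j where ij: "i \<noteq> j" "cvar i j \<in> keys \<mu>" by blast
    have "mon_eval (point (diag_form d)) \<mu> = 0" for d
      unfolding mon_eval_def
      using ij by (intro prod_zero) (auto intro!: bexI[of _ "cvar i j"] simp: point_cvar[OF symm_diag_form] diag_form_def in_keys_iff)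
    then show ?thesis by simp
  next
    case False
    let ?c = "\<lambda>i. cvar i i"
    have sub: "keys \<mu> \<subseteq> ?c ` {..<n}"
    proof
      fix v assume v: "v \<in> keys \<mu>"
      with \<mu> have "v \<in> cvars n" by blast
      then obtain i j where "v = cvar i j" "i < n" "j < n" by (rule cvars_cases)
      moreover from this False v have "i = j" by blast
      ultimately show "v \<in> ?c ` {..<n}" by auto
    qed
    have inj: "inj_on ?c {..<n}" by (auto simp: inj_on_def quad_mon_eq_iff)
    have me: "mon_eval (point (diag_form d)) \<mu> = (\<Prod>i<n. d i ^ lookup \<mu> (?c i))" for d
      by (subst mon_eval_superset[OF _ sub])
        (simp_all add: prod.reindex[OF inj] point_cvar[OF symm_diag_form] diag_form_def)
    have "weight \<mu> i = 2 * lookup \<mu> (?c i)" if "i < n" for i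
    proof -
      have "weight \<mu> i = (\<Sum>k<n. lookup \<mu> (?c k) * lookup (quad_mon k k) i)"
        by (subst weight_superset[OF _ sub]) (simp_all add: sum.reindex[OF inj])
      also have "\<dots> = (\<Sum>k<n. if i = k then 2 * lookup \<mu> (?c k) else 0)"
        by (rule sum.cong) (simp_all add: lookup_quad_mon)
      finally have "weight \<mu> i = (\<Sum>k<n. if i = k then 2 * lookup \<mu> (?c k) else 0)" .
      then show ?thesis using that by simp
    qed
    then have "(\<Prod>i<n. d i ^ (weight \<mu> i div 2)) = (\<Prod>i<n. d i ^ lookup \<mu> (?c i))"
      by (intro prod.cong) auto
    then show ?thesis by (simp add: me)
  qed
  show ?thesis
    unfolding poly_eval_def sum_distrib_right
  proof (rule sum.cong[OF refl])
    fix \<mu> assume m: "\<mu> \<in> keys f"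
    then have "keys \<mu> \<subseteq> cvars n" using f unfolding polys_iff by blast
    from *[OF this] m w
    show "lookup f \<mu> * mon_eval (point (diag_form d)) \<mu> =
        lookup f \<mu> * mon_eval (point (diag_form (\<lambda>_. 1))) \<mu> * (\<Prod>i<n. d i ^ (w i div 2))"
      by (simp add: homog_def)
  qed
qed

text \<open>Highest weights are dominant. On the matrix that is the identity except for the block
\<open>[[t, 1], [1, 0]]\<close> at positions \<open>i, i + 1\<close>, elimination gives the pivots \<open>t\<close> and \<open>-1/t\<close>, so for \<open>t \<noteq> 0\<close> the
value of \<open>h\<close> is \<open>\<plusminus>h(1) t\<^bsup>m i - m (i + 1)\<^esup>\<close>. As a polynomial in \<open>t\<close> it is bounded near \<open>t = 0\<close>, which
excludes a negative exponent.\<close>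

lemma dominant:
  assumes h: "unip_inv n h" and w: "homog w h" and a: "ev (diag_form (\<lambda>_. 1)) h \<noteq> 0" and i: "Suc i < n"
  shows "w (Suc i) div 2 \<le> w i div 2"
proof (rule ccontr)
  define m where "m i = w i div 2" for i
  assume "\<not> w (Suc i) div 2 \<le> w i div 2"
  then have lt: "m i < m (Suc i)" by (simp add: m_def)
  define c where "c = m (Suc i) - m i"
  let ?a = "ev (diag_form (\<lambda>_. 1)) h"
  have hp: "h \<in> polys (cvars n)" using h by (simp add: unip_inv_def)
  define A where "A t p q = (if p = i \<and> q = i then t else if p = Suc i \<and> q = Suc i then 0
    else if p = q \<or> (p = i \<and> q = Suc i) \<or> (p = Suc i \<and> q = i) then 1 else 0)" for t :: real and p q
  have s: "symm (A t)" for t by (auto simp: symm_def A_def)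
  have val: "t ^ c * ev (A t) h = (- 1) ^ m (Suc i) * ?a" if t: "t \<noteq> 0" for t
  proof -
    define u where "u p = (if p = Suc i then - 1 / t else 0)" for p
    define d where "d p = (if p = i then t else if p = Suc i then - 1 / t else 1)" for p
    have "shear i u 1 (A t) = diag_form d"
    proof (intro ext)
      fix p q
      have "i \<noteq> Suc i" by simp
      then show "shear i u 1 (A t) p q = diag_form d p q"
        using t by (auto simp: shear_def diag_form_def A_def u_def d_def field_simps power2_eq_square)
    qed
    then have "ev (A t) h = ev (diag_form d) h"
      using ev_shear_unip_inv[OF h s[of t], of i u 1] by (simp add: u_def)
    also have "\<dots> = ?a * (\<Prod>p<n. d p ^ m p)"
      unfolding m_def by (rule ev_diag_form_homog[OF hp w])
    also have "(\<Prod>p<n. d p ^ m p) = (\<Prod>p<n. (if p = i then t ^ m i else 1) *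
        (if p = Suc i then (- 1 / t) ^ m (Suc i) else 1))"
      by (rule prod.cong) (auto simp: d_def)
    also have "\<dots> = t ^ m i * (- 1 / t) ^ m (Suc i)"
      using i by (simp add: prod.distrib)
    finally have "ev (A t) h = ?a * (t ^ m i * (- 1 / t) ^ m (Suc i))" .
    moreover have "t ^ c * (t ^ m i * (- 1 / t) ^ m (Suc i)) = (- 1) ^ m (Suc i)"
    proof -
      have "t ^ c * t ^ m i = t ^ m (Suc i)" using lt by (simp add: c_def flip: power_add)
      then have "t ^ c * (t ^ m i * (- 1 / t) ^ m (Suc i)) = (t * (- 1 / t)) ^ m (Suc i)"
        by (simp only: mult.assoc[symmetric] power_mult_distrib)
      then show ?thesis using t by simp
    qed
    ultimately show ?thesis by (simp add: mult_ac)
  qed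
  have "((\<lambda>t. ev (A t) h) has_real_derivative
     (\<Sum>k<n. \<Sum>l<n. diag_form (\<lambda>p. if p = i then 1 else 0) k l * ev (A 0) (partial (cvar k l) h))) (at 0)"
  proof (rule ev_has_derivative[OF hp s symm_diag_form])
    fix k l
    show "((\<lambda>t. A t k l) has_real_derivative diag_form (\<lambda>p. if p = i then 1 else 0) k l) (at 0)"
      by (cases "k = i \<and> l = i") (auto simp: A_def diag_form_def)
  qed
  then have "isCont (\<lambda>t. t ^ c * ev (A t) h) 0"
    by (intro continuous_intros) (rule DERIV_isCont)
  then have "(\<lambda>t. t ^ c * ev (A t) h) \<midarrow>0\<rightarrow> 0"
    using lt by (simp add: isCont_def c_def power_0_left split: if_splits)
  moreover have "((\<lambda>t. t ^ c * ev (A t) h) \<longlongrightarrow> (- 1) ^ m (Suc i) * ?a) (at 0)"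
    by (rule tendsto_eventually) (auto simp: eventually_at_filter val)
  ultimately have "(- 1) ^ m (Suc i) * ?a = 0"
    using LIM_unique by blast
  with a show False by simp
qed

text \<open>Multiplying by the leading minors gives a polynomial that vanishes everywhere, and there are no zero divisors:
the lexicographic order of the coordinate indices orders the monomials, so leading terms multiply.\<close>

lemma zero_if_generic_zero:
  assumes q: "q \<in> polys (cvars n)"
    and z: "\<And>A. symm A \<Longrightarrow> (\<And>j. j \<le> n \<Longrightarrow> ev A (lead_minor j) \<noteq> 0) \<Longrightarrow> ev A q = 0"
  shows "q = 0"
proof -
  interpret comm_ring_hom "ev A" for A by (rule poly_eval_ring_hom)
  have "q * (\<Prod>j\<le>n. lead_minor j) = 0"
  proof (rule ev_zero_imp_zero)
    show "q * (\<Prod>j\<le>n. lead_minor j) \<in> polys (cvars n)"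
      using q by (auto intro!: polys_mult polys_prod polys_gen_minor)
    fix A assume "symm A"
    then show "ev A (q * (\<Prod>j\<le>n. lead_minor j)) = 0"
      using z[of A] by (auto simp: hom_mult hom_prod)
  qed
  moreover have "lead_minor j \<noteq> 0" for j
    using ev_lead_minor_diag_form[of "\<lambda>_. 1" j] by force
  ultimately show ?thesis by simp
qed

text \<open>Summation by parts in multiplicative form, expressing a monomial in the pivots by the leading minors.\<close>

lemma prod_telescope:
  fixes d :: "nat \<Rightarrow> real"
  assumes "\<And>i. Suc i \<le> n \<Longrightarrow> m (Suc i) \<le> m i"
  shows "(\<Prod>i<n. (\<Prod>p<Suc i. d p) ^ (m i - m (Suc i))) * (\<Prod>p<n. d p) ^ m n = (\<Prod>p<n. d p ^ m p)"
  using assms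
proof (induction n)
  case (Suc n)
  let ?D = "\<Prod>p<Suc n. d p"
  have "?D ^ (m n - m (Suc n)) * ?D ^ m (Suc n) = ?D ^ m n"
    using Suc.prems[of n] by (simp del: prod.lessThan_Suc flip: power_add)
  also have "\<dots> = (\<Prod>p<n. d p) ^ m n * d n ^ m n"
    by (simp add: power_mult_distrib)
  finally have e: "?D ^ (m n - m (Suc n)) * ?D ^ m (Suc n) = (\<Prod>p<n. d p) ^ m n * d n ^ m n" .
  have "(\<Prod>i<Suc n. (\<Prod>p<Suc i. d p) ^ (m i - m (Suc i))) * ?D ^ m (Suc n) =
     (\<Prod>i<n. (\<Prod>p<Suc i. d p) ^ (m i - m (Suc i))) * (?D ^ (m n - m (Suc n)) * ?D ^ m (Suc n))"
    by (simp only: prod.lessThan_Suc[of _ n] mult.assoc)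
  also have "\<dots> = (\<Prod>p<n. d p ^ m p) * d n ^ m n"
    unfolding e using Suc.IH Suc.prems by (simp only: mult.assoc[symmetric])
  finally show ?case by simp
qed simp

text \<open>By the LDL decomposition, \<open>h\<close> equals \<open>h(1)\<close> times the product of the \<open>\<delta>\<^sub>i\<^sub>+\<^sub>1\<^bsup>m i - m (i + 1)\<^esup>\<close> at
generic matrices, hence as a polynomial. On the diagonal matrix with \<open>r\<close> ones its value is zero, so
\<open>m i > 0\<close> for some \<open>i \<ge> r\<close>; since \<open>m\<close> drops to zero at \<open>n\<close>, some later exponent is positive.\<close>

lemma unip_inv_homog_in_det_ideal:
  assumes van: "vanishing n r h" and h: "unip_inv n h" and w: "homog w h"
  shows "h \<in> det_ideal n (Suc r)"
proof (cases "h = 0")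
  case True
  then show ?thesis by (simp add: det_ideal.zero)
next
  case False
  interpret comm_ring_hom "ev A" for A by (rule poly_eval_ring_hom)
  have hp: "h \<in> polys (cvars n)" using h by (simp add: unip_inv_def)
  define a where "a = ev (diag_form (\<lambda>_. 1)) h"
  define m where "m i = (if i < n then w i div 2 else 0)" for i
  have evd: "ev (diag_form d) h = a * (\<Prod>i<n. d i ^ m i)" for d
    unfolding ev_diag_form_homog[OF hp w, of d] a_def m_def by simp
  have a: "a \<noteq> 0"
  proof
    assume "a = 0"
    have "h = 0"
    proof (rule zero_if_generic_zero[OF hp])
      fix A assume "symm A" "\<And>j. j \<le> n \<Longrightarrow> ev A (lead_minor j) \<noteq> 0"
      then obtain d where "\<And>f. unip_inv n f \<Longrightarrow> ev A f = ev (diag_form d) f" using ldl by blast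
      from this[OF h] \<open>a = 0\<close> evd show "ev A h = 0" by simp
    qed
    with False show False by simp
  qed
  have dec: "m (Suc i) \<le> m i" for i
    using dominant[OF h w a[unfolded a_def], of i] by (auto simp: m_def)
  define e where "e i = m i - m (Suc i)" for i
  let ?Q = "Const a * (\<Prod>i<n. lead_minor (Suc i) ^ e i)"
  have Qp: "?Q \<in> polys (cvars n)"
    by (auto intro!: polys_mult polys_prod polys_power polys_gen_minor)
  have "h - ?Q = 0"
  proof (rule zero_if_generic_zero)
    show "h - ?Q \<in> polys (cvars n)" using hp Qp by (rule polys_diff)
    fix A assume "symm A" "\<And>j. j \<le> n \<Longrightarrow> ev A (lead_minor j) \<noteq> 0"
    then obtain d where d: "\<And>f. unip_inv n f \<Longrightarrow> ev A f = ev (diag_form d) f" using ldl by blast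
    have "ev A ?Q = a * (\<Prod>i<n. ev A (lead_minor (Suc i)) ^ e i)"
      by (simp add: hom_mult hom_prod hom_power)
    also have "(\<Prod>i<n. ev A (lead_minor (Suc i)) ^ e i) = (\<Prod>i<n. (\<Prod>p<Suc i. d p) ^ e i)"
    proof (rule prod.cong[OF refl])
      fix i assume "i \<in> {..<n}"
      then have "unip_inv n (lead_minor (Suc i))" by (intro unip_inv_lead_minor) auto
      from d[OF this] show "ev A (lead_minor (Suc i)) ^ e i = (\<Prod>p<Suc i. d p) ^ e i"
        by (simp only: ev_lead_minor_diag_form)
    qed
    also have "\<dots> = (\<Prod>p<n. d p ^ m p)"
      using prod_telescope[of n m d] dec by (simp add: e_def m_def[of n])
    also have "a * \<dots> = ev A h" using d[OF h] evd by simp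
    finally show "ev A (h - ?Q) = 0" by (simp add: poly_eval_diff)
  qed
  then have hQ: "h = ?Q" by simp
  define d where "d i = (if i < r then 1 else 0 :: real)" for i
  have "low_rank r (diag_form d)"
    unfolding low_rank_def
  proof (intro exI ext)
    fix i j
    have "(\<Sum>k<r. 1 * (if k = i then 1 else 0) * (if k = j then 1 else 0 :: real)) =
       (\<Sum>k<r. if k = i then if i = j then 1 else 0 else 0)"
      by (rule sum.cong) auto
    then show "diag_form d i j = (\<Sum>k<r. 1 * (if k = i then 1 else 0) * (if k = j then 1 else 0))"
      by (auto simp: diag_form_def d_def)
  qed
  then have "ev (diag_form d) h = 0" using van by (simp add: vanishing_def)
  with a evd obtain i where i: "i < n" "d i ^ m i = 0" by auto
  then have "r \<le> i" "m i > 0" by (auto simp: d_def power_0_left split: if_splits)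
  have "\<exists>p. i \<le> p \<and> p < n \<and> e p > 0"
  proof (rule ccontr)
    assume "\<not> ?thesis"
    then have c: "m (Suc p) = m p" if "i \<le> p" "p < n" for p
      using that dec[of p] by (auto simp: e_def)
    have "m p = m i" if "i \<le> p" "p \<le> n" for p
      using that by (induction p rule: dec_induct) (auto simp: c)
    from this[of n] i \<open>m i > 0\<close> show False by (simp add: m_def)
  qed
  then obtain p where p: "i \<le> p" "p < n" "e p > 0" by blast
  then obtain e' where e': "e p = Suc e'" using gr0_implies_Suc by blast
  have "?Q = (Const a * lead_minor (Suc p) ^ e' * (\<Prod>i\<in>{..<n} - {p}. lead_minor (Suc i) ^ e i)) * lead_minor (Suc p)"
    using p by (subst prod.remove[of _ p]) (auto simp: e' mult_ac)
  also have "\<dots> \<in> det_ideal n (Suc r)"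
    using p \<open>r \<le> i\<close> by (intro det_ideal_mult det_ideal_larger polys_mult polys_Const polys_power polys_prod polys_gen_minor) auto
  finally show ?thesis using hQ by simp
qed

section \<open>The vanishing ideal of the matrices of bounded rank\<close>

text \<open>Induction on \<open>\<Sum>i. i w\<^sub>i\<close>, which decreases when an index is replaced by a smaller one. By the induction
hypothesis all these replacements kill \<open>h\<close>, so \<open>h\<close> is a highest weight vector, lies in the ideal, and is
orthogonal to itself.\<close>

lemma vanishing_perp_minors_zero:
  assumes "vanishing n r h" "perp_minors n (Suc r) h" "homog w h"
  shows "h = 0"
  using assms
proof (induction "\<Sum>i<n. i * w i" arbitrary: h w rule: less_induct)
  case less
  have hp: "h \<in> polys (cvars n)" using less.prems by (simp add: vanishing_def)
  have "polar n a b h = 0" if ab: "a < b" "b < n" for a b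
  proof (rule ccontr)
    let ?g = "polar n a b h"
    assume nz: "?g \<noteq> 0"
    then obtain \<mu>0 where \<mu>0: "\<mu>0 \<in> keys ?g" by (metis keys_eq_empty ex_in_conv)
    have k: "weight \<mu> i + (if i = b then 1 else 0) = w i + (if i = a then 1 else 0)" if \<mu>: "\<mu> \<in> keys ?g" for \<mu> i
    proof -
      from \<mu> obtain \<nu> where "\<nu> \<in> keys h"
        "weight \<mu> i + (if i = b then 1 else 0) = weight \<nu> i + (if i = a then 1 else 0)"
        by (rule keys_polar) blast
      with less.prems(3) show ?thesis by (simp add: homog_def)
    qed
    have "weight \<mu> = weight \<mu>0" if "\<mu> \<in> keys ?g" for \<mu>
    proof
      fix i show "weight \<mu> i = weight \<mu>0 i" using k[OF that, of i] k[OF \<mu>0, of i] by simp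
    qed
    then have hom: "homog (weight \<mu>0) ?g" by (simp add: homog_def)
    have "(\<Sum>i<n. i * weight \<mu>0 i) + b = (\<Sum>i<n. i * (weight \<mu>0 i + (if i = b then 1 else 0)))"
      using ab by (simp add: distrib_left sum.distrib if_distrib[of "\<lambda>x. _ * x"] cong: if_cong)
    also have "\<dots> = (\<Sum>i<n. i * (w i + (if i = a then 1 else 0)))"
      by (simp only: k[OF \<mu>0])
    also have "\<dots> = (\<Sum>i<n. i * w i) + a"
      using ab by (simp add: distrib_left sum.distrib if_distrib[of "\<lambda>x. _ * x"] cong: if_cong)
    finally have "(\<Sum>i<n. i * weight \<mu>0 i) < (\<Sum>i<n. i * w i)" using ab by linarith
    from less.hyps[OF this _ _ hom] have "?g = 0"
      using vanishing_polar[OF less.prems(1)] perp_minors_polar[OF less.prems(2)] ab by simp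
    with nz show False by simp
  qed
  then have "unip_inv n h" using hp by (simp add: unip_inv_def)
  then have "h \<in> det_ideal n (Suc r)" using less.prems by (intro unip_inv_homog_in_det_ideal)
  then have "fischer omega h h = 0" using less.prems(2) by (rule det_ideal_perp_minors)
  then show "h = 0" using fischer_pos[of omega h] omega_pos by fastforce
qed

text \<open>The matrix is a product of square matrices of which the first, padded with zeros, has the zero column \<open>r\<close>.\<close>

lemma det_low_rank:
  fixes b c :: "nat \<Rightarrow> nat \<Rightarrow> 'a::comm_ring_1"
  assumes "r < m"
  shows "det (mat m m (\<lambda>(i, j). \<Sum>k<r. b i k * c k j)) = 0"
proof -
  let ?B = "mat m m (\<lambda>(i, k). if k < r then b i k else 0)"
  let ?C = "mat m m (\<lambda>(k, j). c k j)"
  have "mat m m (\<lambda>(i, j). \<Sum>k<r. b i k * c k j) = ?B * ?C"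
  proof (rule eq_matI)
    fix i j assume "i < dim_row (?B * ?C)" "j < dim_col (?B * ?C)"
    then have ij: "i < m" "j < m" by auto
    then have "(?B * ?C) $$ (i, j) = (\<Sum>k\<in>{0..<m}. (if k < r then b i k else 0) * c k j)"
      by (simp add: scalar_prod_def)
    also have "\<dots> = (\<Sum>k<r. b i k * c k j)"
      using assms by (intro sum.mono_neutral_cong_right) auto
    finally show "mat m m (\<lambda>(i, j). \<Sum>k<r. b i k * c k j) $$ (i, j) = (?B * ?C) $$ (i, j)"
      using ij by simp
  qed auto
  moreover have "det ?B = 0"
  proof -
    have "det ?B = (\<Sum>i<m. ?B $$ (i, r) * cofactor ?B i r)"
      using assms by (intro laplace_expansion_column) auto
    also have "\<dots> = 0" using assms by (intro sum.neutral) auto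
    finally show ?thesis .
  qed
  ultimately show ?thesis by (simp add: det_mult[of _ m])
qed

lemma vanishing_gen_minor:
  assumes "\<And>i. i < Suc r \<Longrightarrow> \<alpha> i < n" "\<And>i. i < Suc r \<Longrightarrow> \<beta> i < n"
  shows "vanishing n r (gen_minor (Suc r) \<alpha> \<beta>)"
  unfolding vanishing_def
proof (intro conjI allI impI)
  show "gen_minor (Suc r) \<alpha> \<beta> \<in> polys (cvars n)" using assms by (rule polys_gen_minor)
  fix A assume A: "low_rank r A"
  then obtain w l where "A = (\<lambda>i j. \<Sum>k<r. w k * l k i * l k j)" by (auto simp: low_rank_def)
  then show "ev A (gen_minor (Suc r) \<alpha> \<beta>) = 0"
    unfolding ev_gen_minor[OF low_rank_symm[OF A]]
    using det_low_rank[of r "Suc r" "\<lambda>i k. w k * l k (\<alpha> i)" "\<lambda>k j. l k (\<beta> j)"] by simp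
qed

lemma det_ideal_vanishing: "f \<in> det_ideal n (Suc r) \<Longrightarrow> vanishing n r f"
proof (induction rule: det_ideal.induct)
  case zero
  then show ?case by (simp add: vanishing_def)
next
  case (step x q \<alpha> \<beta>)
  then show ?case
    using vanishing_gen_minor[of r \<alpha> n \<beta>]
    by (auto simp: vanishing_def poly_eval_add poly_eval_mult intro!: polys_add polys_mult)
qed

text \<open>Each weight part of \<open>f\<close> also vanishes on the matrices of bounded rank. Subtracting its component in the
ideal leaves a vanishing polynomial orthogonal to the ideal, which is zero.\<close>

lemma vanishing_iff_det_ideal: "vanishing n r f \<longleftrightarrow> f \<in> det_ideal n (Suc r)"
proof
  assume f: "vanishing n r f"
  have "weight_part w f \<in> det_ideal n (Suc r)" for w
  proof -
    have v: "vanishing n r (weight_part w f)" by (rule vanishing_weight_part[OF f])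
    then have "weight_part w f \<in> polys (cvars n)" by (simp add: vanishing_def)
    then obtain p h where ph: "weight_part w f = p + h" "p \<in> det_ideal n (Suc r)" "h \<in> polys (cvars n)"
      "homog w h" "perp_minors n (Suc r) h"
      using det_ideal_decomp[OF _ homog_weight_part] by blast
    have "ev A h = 0" if "low_rank r A" for A
    proof -
      have "ev A (p + h) = 0" using v that unfolding ph(1) vanishing_def by blast
      moreover have "ev A p = 0" using det_ideal_vanishing[OF ph(2)] that by (simp add: vanishing_def)
      ultimately show ?thesis by (simp add: poly_eval_add)
    qed
    then have "vanishing n r h" using ph(3) by (simp add: vanishing_def)
    then have "h = 0" using ph(4,5) by (intro vanishing_perp_minors_zero)
    with ph show ?thesis by simp
  qed
  then have "(\<Sum>w\<in>weight ` keys f. weight_part w f) \<in> det_ideal n (Suc r)" by (intro det_ideal_sum)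
  then show "f \<in> det_ideal n (Suc r)" using sum_weight_part[of f] by simp
qed (rule det_ideal_vanishing)

section \<open>Minors as generators of an ideal\<close>

text \<open>The permutation sends each position to the rank of its row index among all the chosen ones.\<close>

lemma gen_minor_sort_rows:
  assumes inj: "inj_on \<alpha> {0..<k}"
  obtains p where "gen_minor k \<alpha> \<beta> = signof p * gen_minor k (pick (\<alpha> ` {0..<k})) \<beta>"
proof -
  define I where "I = \<alpha> ` {0..<k}"
  have c: "card I = k" "finite I" unfolding I_def using card_image[OF inj] by auto
  define p where "p i = (if i < k then card {a \<in> I. a < \<alpha> i} else i)" for i
  have pk: "pick I (p i) = \<alpha> i" if "i < k" for i
    using that pick_card_in_set[of "\<alpha> i" I] by (simp add: p_def I_def)
  have pl: "p i < k" if "i < k" for i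
  proof -
    have "{a \<in> I. a < \<alpha> i} \<subset> I" using that by (auto simp: I_def)
    then show ?thesis using psubset_card_mono[OF c(2)] c(1) that by (simp add: p_def)
  qed
  then have sub: "p ` {0..<k} \<subseteq> {0..<k}" by auto
  have "inj_on p {0..<k}"
    by (rule inj_onI) (metis atLeastLessThan_iff inj inj_onD pk)
  then have "bij_betw p {0..<k} {0..<k}"
    using sub endo_inj_surj[of "{0..<k}" p] by (auto simp: bij_betw_def)
  then have p: "p permutes {0..<k}"
    by (rule bij_imp_permutes) (simp add: p_def)
  let ?M = "mat k k (\<lambda>(i, j). entry (pick I i) (\<beta> j))"
  have "gen_minor k \<alpha> \<beta> = det (mat k k (\<lambda>(i, j). ?M $$ (p i, j)))"
    unfolding gen_minor_def
    by (rule arg_cong[of _ _ det]) (auto intro!: eq_matI simp: pk pl)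
  also have "\<dots> = signof p * gen_minor k (pick I) \<beta>"
    unfolding gen_minor_def by (rule det_permute_rows[OF _ p]) simp
  finally show thesis using that unfolding I_def by blast
qed

lemma generic_quad_mat_entry: "generic_quad_mat n = mat n n (\<lambda>(i, j). entry i j)"
  by (simp add: generic_quad_mat_def entry_def)

lemma pick_less:
  assumes "I \<subseteq> {..<n}" "card I = k" "i < k" shows "pick I i < n"
  using pick_in_set_le[of i I] assms by auto

lemma minor_eq_gen_minor:
  assumes "I \<subseteq> {..<n}" "J \<subseteq> {..<n}" "card I = k" "card J = k"
  shows "det (submatrix (generic_quad_mat n) I J) = gen_minor k (pick I) (pick J)"
proof -
  have 1: "{i. i < n \<and> i \<in> I} = I" "{i. i < n \<and> i \<in> J} = J" using assms by auto
  show ?thesis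
    unfolding gen_minor_def submatrix_def generic_quad_mat_entry
    by (rule arg_cong[of _ _ det]) (auto intro!: eq_matI simp: 1 assms pick_less[OF assms(1,3)] pick_less[OF assms(2,4)])
qed

text \<open>Unless an index is repeated, sorting the row and the column indices changes a minor only by a sign.\<close>

lemma gen_minor_minor:
  assumes \<alpha>: "\<And>i. i < k \<Longrightarrow> \<alpha> i < n" and \<beta>: "\<And>i. i < k \<Longrightarrow> \<beta> i < n"
  obtains s M where "gen_minor k \<alpha> \<beta> = s * M" "s \<in> polys (cvars n)" "M \<in> minors k (generic_quad_mat n)"
  | "gen_minor k \<alpha> \<beta> = 0"
proof (cases "inj_on \<alpha> {0..<k} \<and> inj_on \<beta> {0..<k}")
  case True
  let ?I = "\<alpha> ` {0..<k}" and ?J = "\<beta> ` {0..<k}"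
  let ?D = "det (submatrix (generic_quad_mat n) ?I ?J)"
  obtain p where p: "gen_minor k \<alpha> \<beta> = signof p * gen_minor k (pick ?I) \<beta>"
    using gen_minor_sort_rows[of \<alpha> k \<beta>] True by blast
  obtain q where q: "gen_minor k \<beta> (pick ?I) = signof q * gen_minor k (pick ?J) (pick ?I)"
    using gen_minor_sort_rows[of \<beta> k "pick ?I"] True by blast
  have IJ: "?I \<subseteq> {..<n}" "?J \<subseteq> {..<n}" "card ?I = k" "card ?J = k"
    using \<alpha> \<beta> True by (auto simp: card_image)
  have D: "?D = gen_minor k (pick ?J) (pick ?I)"
    using minor_eq_gen_minor[OF IJ] gen_minor_commute[of k "pick ?J" "pick ?I"] by simp
  have "gen_minor k (pick ?I) \<beta> = signof q * ?D"
    unfolding D using gen_minor_commute[of k "pick ?I" \<beta>] q by simp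
  then have "gen_minor k \<alpha> \<beta> = (signof p * signof q) * ?D"
    using p by (simp only: mult.assoc)
  moreover have "?D \<in> minors k (generic_quad_mat n)"
    unfolding minors_def by (rule CollectI, intro exI[of _ ?I] exI[of _ ?J])
      (use IJ in \<open>simp add: generic_quad_mat_def\<close>)
  moreover have "signof p * signof q \<in> polys (cvars n)"
    by (auto simp: sign_def intro: polys_uminus)
  ultimately show thesis using that(1) by blast
next
  case False
  then have "gen_minor k \<alpha> \<beta> = 0"
    unfolding inj_on_def using gen_minor_repeat(1)[of _ k _ \<alpha> \<beta>] gen_minor_repeat(2)[of _ k _ \<beta> \<alpha>]
    by (metis atLeastLessThan_iff)
  then show thesis by (rule that(2))
qed

lemma minors_subset_det_ideal: "minors k (generic_quad_mat n) \<subseteq> det_ideal n k"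
proof
  fix M assume "M \<in> minors k (generic_quad_mat n)"
  then obtain I J where IJ: "M = det (submatrix (generic_quad_mat n) I J)"
    "I \<subseteq> {..<n}" "J \<subseteq> {..<n}" "card I = k" "card J = k"
    by (auto simp: minors_def generic_quad_mat_def)
  show "M \<in> det_ideal n k"
    unfolding IJ(1) minor_eq_gen_minor[OF IJ(2-5)] using IJ by (intro det_ideal_gen_minor pick_less)
qed

lemma ideal_det_ideal: "ideal (det_ideal n k) (poly_ring (cvars n))"
proof -
  interpret cring "poly_ring (cvars n) :: (nat \<times> nat monomial, real) mpoly ring" by (rule cring_poly_ring)
  let ?R = "poly_ring (cvars n) :: (nat \<times> nat monomial, real) mpoly ring"
  have inv: "\<ominus>\<^bsub>?R\<^esub> x = - x" if "x \<in> polys (cvars n)" for x :: "(nat \<times> nat monomial, real) mpoly"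
    using minus_equality[of "- x" x] that polys_uminus[OF that] by (simp add: poly_ring_def)
  show ?thesis
  proof (rule idealI)
    show "ring ?R" by (rule ring_axioms)
    show "subgroup (det_ideal n k) (add_monoid ?R)"
    proof
      show "det_ideal n k \<subseteq> carrier (add_monoid ?R)" using det_ideal_polys by auto
      fix x y assume xy: "x \<in> det_ideal n k" "y \<in> det_ideal n k"
      then show "x \<otimes>\<^bsub>add_monoid ?R\<^esub> y \<in> det_ideal n k"
        by (simp add: poly_ring_def det_ideal_add)
      have "- x = Const (- 1) * x" by (simp add: Const_def single_uminus)
      then have "- x \<in> det_ideal n k" using det_ideal_mult[OF xy(1) polys_Const[of "-1"]] by simp
      then show "inv\<^bsub>add_monoid ?R\<^esub> x \<in> det_ideal n k"
        using inv[OF det_ideal_polys[OF xy(1)]] by (simp add: a_inv_def)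
    next
      show "\<one>\<^bsub>add_monoid ?R\<^esub> \<in> det_ideal n k" by (simp add: poly_ring_def det_ideal.zero)
    qed
    fix a x assume "a \<in> det_ideal n k" "x \<in> carrier ?R"
    then have "x * a \<in> det_ideal n k" by (rule det_ideal_mult)
    then show "x \<otimes>\<^bsub>?R\<^esub> a \<in> det_ideal n k" "a \<otimes>\<^bsub>?R\<^esub> x \<in> det_ideal n k"
      by (simp_all add: poly_ring_def mult.commute)
  qed
qed

lemma Idl_minors: "Idl\<^bsub>poly_ring (cvars n)\<^esub> (minors k (generic_quad_mat n)) = det_ideal n k"
proof (rule antisym)
  interpret cring "poly_ring (cvars n) :: (nat \<times> nat monomial, real) mpoly ring" by (rule cring_poly_ring)
  let ?R = "poly_ring (cvars n) :: (nat \<times> nat monomial, real) mpoly ring"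
  let ?S = "minors k (generic_quad_mat n)"
  show "Idl\<^bsub>?R\<^esub> ?S \<subseteq> det_ideal n k"
    by (rule genideal_minimal[OF ideal_det_ideal minors_subset_det_ideal])
  have S: "?S \<subseteq> carrier ?R" using minors_subset_det_ideal det_ideal_polys by blast
  interpret J: ideal "Idl\<^bsub>?R\<^esub> ?S" ?R by (rule genideal_ideal[OF S])
  have ops: "x \<oplus>\<^bsub>?R\<^esub> y = x + y" "x \<otimes>\<^bsub>?R\<^esub> y = x * y" "\<zero>\<^bsub>?R\<^esub> = 0" for x y
    by (simp_all add: poly_ring_def)
  note add = J.a_closed[unfolded ops] and mult = J.I_l_closed[unfolded ops]
    and zeroI = additive_subgroup.zero_closed[OF J.additive_subgroup_axioms, unfolded ops]
  show "det_ideal n k \<subseteq> Idl\<^bsub>?R\<^esub> ?S"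
  proof
    fix x assume "x \<in> det_ideal n k"
    then show "x \<in> Idl\<^bsub>?R\<^esub> ?S"
    proof (induction rule: det_ideal.induct)
      case zero
      show ?case by (rule zeroI)
    next
      case (step x q \<alpha> \<beta>)
      have "gen_minor k \<alpha> \<beta> \<in> Idl\<^bsub>?R\<^esub> ?S"
        using step.hyps(3,4)
      proof (rule gen_minor_minor)
        fix s M assume g: "gen_minor k \<alpha> \<beta> = s * M" and s: "s \<in> polys (cvars n)" and M: "M \<in> ?S"
        have "M \<in> Idl\<^bsub>?R\<^esub> ?S" using genideal_self[OF S] M by (rule subsetD)
        then show ?thesis unfolding g using s by (rule mult)
      next
        assume "gen_minor k \<alpha> \<beta> = 0"
        then show ?thesis using zeroI by (simp only:)
      qed
      then have "q * gen_minor k \<alpha> \<beta> \<in> Idl\<^bsub>?R\<^esub> ?S" using step.hyps(2) by (rule mult)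
      with step.IH show ?case by (rule add)
    qed
  qed
qed

section \<open>Orthogonal systems of a symmetric form\<close>

definition bilin :: "nat \<Rightarrow> (nat \<Rightarrow> nat \<Rightarrow> real) \<Rightarrow> (nat \<Rightarrow> real) \<Rightarrow> (nat \<Rightarrow> real) \<Rightarrow> real" where
  "bilin n A x y = (\<Sum>i<n. \<Sum>j<n. x i * A i j * y j)"

lemma bilin_symm: "symm A \<Longrightarrow> bilin n A x y = bilin n A y x"
  unfolding bilin_def
proof (subst sum.swap, intro sum.cong refl)
  fix i j assume "symm A"
  then have "A j i = A i j" by (simp add: symm_def)
  then show "x j * A j i * y i = y i * A i j * x j" by simp
qed

lemma bilin_diff: "bilin n A x (\<lambda>j. y j - z j) = bilin n A x y - bilin n A x z"
  by (simp add: bilin_def right_diff_distrib sum_subtractf)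

lemma bilin_sum: "bilin n A x (\<lambda>j. \<Sum>p\<in>P. c p * z p j) = (\<Sum>p\<in>P. c p * bilin n A x (z p))"
proof (induction P rule: infinite_finite_induct)
  case (insert p P)
  have "bilin n A x (\<lambda>j. \<Sum>p\<in>insert p P. c p * z p j) =
      c p * bilin n A x (z p) + bilin n A x (\<lambda>j. \<Sum>p\<in>P. c p * z p j)"
    using insert.hyps by (simp add: bilin_def distrib_left sum.distrib sum_distrib_left mult_ac)
  with insert show ?case by simp
qed (simp_all add: bilin_def)

lemma bilin_factor:
  assumes "\<And>i j. i < n \<Longrightarrow> j < n \<Longrightarrow> A i j = (\<Sum>k<r. b i k * c k j)"
  shows "bilin n A x y = (\<Sum>k<r. (\<Sum>i<n. x i * b i k) * (\<Sum>j<n. c k j * y j))"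
proof -
  have "bilin n A x y = (\<Sum>i<n. \<Sum>j<n. \<Sum>k<r. x i * b i k * (c k j * y j))"
    unfolding bilin_def
    by (intro sum.cong refl) (simp add: assms sum_distrib_left sum_distrib_right mult_ac)
  also have "\<dots> = (\<Sum>k<r. \<Sum>i<n. \<Sum>j<n. x i * b i k * (c k j * y j))"
  proof -
    have "(\<Sum>j<n. \<Sum>k<r. x i * b i k * (c k j * y j)) = (\<Sum>k<r. \<Sum>j<n. x i * b i k * (c k j * y j))" for i
      by (rule sum.swap)
    then show ?thesis by (simp only:) (rule sum.swap)
  qed
  also have "\<dots> = (\<Sum>k<r. (\<Sum>i<n. x i * b i k) * (\<Sum>j<n. c k j * y j))"
    by (simp add: sum_product)
  finally show ?thesis .
qed

definition low_rank_on :: "nat \<Rightarrow> nat \<Rightarrow> (nat \<Rightarrow> nat \<Rightarrow> real) \<Rightarrow> bool" where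
  "low_rank_on n r A \<longleftrightarrow> (\<exists>B. low_rank r B \<and> (\<forall>i<n. \<forall>j<n. A i j = B i j))"

lemma low_rank_mono:
  assumes "low_rank k B" "k \<le> r" shows "low_rank r B"
proof -
  obtain w l where B: "B = (\<lambda>i j. \<Sum>p<k. w p * l p i * l p j)" using assms by (auto simp: low_rank_def)
  have "B = (\<lambda>i j. \<Sum>p<r. (if p < k then w p else 0) * l p i * l p j)"
    unfolding B using assms(2) by (intro ext sum.mono_neutral_cong_left) auto
  then show ?thesis
    unfolding low_rank_def by (intro exI[of _ "\<lambda>p. if p < k then w p else 0"] exI[of _ l])
qed

text \<open>Polarization: if the quadratic form vanishes, so do its values at \<open>e\<^sub>i\<close>, \<open>e\<^sub>j\<close> and \<open>e\<^sub>i - e\<^sub>j\<close>, and hence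
the entry at \<open>(i, j)\<close>.\<close>

lemma bilin_nonzero:
  assumes "symm A" "i < n" "j < n" "A i j \<noteq> 0"
  obtains y where "bilin n A y y \<noteq> 0"
proof (rule ccontr)
  assume "\<not> thesis"
  then have z: "bilin n A y y = 0" for y using that by blast
  have e: "bilin n A (\<lambda>k. if k = p then 1 else 0) (\<lambda>k. if k = q then 1 else 0) = A p q"
    if "p < n" "q < n" for p q
  proof -
    have "(\<Sum>j<n. (if i = p then 1 else 0) * A i j * (if j = q then 1 else 0)) =
        (\<Sum>j<n. if j = q then if i = p then A p q else 0 else 0)" for i
      by (rule sum.cong) auto
    then show ?thesis using that by (simp add: bilin_def)
  qed
  have "bilin n A (\<lambda>k. (if k = i then 1 else 0) - (if k = j then 1 else 0))
      (\<lambda>k. (if k = i then 1 else 0) - (if k = j then 1 else 0)) = A i i - A i j - (A j i - A j j)"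
    unfolding bilin_diff bilin_symm[OF assms(1), of n "\<lambda>k. _ k - _ k"]
    using assms by (simp add: e)
  moreover have "A i i = 0" "A j j = 0" using e[of i i] e[of j j] z assms by auto
  ultimately have "A i j + A j i = 0" using z by simp
  moreover have "A i j = A j i" using assms(1) by (simp add: symm_def)
  ultimately show False using assms(4) by simp
qed

text \<open>Given \<open>k\<close> orthogonal vectors \<open>x\<^sub>p\<close> of nonzero norm \<open>c\<^sub>p\<close>, consider
\<open>D = A - \<Sum>p<k. (A x\<^sub>p)(A x\<^sub>p)\<^sup>T / c\<^sub>p\<close>. If \<open>D = 0\<close>, then \<open>A\<close> is a sum of \<open>k\<close> squares.
Otherwise some \<open>y\<close> has \<open>y\<^sup>T D y \<noteq> 0\<close>, and its component \<open>z\<close> orthogonal to the \<open>x\<^sub>p\<close> has norm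
\<open>z\<^sup>T A z = y\<^sup>T D y\<close>, so it extends the system.\<close>

lemma orthogonal_system:
  assumes A: "symm A"
  shows "(\<exists>j<k. low_rank_on n j A) \<or>
    (\<exists>x c. (\<forall>i<k. c i \<noteq> 0) \<and> (\<forall>i<k. \<forall>j<k. bilin n A (x i) (x j) = (if i = j then c i else 0)))"
proof (induction k)
  case 0
  then show ?case by simp
next
  case (Suc k)
  then consider j where "j < k" "low_rank_on n j A"
    | x c where "\<And>i. i < k \<Longrightarrow> c i \<noteq> 0"
      "\<And>i j. i < k \<Longrightarrow> j < k \<Longrightarrow> bilin n A (x i) (x j) = (if i = j then c i else (0::real))"
    by blast
  then show ?case
  proof cases
    case 1
    then show ?thesis by (meson less_Suc_eq)
  next
    case 2
    define Ax where "Ax p i = (\<Sum>j<n. A i j * x p j)" for p i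
    define B where "B i j = (\<Sum>p<k. (1 / c p) * Ax p i * Ax p j)" for i j
    have B: "low_rank k B"
      unfolding low_rank_def B_def by (intro exI[of _ "\<lambda>p. 1 / c p"] exI[of _ Ax]) simp
    show ?thesis
    proof (cases "\<forall>i<n. \<forall>j<n. A i j = B i j")
      case True
      then have "low_rank_on n k A" using B by (auto simp: low_rank_on_def)
      then show ?thesis by blast
    next
      case False
      then obtain i j where ij: "i < n" "j < n" "A i j - B i j \<noteq> 0" by auto
      define D where "D i j = A i j - B i j" for i j
      have sD: "symm D" using A low_rank_symm[OF B] by (simp add: symm_def D_def)
      obtain y where y: "bilin n D y y \<noteq> 0"
        using bilin_nonzero[OF sD ij(1,2)] ij(3) by (auto simp: D_def)
      define s where "s p = bilin n A (x p) y" for p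
      have s_eq: "s p = (\<Sum>i<n. Ax p i * y i)" for p
      proof -
        have "s p = bilin n A y (x p)" unfolding s_def by (rule bilin_symm[OF A])
        then show ?thesis
          by (simp add: bilin_def Ax_def sum_distrib_left sum_distrib_right mult_ac)
      qed
      have "bilin n D y y = bilin n A y y - bilin n B y y"
        by (simp add: bilin_def D_def left_diff_distrib right_diff_distrib sum_subtractf)
      also have "bilin n B y y = (\<Sum>p<k. s p * s p / c p)"
      proof -
        have "bilin n B y y = (\<Sum>p<k. (\<Sum>i<n. y i * ((1 / c p) * Ax p i)) * (\<Sum>j<n. Ax p j * y j))"
          by (rule bilin_factor) (simp add: B_def)
        also have "\<dots> = (\<Sum>p<k. s p * s p / c p)"
          by (rule sum.cong) (simp_all add: s_eq sum_distrib_left[symmetric] sum_divide_distrib[symmetric] mult_ac)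
        finally show ?thesis .
      qed
      finally have D: "bilin n D y y = bilin n A y y - (\<Sum>p<k. s p * s p / c p)" .
      define z where "z j = y j - (\<Sum>p<k. (s p / c p) * x p j)" for j
      have Az: "bilin n A u z = bilin n A u y - (\<Sum>p<k. (s p / c p) * bilin n A u (x p))" for u
        unfolding z_def bilin_diff bilin_sum ..
      have xz: "bilin n A (x q) z = 0" if "q < k" for q
      proof -
        have "(\<Sum>p<k. (s p / c p) * bilin n A (x q) (x p)) = (\<Sum>p<k. if p = q then s q else 0)"
          using that 2 by (intro sum.cong) auto
        then show ?thesis using that by (simp add: Az s_def[symmetric])
      qed
      then have zx: "bilin n A z (x q) = 0" if "q < k" for q
        using that bilin_symm[OF A] by metis
      have "bilin n A z z = bilin n A y z"
        using zx bilin_symm[OF A, of n z y] by (simp add: Az)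
      also have "\<dots> = bilin n D y y"
        unfolding D Az by (simp add: s_def bilin_symm[OF A, of n y "x _"])
      finally have zz: "bilin n A z z \<noteq> 0" using y by simp
      define x' where "x' i = (if i = k then z else x i)" for i
      define c' where "c' i = (if i = k then bilin n A z z else c i)" for i
      have "\<forall>i<Suc k. c' i \<noteq> 0" using 2 zz by (auto simp: c'_def less_Suc_eq)
      moreover have "\<forall>i<Suc k. \<forall>j<Suc k. bilin n A (x' i) (x' j) = (if i = j then c' i else 0)"
        using 2 xz zx by (auto simp: x'_def c'_def less_Suc_eq)
      ultimately show ?thesis by blast
    qed
  qed
qed

lemma low_rank_or_nondegenerate:
  assumes A: "symm A"
  obtains "low_rank_on n r A"
  | x where "det (mat (Suc r) (Suc r) (\<lambda>(i, j). bilin n A (x i) (x j))) \<noteq> 0"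
proof -
  from orthogonal_system[OF A, of "Suc r" n] show thesis
  proof
    assume "\<exists>j<Suc r. low_rank_on n j A"
    then have "low_rank_on n r A"
      unfolding low_rank_on_def using low_rank_mono by (meson less_Suc_eq_le)
    then show thesis by (rule that(1))
  next
    assume "\<exists>x c. (\<forall>i<Suc r. c i \<noteq> 0) \<and> (\<forall>i<Suc r. \<forall>j<Suc r. bilin n A (x i) (x j) = (if i = j then c i else 0))"
    then obtain x c where c: "\<And>i. i < Suc r \<Longrightarrow> c i \<noteq> 0"
      and x: "\<And>i j. i < Suc r \<Longrightarrow> j < Suc r \<Longrightarrow> bilin n A (x i) (x j) = (if i = j then c i else 0)"
      by blast
    let ?M = "mat (Suc r) (Suc r) (\<lambda>(i, j). bilin n A (x i) (x j))"
    have "det ?M = prod_list (diag_mat ?M)"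
      by (rule det_upper_triangular[of _ "Suc r"]) (auto simp: x upper_triangular_def)
    also have "\<dots> \<noteq> 0"
      using c x by (auto simp: prod_list_zero_iff diag_mat_def)
    finally show thesis by (rule that(2))
  qed
qed

lemma factor_bilin_det_zero:
  assumes "\<And>i j. i < n \<Longrightarrow> j < n \<Longrightarrow> A i j = (\<Sum>k<r. b i k * c k j)"
  shows "det (mat (Suc r) (Suc r) (\<lambda>(i, j). bilin n A (x i) (x j))) = 0"
  using det_low_rank[of r "Suc r" "\<lambda>i k. \<Sum>p<n. x i p * b p k" "\<lambda>k j. \<Sum>q<n. c k q * x j q"]
  by (simp add: bilin_factor[OF assms])

section \<open>Rank and factorizations\<close>

text \<open>The factor \<open>b\<close> lists a maximal independent set of columns, padded with zeros, and \<open>c\<close> contains the coefficients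
of all columns with respect to it.\<close>

lemma rank_le_imp_factor:
  fixes A :: "'a::field mat"
  assumes A: "A \<in> carrier_mat n nc" and r: "vec_space.rank n A \<le> r"
  obtains b c where "\<And>i j. i < n \<Longrightarrow> j < nc \<Longrightarrow> A $$ (i, j) = (\<Sum>k<r. b i k * c k j)"
proof -
  interpret vec_space "TYPE('a)" n .
  let ?C = "set (cols A)"
  have C: "?C \<subseteq> carrier_vec n" using A cols_dim by blast
  obtain S where S: "maximal S (\<lambda>T. T \<subseteq> ?C \<and> lin_indpt T)" "finite S"
    using maximal_exists_superset[of ?C "\<lambda>T. T \<subseteq> ?C \<and> lin_indpt T" "{}"] finite_lin_indpt2[of "{}"]
    by auto
  then have SC: "S \<subseteq> ?C" and ind: "lin_indpt S" by (auto simp: maximal_def)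
  have Sn: "S \<subseteq> carrier_vec n" using SC C by blast
  have card: "card S \<le> r" using rank_card_indpt[OF A S(1)] r by simp
  have "\<exists>a. v = lincomb a S" if v: "v \<in> ?C" for v
  proof -
    have "v \<in> span S"
    proof (rule ccontr)
      assume n: "v \<notin> span S"
      then have "v \<notin> S" using in_own_span[OF Sn] by blast
      then have "lin_indpt (S \<union> {v})"
        using lin_dep_iff_in_span[OF Sn ind _ \<open>v \<notin> S\<close>] n v C by auto
      with S(1) SC v have "S \<union> {v} = S" unfolding maximal_def by (metis Un_insert_right Un_upper1 insert_subset sup_bot.right_neutral)
      with \<open>v \<notin> S\<close> show False by blast
    qed
    then show ?thesis using finite_span[OF S(2) Sn] by auto
  qed
  then obtain a where a: "\<And>v. v \<in> ?C \<Longrightarrow> v = lincomb (a v) S" by metis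
  obtain f where f: "bij_betw f {..<card S} S"
    using ex_bij_betw_nat_finite[OF S(2)] by (auto simp: atLeast0LessThan)
  have "A $$ (i, j) = (\<Sum>k<r. (if k < card S then f k $ i else 0) * a (col A j) (f k))"
    if ij: "i < n" "j < nc" for i j
  proof -
    have "col A j \<in> ?C" using ij A by (auto simp: cols_def)
    then have "col A j $ i = (\<Sum>x\<in>S. a (col A j) x * x $ i)"
      using a lincomb_index[OF ij(1) Sn] by metis
    also have "\<dots> = (\<Sum>k<card S. a (col A j) (f k) * f k $ i)"
      by (rule sum.reindex_bij_betw[OF f, symmetric])
    also have "\<dots> = (\<Sum>k<r. (if k < card S then f k $ i else 0) * a (col A j) (f k))"
      using card by (intro sum.mono_neutral_cong_left) auto
    finally show ?thesis using ij A by simp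
  qed
  then show thesis by (rule that)
qed

lemma factor_imp_rank_le:
  fixes b c :: "nat \<Rightarrow> nat \<Rightarrow> 'a::field"
  shows "vec_space.rank n (mat n nc (\<lambda>(i, j). \<Sum>k<r. b i k * c k j)) \<le> r"
proof (induction r)
  case 0
  have "mat n nc (\<lambda>(i, j). \<Sum>k<0. b i k * c k j) = 0\<^sub>m n nc" by (rule eq_matI) auto
  moreover have "vec_space.rank n (0\<^sub>m n nc :: 'a mat) = 0" by (rule vec_space.rank_0I)
  ultimately show ?case by (simp only: le_refl)
next
  case (Suc r)
  let ?M = "\<lambda>r. mat n nc (\<lambda>(i, j). \<Sum>k<r. b i k * c k j)"
  let ?N = "mat n nc (\<lambda>(i, j). b i r * c r j)"
  have "?M (Suc r) = ?M r + ?N" by (rule eq_matI) auto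
  moreover have "vec_space.rank n (?M r + ?N) \<le> vec_space.rank n (?M r) + vec_space.rank n ?N"
    by (rule vec_space.rank_subadditive[of _ _ nc]) auto
  moreover have "vec_space.rank n ?N \<le> 1"
    by (rule vec_space.rank_le_1_product_entries[of _ _ nc "\<lambda>i. b i r" "\<lambda>j. c r j"]) auto
  ultimately show ?case using Suc.IH by simp
qed

text \<open>A matrix of rank at most \<open>r\<close> factors through dimension \<open>r\<close>, which makes all the Gram determinants
\<open>det (x\<^sub>i\<^sup>T A x\<^sub>j)\<close> of size \<open>r + 1\<close> vanish. Conversely, a sum of \<open>r\<close> matrices of rank one has rank at most \<open>r\<close>.\<close>

lemma rank_le_iff:
  assumes A: "symm A"
  shows "vec_space.rank n (mat n n (\<lambda>(i, j). A i j)) \<le> r \<longleftrightarrow> low_rank_on n r A"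
proof
  assume r: "vec_space.rank n (mat n n (\<lambda>(i, j). A i j)) \<le> r"
  obtain b c where bc: "\<And>i j. i < n \<Longrightarrow> j < n \<Longrightarrow>
      mat n n (\<lambda>(i, j). A i j) $$ (i, j) = (\<Sum>k<r. b i k * c k j)"
    using rank_le_imp_factor[OF _ r, of n] by auto
  show "low_rank_on n r A"
  proof (rule low_rank_or_nondegenerate[OF A])
    fix x assume "det (mat (Suc r) (Suc r) (\<lambda>(i, j). bilin n A (x i) (x j))) \<noteq> 0"
    moreover have "det (mat (Suc r) (Suc r) (\<lambda>(i, j). bilin n A (x i) (x j))) = 0"
      by (rule factor_bilin_det_zero[where b = b and c = c]) (use bc in auto)
    ultimately show ?thesis by simp
  qed
next
  assume "low_rank_on n r A"
  then obtain w l where "\<forall>i<n. \<forall>j<n. A i j = (\<Sum>k<r. w k * l k i * l k j)"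
    by (auto simp: low_rank_on_def low_rank_def)
  then have "mat n n (\<lambda>(i, j). A i j) = mat n n (\<lambda>(i, j). \<Sum>k<r. (w k * l k i) * l k j)"
    by (intro eq_matI) auto
  then show "vec_space.rank n (mat n n (\<lambda>(i, j). A i j)) \<le> r"
    using factor_imp_rank_le[of n n "\<lambda>i k. w k * l k i" l r] by simp
qed

section \<open>The matrices of bounded rank form a closed set\<close>

text \<open>Otherwise some Gram determinant \<open>det (x\<^sub>i\<^sup>T A x\<^sub>j)\<close> of size \<open>r + 1\<close> is nonzero; with the generic matrix in place of
\<open>A\<close>, it is a polynomial that vanishes on all matrices of bounded rank.\<close>

lemma vanishing_imp_low_rank:
  assumes A: "symm A" and van: "\<And>q. vanishing n r q \<Longrightarrow> ev A q = 0"
  shows "low_rank_on n r A"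
proof (rule low_rank_or_nondegenerate[OF A])
  fix x assume nz: "det (mat (Suc r) (Suc r) (\<lambda>(i, j). bilin n A (x i) (x j))) \<noteq> 0"
  define M where "M i j = (\<Sum>p<n. \<Sum>q<n. Const (x i p * x j q) * entry p q)" for i j
  define P where "P = det (mat (Suc r) (Suc r) (\<lambda>(i, j). M i j))"
  have evP: "ev B P = det (mat (Suc r) (Suc r) (\<lambda>(i, j). bilin n B (x i) (x j)))" if B: "symm B" for B
  proof -
    interpret comm_ring_hom "ev B" by (rule poly_eval_ring_hom)
    have "ev B (M i j) = bilin n B (x i) (x j)" for i j
      by (simp add: M_def poly_eval_sum poly_eval_mult ev_entry[OF B] bilin_def mult_ac)
    then show ?thesis
      unfolding P_def hom_det[symmetric]
      by (intro arg_cong[of _ _ det] eq_matI) auto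
  qed
  have "vanishing n r P"
    unfolding vanishing_def
  proof (intro conjI allI impI)
    show "P \<in> polys (cvars n)"
      unfolding P_def M_def by (intro polys_det polys_sum polys_mult polys_Const polys_entry) auto
    fix B assume B: "low_rank r B"
    then obtain w l where "B = (\<lambda>i j. \<Sum>k<r. w k * l k i * l k j)" by (auto simp: low_rank_def)
    then show "ev B P = 0"
      unfolding evP[OF low_rank_symm[OF B]]
      by (intro factor_bilin_det_zero[where b = "\<lambda>i k. w k * l k i" and c = l]) simp
  qed
  from van[OF this] nz show ?thesis unfolding evP[OF A] by simp
qed

section \<open>Networks with one hidden layer\<close>

definition quad_form :: "nat \<Rightarrow> (nat \<Rightarrow> nat \<Rightarrow> real) \<Rightarrow> (nat, real) mpoly" where
  "quad_form n A = (\<Sum>i<n. \<Sum>j<n. single (quad_mon i j) (A i j))"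

lemma lookup_quad_form:
  assumes A: "symm A" and "p < n" "q < n"
  shows "lookup (quad_form n A) (quad_mon p q) = (if p = q then 1 else 2) * A p q"
proof -
  have "lookup (quad_form n A) (quad_mon p q) =
     (\<Sum>i<n. \<Sum>j<n. (if i = p then if j = q then A p q else 0 else 0) +
       (if p = q then 0 else if i = q then if j = p then A p q else 0 else 0))"
    unfolding quad_form_def lookup_sum lookup_single
    using A by (intro sum.cong refl) (auto simp: when_def quad_mon_eq_iff symm_def)
  also have "\<dots> = (\<Sum>i<n. (if i = p then A p q else 0) + (if i = q then if p = q then 0 else A p q else 0))"
    using assms by (intro sum.cong refl) (auto simp: sum.distrib)
  also have "\<dots> = (if p = q then 1 else 2) * A p q"
    using assms by (simp add: sum.distrib)
  finally show ?thesis .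
qed

lemma quad_form_Sym: "quad_form n A \<in> Sym 2 n"
  unfolding Sym_def
proof (intro CollectI subsetI)
  fix m assume "m \<in> keys (quad_form n A)"
  then have "(\<Sum>i<n. \<Sum>j<n. A i j when quad_mon i j = m) \<noteq> 0"
    by (simp add: quad_form_def in_keys_iff lookup_sum lookup_single)
  then obtain i where i: "i < n" "(\<Sum>j<n. A i j when quad_mon i j = m) \<noteq> 0"
    by (meson lessThan_iff sum.not_neutral_contains_not_neutral)
  then obtain j where "j < n" "(A i j when quad_mon i j = m) \<noteq> 0"
    by (meson lessThan_iff sum.not_neutral_contains_not_neutral)
  with i show "m \<in> monomials 2 n" by (auto simp: monomials_2 when_def split: if_splits)
qed

lemma quad_mat_quad_form: "symm A \<Longrightarrow> quad_mat n (quad_form n A) = mat n n (\<lambda>(i, j). A i j)"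
  by (rule eq_matI) (auto simp: quad_mat_def lookup_quad_form)

lemma quad_form_cong: "(\<And>i j. i < n \<Longrightarrow> j < n \<Longrightarrow> A i j = B i j) \<Longrightarrow> quad_form n A = quad_form n B"
  unfolding quad_form_def by (intro sum.cong refl) auto

lemma square_linear_form:
  "(\<Sum>i<n. Const (a i) * Var i)\<^sup>2 = quad_form n (\<lambda>i j. a i * a j)"
proof -
  have "Const (a i) * Var i * (Const (a j) * Var j) = single (quad_mon i j) (a i * a j)" for i j
    by (simp add: Const_def Var_def mult_single quad_mon_def)
  then show ?thesis by (simp add: power2_eq_square sum_product quad_form_def)
qed

lemma quad_form_combination:
  fixes r :: nat
  shows "(\<Sum>k<r. Const (w k) * quad_form n (B k)) = quad_form n (\<lambda>i j. \<Sum>k<r. w k * B k i j)"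
proof (induction r)
  case 0
  then show ?case by (simp add: quad_form_def)
next
  case (Suc r)
  have "Const (w r) * quad_form n (B r) = quad_form n (\<lambda>i j. w r * B r i j)"
    by (simp add: quad_form_def sum_distrib_left Const_times_single)
  with Suc show ?case by (simp add: quad_form_def single_add sum.distrib)
qed

definition form_vec :: "nat \<Rightarrow> (nat \<Rightarrow> nat \<Rightarrow> real) \<Rightarrow> (nat, real) mpoly vec" where
  "form_vec n A = vec 1 (\<lambda>_. quad_form n A)"

text \<open>The hidden unit \<open>k\<close> contributes the square of a linear form, with the matrix \<open>l\<^sub>k l\<^sub>k\<^sup>T\<close> of rank one.\<close>

lemma param_map_shallow:
  assumes W1: "W1 \<in> carrier_mat r n" and W2: "W2 \<in> carrier_mat 1 r"
  shows "param_map [n, r, 1] 2 [W1, W2] =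
    form_vec n (\<lambda>i j. \<Sum>k<r. W2 $$ (0, k) * W1 $$ (k, i) * W1 $$ (k, j))"
proof (rule eq_vecI)
  let ?v = "map_vec (\<lambda>t. t\<^sup>2) (map_mat Const W1 *\<^sub>v vec n Var)"
  have v: "?v $ k = quad_form n (\<lambda>i j. W1 $$ (k, i) * W1 $$ (k, j))" if "k < r" for k
    using that W1 by (simp add: scalar_prod_def atLeast0LessThan square_linear_form)
  fix i assume "i < dim_vec (form_vec n (\<lambda>i j. \<Sum>k<r. W2 $$ (0, k) * W1 $$ (k, i) * W1 $$ (k, j)))"
  then have i: "i = 0" by (simp add: form_vec_def)
  have "param_map [n, r, 1] 2 [W1, W2] $ 0 = (\<Sum>k<dim_vec ?v. row (map_mat Const W2) 0 $ k * ?v $ k)"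
    using W2 by (simp add: param_map_def scalar_prod_def atLeast0LessThan del: index_map_vec)
  also have "\<dots> = (\<Sum>k<r. Const (W2 $$ (0, k)) * ?v $ k)"
    using W1 W2 by (intro sum.cong) auto
  also have "\<dots> = (\<Sum>k<r. Const (W2 $$ (0, k)) * quad_form n (\<lambda>i j. W1 $$ (k, i) * W1 $$ (k, j)))"
    by (intro sum.cong) (auto simp only: v lessThan_iff)
  finally show "param_map [n, r, 1] 2 [W1, W2] $ i =
      form_vec n (\<lambda>i j. \<Sum>k<r. W2 $$ (0, k) * W1 $$ (k, i) * W1 $$ (k, j)) $ i"
    by (simp add: i form_vec_def quad_form_combination mult.assoc)
qed (use W2 in \<open>simp add: param_map_def form_vec_def\<close>)

lemma neuromanifold_shallow: "neuromanifold [n, r, 1] 2 = form_vec n ` {A. low_rank r A}"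
proof (intro equalityI subsetI)
  fix F assume "F \<in> neuromanifold [n, r, 1] 2"
  then obtain Ws where F: "F = param_map [n, r, 1] 2 Ws" and Ws: "Ws \<in> weights [n, r, 1]"
    by (auto simp: neuromanifold_def)
  then have "length Ws = 2" by (simp add: weights_def)
  then obtain W1 W2 where W: "Ws = [W1, W2]" by (auto simp: numeral_2_eq_2 length_Suc_conv)
  then have "W1 \<in> carrier_mat r n" "W2 \<in> carrier_mat 1 r"
    using Ws by (auto simp: weights_def All_less_Suc2 numeral_2_eq_2)
  from param_map_shallow[OF this] show "F \<in> form_vec n ` {A. low_rank r A}"
    unfolding F W low_rank_def by (intro image_eqI) (auto intro!: exI)
next
  fix F assume "F \<in> form_vec n ` {A. low_rank r A}"
  then obtain w l where F: "F = form_vec n (\<lambda>i j. \<Sum>k<r. w k * l k i * l k j)"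
    by (auto simp: low_rank_def)
  define W1 where "W1 = mat r n (\<lambda>(k, i). l k i)"
  define W2 where "W2 = mat 1 r (\<lambda>(_, k). w k)"
  have W: "W1 \<in> carrier_mat r n" "W2 \<in> carrier_mat 1 r" by (simp_all add: W1_def W2_def)
  have "F = param_map [n, r, 1] 2 [W1, W2]"
  proof -
    have "quad_form n (\<lambda>i j. \<Sum>k<r. W2 $$ (0, k) * W1 $$ (k, i) * W1 $$ (k, j)) =
        quad_form n (\<lambda>i j. \<Sum>k<r. w k * l k i * l k j)"
      by (intro quad_form_cong sum.cong) (auto simp: W1_def W2_def)
    then show ?thesis unfolding param_map_shallow[OF W] F form_vec_def by simp
  qed
  moreover have "[W1, W2] \<in> weights [n, r, 1]"
    using W by (auto simp: weights_def less_Suc_eq)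
  ultimately show "F \<in> neuromanifold [n, r, 1] 2" by (auto simp: neuromanifold_def)
qed

lemma coord_index_shallow: "coord_index [n, r, 1] 2 = cvars n"
  by (simp add: coord_index_def cvars_def)

lemma target_space_shallow: "target_space [n, r, 1] 2 = form_vec n ` {A. symm A}"
proof (intro equalityI subsetI)
  fix F assume "F \<in> target_space [n, r, 1] 2"
  then have F: "F \<in> carrier_vec 1" "F $ 0 \<in> Sym 2 n" by (auto simp: target_space_def)
  have t: "transpose_mat (quad_mat n (F $ 0)) = quad_mat n (F $ 0)"
    using bij_betwE[OF quad_mat_bij] F(2) by blast
  define A where "A i j = (if i < n \<and> j < n then quad_mat n (F $ 0) $$ (i, j) else 0)" for i j
  have s: "symm A"
    by (auto simp: symm_def A_def quad_mat_def quad_mon_commute)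
  have "quad_mat n (quad_form n A) = quad_mat n (F $ 0)"
    unfolding quad_mat_quad_form[OF s] by (rule eq_matI) (auto simp: A_def quad_mat_def)
  then have "quad_form n A = F $ 0"
    using bij_betw_imp_inj_on[OF quad_mat_bij] quad_form_Sym F(2) by (metis inj_onD)
  then have "F = form_vec n A" using F(1) by (intro eq_vecI) (auto simp: form_vec_def)
  with s show "F \<in> form_vec n ` {A. symm A}" by blast
qed (use quad_form_Sym in \<open>auto simp: target_space_def form_vec_def\<close>)

lemma eval_coords_form_vec:
  assumes A: "symm A" and q: "q \<in> polys (cvars n)"
  shows "poly_eval (coords (form_vec n A)) q = ev A q"
proof (rule poly_eval_cong[OF q])
  fix v assume "v \<in> cvars n"
  then obtain i j where "v = cvar i j" "i < n" "j < n" by (rule cvars_cases)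
  then show "coords (form_vec n A) v = point A v"
    by (simp add: coords_def form_vec_def lookup_quad_form[OF A] point_cvar[OF A])
qed

lemma vanishing_ideal_shallow:
  "vanishing_ideal [n, r, 1] 2 (neuromanifold [n, r, 1] 2) = {q. vanishing n r q}"
  unfolding vanishing_ideal_def coord_ring_def coord_index_shallow neuromanifold_shallow vanishing_def
  by (auto simp: eval_coords_form_vec[OF low_rank_symm])

lemma form_vec_low_rank:
  assumes A: "symm A"
  shows "form_vec n A \<in> form_vec n ` {A. low_rank r A} \<longleftrightarrow> low_rank_on n r A"
proof
  assume "form_vec n A \<in> form_vec n ` {A. low_rank r A}"
  then obtain B where B: "low_rank r B" "form_vec n A = form_vec n B" by auto
  then have "form_vec n A $ 0 = form_vec n B $ 0" by simp
  then have "quad_form n A = quad_form n B" by (simp add: form_vec_def)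
  then have m: "mat n n (\<lambda>(i, j). A i j) = mat n n (\<lambda>(i, j). B i j)"
    using quad_mat_quad_form[OF A, of n] quad_mat_quad_form[OF low_rank_symm[OF B(1)], of n] by simp
  have "A i j = B i j" if "i < n" "j < n" for i j
    using arg_cong[OF m, of "\<lambda>M. M $$ (i, j)"] that by simp
  then show "low_rank_on n r A" using B(1) by (auto simp: low_rank_on_def)
next
  assume "low_rank_on n r A"
  then obtain B where B: "low_rank r B" "\<forall>i<n. \<forall>j<n. A i j = B i j" by (auto simp: low_rank_on_def)
  then have "quad_form n A = quad_form n B" by (intro quad_form_cong) auto
  then have "form_vec n A = form_vec n B" by (simp add: form_vec_def)
  with B show "form_vec n A \<in> form_vec n ` {A. low_rank r A}" by blast
qed

lemma neurovariety_shallow: "neurovariety [n, r, 1] 2 = neuromanifold [n, r, 1] 2"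
proof (intro equalityI subsetI)
  fix F assume "F \<in> neurovariety [n, r, 1] 2"
  then have F: "F \<in> target_space [n, r, 1] 2"
    and z: "\<And>q. vanishing n r q \<Longrightarrow> poly_eval (coords F) q = 0"
    unfolding neurovariety_def zariski_closure_def vanishing_ideal_shallow by auto
  obtain A where A: "symm A" "F = form_vec n A" using F unfolding target_space_shallow by blast
  have "ev A q = 0" if "vanishing n r q" for q
    using z[OF that] eval_coords_form_vec[OF A(1), of q n] that unfolding A(2) by (simp add: vanishing_def)
  then have "low_rank_on n r A" by (rule vanishing_imp_low_rank[OF A(1)])
  then show "F \<in> neuromanifold [n, r, 1] 2"
    unfolding neuromanifold_shallow A(2) form_vec_low_rank[OF A(1)] .
next
  fix F assume F: "F \<in> neuromanifold [n, r, 1] 2"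
  then have "F \<in> target_space [n, r, 1] 2"
    unfolding neuromanifold_shallow target_space_shallow using low_rank_symm by blast
  with F show "F \<in> neurovariety [n, r, 1] 2"
    unfolding neurovariety_def zariski_closure_def vanishing_ideal_def by simp
qed

lemma neuromanifold_rank:
  "neuromanifold [n, r, 1] 2 =
     {F \<in> target_space [n, r, 1] 2. vec_space.rank n (quad_mat n (F $ 0)) \<le> r}"
proof -
  have "vec_space.rank n (quad_mat n (form_vec n A $ 0)) \<le> r \<longleftrightarrow> form_vec n A \<in> form_vec n ` {A. low_rank r A}"
    if "symm A" for A
    unfolding form_vec_low_rank[OF that] rank_le_iff[OF that, symmetric]
    by (simp add: form_vec_def quad_mat_quad_form[OF that])
  then show ?thesis
    unfolding neuromanifold_shallow target_space_shallow using low_rank_symm by blast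
qed

lemma filling_shallow: "filling [n, r, 1] 2 \<longleftrightarrow> n \<le> r"
proof
  assume "filling [n, r, 1] 2"
  moreover have "form_vec n (diag_form (\<lambda>_. 1)) \<in> target_space [n, r, 1] 2"
    unfolding target_space_shallow using symm_diag_form by blast
  ultimately have "vec_space.rank n (quad_mat n (form_vec n (diag_form (\<lambda>_. 1)) $ 0)) \<le> r"
    unfolding filling_def neurovariety_shallow neuromanifold_rank by blast
  moreover have "quad_mat n (form_vec n (diag_form (\<lambda>_. 1)) $ 0) = 1\<^sub>m n"
    by (simp add: form_vec_def quad_mat_quad_form[OF symm_diag_form]) (auto simp: diag_form_def intro!: eq_matI)
  moreover have "vec_space.rank n (1\<^sub>m n :: real mat) = n"
    using vec_space.det_rank_iff[of "1\<^sub>m n :: real mat" n] by simp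
  ultimately show "n \<le> r" by simp
next
  assume "n \<le> r"
  moreover have "vec_space.rank n (quad_mat n f) \<le> n" for f
    by (rule vec_space.rank_le_nc) (simp add: quad_mat_def)
  ultimately show "filling [n, r, 1] 2"
    unfolding filling_def neurovariety_shallow neuromanifold_rank using order_trans by blast
qed

theorem lemma3p3:
  fixes d0 d1 :: nat
  assumes "d0 > 0" and "d1 > 0"
  shows "neuromanifold [d0, d1, 1] 2 =
           {F \<in> target_space [d0, d1, 1] 2. vec_space.rank d0 (quad_mat d0 (F $ 0)) \<le> d1} \<and>
         neuromanifold [d0, d1, 1] 2 = neurovariety [d0, d1, 1] 2 \<and>
         vanishing_ideal [d0, d1, 1] 2 (neurovariety [d0, d1, 1] 2) =
           Idl\<^bsub>coord_ring [d0, d1, 1] 2\<^esub> (minors (d1 + 1) (generic_quad_mat d0)) \<and>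
         (filling [d0, d1, 1] 2 \<longleftrightarrow> d1 \<ge> d0)"
proof (intro conjI)
  show "vanishing_ideal [d0, d1, 1] 2 (neurovariety [d0, d1, 1] 2) =
           Idl\<^bsub>coord_ring [d0, d1, 1] 2\<^esub> (minors (d1 + 1) (generic_quad_mat d0))"
    unfolding neurovariety_shallow vanishing_ideal_shallow coord_ring_def coord_index_shallow
      Idl_minors vanishing_iff_det_ideal by simp
qed (simp_all only: neuromanifold_rank[symmetric] neurovariety_shallow filling_shallow)

end
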